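(* Let $n\geq2$ and $m\geq1$. The Euclidean balls are not maximizers of the normalized eigenvalue $\xi_m(\Omega)|\partial\Omega|^{3/(n-1)}$ among Euclidean domains $\Omega\subset\mathbb{R}^n$: there exists a smooth bounded domain $\Omega\subset\mathbb{R}^n$ with $\xi_m(\Omega)|\partial\Omega|^{3/(n-1)}>\xi_m(\mathbb{B}^n_1)|\partial\mathbb{B}^n_1|^{3/(n-1)}$.
   Context: For a bounded smooth domain $\Omega\subset\mathbb{R}^n$, $\xi_0(\Omega)=0<\xi_1(\Omega)\leq\xi_2(\Omega)\leq\cdots$ are the eigenvalues, counted with multiplicity, of the fourth-order Steklov problem $\Delta^2u=0$ in $\Omega$, $\partial_\nu u=0$ and $\partial_\nu(\Delta u)+\xi u=0$ on $\partial\Omega$, where $\nu$ is the outward unit normal and $\Delta=\sum_i\partial_i^2$. $|\partial\Omega|$ is the boundary area and $\mathbb{B}^n_1$ is the unit ball. *)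

theory Defs
  imports "HOL-Analysis.Analysis"
begin

fun dd :: "'a::euclidean_space list \<Rightarrow> ('a \<Rightarrow> real) \<Rightarrow> ('a \<Rightarrow> real)" where
  "dd [] f = f"
| "dd (v # vs) f = (\<lambda>x. frechet_derivative (dd vs f) (at x) v)"

text \<open>C-infinity on an open set: all iterated partial derivatives exist (hence are continuous).\<close>
definition smooth_on :: "'a::euclidean_space set \<Rightarrow> ('a \<Rightarrow> real) \<Rightarrow> bool" where
  "smooth_on S f \<longleftrightarrow> open S \<and> (\<forall>vs. set vs \<subseteq> Basis \<longrightarrow> dd vs f differentiable_on S)"

definition grad :: "('a::euclidean_space \<Rightarrow> real) \<Rightarrow> 'a \<Rightarrow> 'a" where
  "grad f x = (\<Sum>b\<in>Basis. dd [b] f x *\<^sub>R b)"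

definition laplacian :: "('a::euclidean_space \<Rightarrow> real) \<Rightarrow> 'a \<Rightarrow> real" where
  "laplacian f x = (\<Sum>b\<in>Basis. dd [b, b] f x)"

definition local_defining :: "'a::euclidean_space set \<Rightarrow> 'a \<Rightarrow> 'a set \<Rightarrow> ('a \<Rightarrow> real) \<Rightarrow> bool" where
  "local_defining \<Omega> p U \<phi> \<longleftrightarrow> open U \<and> p \<in> U \<and> smooth_on U \<phi> \<and>
     (\<forall>x\<in>U. grad \<phi> x \<noteq> 0) \<and> \<Omega> \<inter> U = {x\<in>U. \<phi> x < 0}"

definition smooth_bounded_domain :: "'a::euclidean_space set \<Rightarrow> bool" where
  "smooth_bounded_domain \<Omega> \<longleftrightarrow> open \<Omega> \<and> connected \<Omega> \<and> \<Omega> \<noteq> {} \<and> bounded \<Omega> \<and>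
     (\<forall>p\<in>frontier \<Omega>. \<exists>U \<phi>. local_defining \<Omega> p U \<phi>)"

text \<open>Outward unit normal (independent of the choice of defining function).\<close>
definition outward_normal :: "'a::euclidean_space set \<Rightarrow> 'a \<Rightarrow> 'a" where
  "outward_normal \<Omega> p = (SOME \<nu>. \<exists>U \<phi>. local_defining \<Omega> p U \<phi> \<and>
      \<nu> = (1 / norm (grad \<phi> p)) *\<^sub>R grad \<phi> p)"

definition normal_deriv :: "'a::euclidean_space set \<Rightarrow> ('a \<Rightarrow> real) \<Rightarrow> 'a \<Rightarrow> real" where
  "normal_deriv \<Omega> u p = frechet_derivative u (at p) (outward_normal \<Omega> p)"

definition unit_ball_vol :: "real \<Rightarrow> real" where
  "unit_ball_vol s = pi powr (s / 2) / Gamma (s / 2 + 1)"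

definition hausdorff_measure :: "real \<Rightarrow> 'a::euclidean_space set \<Rightarrow> ennreal" where
  "hausdorff_measure s A = (SUP \<delta>\<in>{0<..}.
      INF C\<in>{C :: nat \<Rightarrow> 'a set. A \<subseteq> (\<Union>i. C i) \<and> (\<forall>i. bounded (C i) \<and> diameter (C i) \<le> \<delta>)}.
        (\<Sum>i. ennreal (unit_ball_vol s * (diameter (C i) / 2) powr s)))"

definition boundary_area :: "'a::euclidean_space set \<Rightarrow> real" where
  "boundary_area \<Omega> = enn2real (hausdorff_measure (real DIM('a) - 1) (frontier \<Omega>))"

text \<open>u (smooth up to the boundary, i.e. smooth on an open neighbourhood of the closure)
  solves  Delta^2 u = 0 in Omega, d_nu u = 0 and d_nu (Delta u) + xi u = 0 on the boundary.\<close>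
definition steklov_solution :: "'a::euclidean_space set \<Rightarrow> real \<Rightarrow> ('a \<Rightarrow> real) \<Rightarrow> bool" where
  "steklov_solution \<Omega> \<xi> u \<longleftrightarrow>
     (\<exists>V. open V \<and> closure \<Omega> \<subseteq> V \<and> smooth_on V u) \<and>
     (\<forall>x\<in>\<Omega>. laplacian (laplacian u) x = 0) \<and>
     (\<forall>p\<in>frontier \<Omega>. normal_deriv \<Omega> u p = 0 \<and>
        normal_deriv \<Omega> (laplacian u) p + \<xi> * u p = 0)"

definition restr :: "'a::euclidean_space set \<Rightarrow> ('a \<Rightarrow> real) \<Rightarrow> ('a \<Rightarrow> real)" where
  "restr \<Omega> u = (\<lambda>x. if x \<in> closure \<Omega> then u x else 0)"

definition lin_indep_fun :: "('a \<Rightarrow> real) set \<Rightarrow> bool" where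
  "lin_indep_fun F \<longleftrightarrow> (\<forall>c. (\<forall>x. (\<Sum>f\<in>F. c f * f x) = 0) \<longrightarrow> (\<forall>f\<in>F. c f = 0))"

text \<open>xi_m, m = 0,1,2,..., counted with multiplicity: the least t such that the eigenspaces
  with eigenvalue at most t contain m+1 linearly independent eigenfunctions.\<close>
definition steklov_eigenvalue :: "nat \<Rightarrow> 'a::euclidean_space set \<Rightarrow> real" where
  "steklov_eigenvalue m \<Omega> = Inf {t. \<exists>F. finite F \<and> card F = Suc m \<and> lin_indep_fun F \<and>
      (\<forall>f\<in>F. \<exists>\<xi> u. \<xi> \<le> t \<and> steklov_solution \<Omega> \<xi> u \<and> f = restr \<Omega> u)}"

end

(* Removing a small concentric ball from the unit ball gives the required domain. With \<open>n = d + 2\<close>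
the eigenvalues of the ball are \<open>k\<^sup>2 (2 k + n)\<close>, with the spherical harmonics of degree \<open>k\<close> as
boundary values. On the annulus with inner radius \<open>e\<close>, every spherical harmonic coefficient of an
eigenfunction solves a fourth-order ordinary differential equation with energy identity
\<open>\<integral> r^(n-1) w\<^sup>2 = \<xi> (c(1)\<^sup>2 + e^(n-1) c(e)\<^sup>2)\<close>, where \<open>w\<close> is the coefficient of the Laplacian.
Pairing \<open>w\<close> with radial harmonic functions bounds the energy from below by
\<open>(k\<^sup>2 (2 k + n) - O(e^(2k+d))) c(1)\<^sup>2 + e^d c(e)\<^sup>2\<close>. So an eigenvalue drops by at most \<open>O(e^n)\<close>,
whereas the boundary area grows by a factor \<open>1 + e^(n-1)\<close>, and the latter wins for small \<open>e\<close>. *)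

theory Submission
  imports Defs
begin

section \<open>Smooth functions and the Laplacian\<close>

text \<open>\<open>steklov_eigenvalue\<close> is an infimum over independent families of
  eigenfunctions, so the two domains are compared on such families and not by min-max. On the ball,
  explicit eigenfunctions bound the infimum from above. On the annulus, let k be the least degree up
  to which \<open>m + 1\<close> independent spherical harmonics exist. A family of
  \<open>m + 1\<close> eigenfunctions with eigenvalues below the claimed bound has a nontrivial
  combination without coefficients of degree < k on the outer sphere; the energy estimates force all
  its remaining coefficients to vanish, and completeness of the spherical harmonics makes the
  combination zero, contradicting independence. The inner boundary values are left free: they enter
  the energy identity with weight e^(d+1) but the energy bound with e^d, so a small e absorbs them.
  Since an infimum of the empty set would have an arbitrary value, eigenfunctions of the annulus
  must also be constructed. The area of the sphere is never computed: scaling, separation,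
  finiteness and positivity of the Hausdorff measure suffice.\<close>

declare dd.simps(2) [simp del]

lemma dd_append: "dd (vs @ ws) f = dd vs (dd ws f)"
  by (induction vs) (auto simp: dd.simps)

lemma dd_pair: "dd [a, b] f = dd [a] (dd [b] f)"
  by (simp add: dd.simps)

lemma has_derivative_imp_dd:
  "(f has_derivative f') (at x) \<Longrightarrow> dd [b] f x = f' b"
  by (metis dd.simps frechet_derivative_at)

text \<open>Differentiability is not among the assumptions: \<open>frechet_derivative\<close> is a
  \<open>SOME\<close> choice, and the predicates it chooses from coincide, so the values agree even
  at points without a derivative.\<close>

lemma frechet_derivative_cong_open:
  assumes "open S" "x \<in> S" "\<And>y. y \<in> S \<Longrightarrow> f y = g y"
  shows "frechet_derivative f (at x) = frechet_derivative g (at x)"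
proof -
  have "(f has_derivative D) (at x) \<longleftrightarrow> (g has_derivative D) (at x)" for D
    using has_derivative_transform_within_open[OF _ assms(1,2), of f D UNIV g]
      has_derivative_transform_within_open[OF _ assms(1,2), of g D UNIV f] assms(3) by auto
  then show ?thesis unfolding frechet_derivative_def by simp
qed

lemma differentiable_cong_open:
  assumes "open S" "x \<in> S" "\<And>y. y \<in> S \<Longrightarrow> f y = g y" "f differentiable (at x)"
  shows "g differentiable (at x)"
  using assms(4) has_derivative_transform_within_open[OF _ assms(1,2), of f _ UNIV g] assms(3)
  unfolding differentiable_def by metis

lemma dd_cong_open:
  assumes "open S" "\<And>y. y \<in> S \<Longrightarrow> f y = g y" "x \<in> S"
  shows "dd vs f x = dd vs g x"
  using assms(3)
proof (induction vs arbitrary: x)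
  case (Cons v vs)
  then show ?case using frechet_derivative_cong_open[OF assms(1), of x "dd vs f" "dd vs g"]
    by (simp add: dd.simps)
qed (use assms in auto)

lemma laplacian_cong_open:
  assumes "open S" "\<And>y. y \<in> S \<Longrightarrow> f y = g y" "x \<in> S"
  shows "laplacian f x = laplacian g x"
  unfolding laplacian_def by (intro sum.cong refl dd_cong_open[OF assms])

lemma dd_const [simp]: "dd [b] (\<lambda>x. c) x = 0"
  by (rule has_derivative_imp_dd) (rule has_derivative_const)

lemma dd_inner [simp]: "dd [b] (\<lambda>x. x \<bullet> a) x = b \<bullet> a"
  by (rule has_derivative_imp_dd) (auto intro!: derivative_eq_intros)

lemma dd_single: "dd [b] f x = frechet_derivative f (at x) b"
  by (simp add: dd.simps)

lemma dd_add:
  fixes f g :: "'a::euclidean_space \<Rightarrow> real"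
  assumes "f differentiable (at x)" "g differentiable (at x)"
  shows "dd [b] (\<lambda>y. f y + g y) x = dd [b] f x + dd [b] g x"
  using has_derivative_imp_dd[OF has_derivative_add[OF assms[unfolded frechet_derivative_works]]]
  by (simp add: dd_single)

lemma dd_mult:
  fixes f g :: "'a::euclidean_space \<Rightarrow> real"
  assumes "f differentiable (at x)" "g differentiable (at x)"
  shows "dd [b] (\<lambda>y. f y * g y) x = f x * dd [b] g x + dd [b] f x * g x"
  using has_derivative_imp_dd[OF has_derivative_mult[OF assms[unfolded frechet_derivative_works]]]
  by (simp add: dd_single)

lemma dd_cmult:
  fixes f :: "'a::euclidean_space \<Rightarrow> real"
  assumes "f differentiable (at x)"
  shows "dd [b] (\<lambda>y. c * f y) x = c * dd [b] f x"
  using dd_mult[OF differentiable_const assms, of b c] by simp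

lemma dd_sum:
  fixes f :: "'i \<Rightarrow> 'a::euclidean_space \<Rightarrow> real"
  assumes "finite I" "\<And>i. i \<in> I \<Longrightarrow> f i differentiable (at x)"
  shows "dd [b] (\<lambda>y. \<Sum>i\<in>I. f i y) x = (\<Sum>i\<in>I. dd [b] (f i) x)"
  using has_derivative_imp_dd[OF has_derivative_sum[of I f "\<lambda>i. frechet_derivative (f i) (at x)"]]
    assms[unfolded frechet_derivative_works] by (simp add: dd_single)

lemma smooth_on_open: "smooth_on S f \<Longrightarrow> open S"
  by (simp add: smooth_on_def)

lemma smooth_on_differentiable:
  "smooth_on S f \<Longrightarrow> x \<in> S \<Longrightarrow> f differentiable (at x)"
  unfolding smooth_on_def
  by (metis dd.simps(1) differentiable_on_eq_differentiable_at empty_set empty_subsetI)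

lemma smooth_on_dd: "smooth_on S f \<Longrightarrow> set ws \<subseteq> Basis \<Longrightarrow> smooth_on S (dd ws f)"
  unfolding smooth_on_def by (metis dd_append le_sup_iff set_append)

lemma smooth_on_continuous: "smooth_on S f \<Longrightarrow> continuous_on S f"
  by (meson continuous_at_imp_continuous_on differentiable_imp_continuous_within
      smooth_on_differentiable)

text \<open>Induction over the list of directions, packaged once: it is enough to exhibit a class of
  differentiable functions closed under partial derivatives. Closure is asked only up to equality on
  \<open>S\<close>, because the concrete formulas for derivatives usually fail elsewhere, for
  instance at the origin.\<close>

lemma smooth_on_coinduct:
  assumes "open S" "P f"
    and diff: "\<And>f x. P f \<Longrightarrow> x \<in> S \<Longrightarrow> f differentiable (at x)"
    and step: "\<And>f b. P f \<Longrightarrow> b \<in> Basis \<Longrightarrow> \<exists>g. P g \<and> (\<forall>x\<in>S. dd [b] f x = g x)"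
  shows "smooth_on S f"
proof -
  have *: "\<exists>g. P g \<and> (\<forall>x\<in>S. dd vs f x = g x)" if "set vs \<subseteq> Basis" for vs
    using that
  proof (induction vs)
    case Nil
    then show ?case using assms(2) by auto
  next
    case (Cons v vs)
    then obtain g where g: "P g" "\<And>x. x \<in> S \<Longrightarrow> dd vs f x = g x" by auto
    obtain h where h: "P h" "\<forall>x\<in>S. dd [v] g x = h x"
      using step[OF g(1), of v] Cons.prems by auto
    have "dd (v # vs) f x = h x" if "x \<in> S" for x
      using dd_cong_open[of S "dd vs f" g x "[v]"] g(2) that h(2) assms(1) dd_append[of "[v]" vs f] by simp
    with h(1) show ?case by blast
  qed
  show ?thesis
    unfolding smooth_on_def
  proof (intro conjI allI impI assms(1))
    fix vs :: "'a list" assume "set vs \<subseteq> Basis"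
    from *[OF this] obtain g where g: "P g" "\<forall>x\<in>S. dd vs f x = g x" by auto
    have "dd vs f differentiable (at x)" if "x \<in> S" for x
      by (rule differentiable_cong_open[OF assms(1) that _ diff[OF g(1) that]]) (simp add: g(2))
    then show "dd vs f differentiable_on S"
      using differentiable_on_eq_differentiable_at[OF assms(1)] by blast
  qed
qed

text \<open>Single products are not closed under the Leibniz rule; finite sums of products are,
  which makes the class fit for \<open>smooth_on_coinduct\<close>.\<close>

inductive smooth_products :: "'a::euclidean_space set \<Rightarrow> ('a \<Rightarrow> real) \<Rightarrow> bool"
  for S where
  times: "smooth_on S f \<Longrightarrow> smooth_on S g \<Longrightarrow> smooth_products S (\<lambda>x. f x * g x)"
| plus: "smooth_products S f \<Longrightarrow> smooth_products S g \<Longrightarrow> smooth_products S (\<lambda>x. f x + g x)"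

lemma smooth_products_differentiable:
  "smooth_products S f \<Longrightarrow> x \<in> S \<Longrightarrow> f differentiable (at x)"
  by (induction rule: smooth_products.induct)
    (auto intro!: differentiable_mult differentiable_add intro: smooth_on_differentiable)

lemma smooth_products_dd:
  "smooth_products S f \<Longrightarrow> b \<in> Basis \<Longrightarrow> \<exists>g. smooth_products S g \<and> (\<forall>x\<in>S. dd [b] f x = g x)"
proof (induction rule: smooth_products.induct)
  case (times f g)
  then show ?case
    by (intro exI[of _ "\<lambda>x. f x * dd [b] g x + dd [b] f x * g x"])
      (auto intro!: smooth_products.intros smooth_on_dd[of _ _ "[b]"]
        dd_mult simp: smooth_on_differentiable)
next
  case (plus f g)
  then obtain f' g' where "smooth_products S f'" "smooth_products S g'"
    "\<forall>x\<in>S. dd [b] f x = f' x" "\<forall>x\<in>S. dd [b] g x = g' x" by blast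
  then show ?case
    using plus.hyps
    by (intro exI[of _ "\<lambda>x. f' x + g' x"])
      (auto intro!: smooth_products.plus
        simp: dd_add smooth_products_differentiable)
qed

lemma smooth_products_smooth: "open S \<Longrightarrow> smooth_products S f \<Longrightarrow> smooth_on S f"
  by (rule smooth_on_coinduct[of S "smooth_products S"])
    (auto intro: smooth_products_differentiable smooth_products_dd)

lemma smooth_on_const: "open S \<Longrightarrow> smooth_on S (\<lambda>x. c)"
  by (rule smooth_on_coinduct[of S "\<lambda>f. \<exists>c. f = (\<lambda>x. c)"]) auto

lemma smooth_on_mult: "smooth_on S f \<Longrightarrow> smooth_on S g \<Longrightarrow> smooth_on S (\<lambda>x. f x * g x)"
  by (rule smooth_products_smooth[OF smooth_on_open smooth_products.times])

lemma smooth_on_add: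
  assumes "smooth_on S f" "smooth_on S g"
  shows "smooth_on S (\<lambda>x. f x + g x)"
proof -
  have S: "open S" and 1: "smooth_on S (\<lambda>x. 1)" using assms smooth_on_open smooth_on_const by auto
  show ?thesis
    \<comment> \<open>A sum lies in the class when written as
      \<open>f x * 1 + g x * 1\<close>.\<close>
    using smooth_products_smooth[OF S smooth_products.plus[OF smooth_products.times[OF assms(1) 1]
          smooth_products.times[OF assms(2) 1]]] by simp
qed

lemma smooth_on_cmult: "smooth_on S f \<Longrightarrow> smooth_on S (\<lambda>x. c * f x)"
  by (intro smooth_on_mult smooth_on_const) (auto dest: smooth_on_open)

lemma smooth_on_diff:
  assumes "smooth_on S f" "smooth_on S g"
  shows "smooth_on S (\<lambda>x. f x - g x)"
  using smooth_on_add[OF assms(1) smooth_on_cmult[OF assms(2), of "-1"]] by simp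

lemma smooth_on_inner:
  fixes a :: "'a::euclidean_space"
  assumes "open S" shows "smooth_on S (\<lambda>x. x \<bullet> a)"
proof (rule smooth_on_coinduct[of S "\<lambda>f. (\<exists>a. f = (\<lambda>x. x \<bullet> a)) \<or> (\<exists>c. f = (\<lambda>x. c))"])
  fix f :: "'a \<Rightarrow> real" and b :: 'a
  assume "(\<exists>a. f = (\<lambda>x. x \<bullet> a)) \<or> (\<exists>c. f = (\<lambda>x. c))"
  then obtain c where "\<forall>x\<in>S. dd [b] f x = c" by (metis dd_inner dd_const)
  then show "\<exists>g. ((\<exists>a. g = (\<lambda>x. x \<bullet> a)) \<or> (\<exists>c. g = (\<lambda>x. c))) \<and> (\<forall>x\<in>S. dd [b] f x = g x)"
    by (intro exI[of _ "\<lambda>x. c"]) auto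
qed (use assms in auto)

lemma smooth_on_sum:
  "open S \<Longrightarrow> (\<And>i. i \<in> I \<Longrightarrow> smooth_on S (f i)) \<Longrightarrow> smooth_on S (\<lambda>x. \<Sum>i\<in>I. f i x)"
  by (induction I rule: infinite_finite_induct) (auto intro: smooth_on_add smooth_on_const)

lemma smooth_on_laplacian:
  assumes "smooth_on S f" shows "smooth_on S (laplacian f)"
proof -
  have "smooth_on S (\<lambda>x. \<Sum>b\<in>Basis. dd [b, b] f x)"
    using assms smooth_on_open[OF assms] smooth_on_dd[OF assms]
    by (intro smooth_on_sum) auto
  then show ?thesis by (simp add: laplacian_def[abs_def])
qed

section \<open>Euler and rotation fields, polar form of the Laplacian\<close>

definition euler_deriv :: "('a::euclidean_space \<Rightarrow> real) \<Rightarrow> 'a \<Rightarrow> real" where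
  "euler_deriv f x = (\<Sum>b\<in>Basis. (x \<bullet> b) * dd [b] f x)"

text \<open>The infinitesimal rotation in the plane of \<open>a\<close> and \<open>b\<close>,
  tangent to all spheres about the origin. With the Euler field r d/dr it replaces polar
  coordinates; both have polynomial coefficients and so preserve smoothness.\<close>

definition rot_deriv :: "'a::euclidean_space \<Rightarrow> 'a \<Rightarrow> ('a \<Rightarrow> real) \<Rightarrow> 'a \<Rightarrow> real" where
  "rot_deriv a b f x = (x \<bullet> a) * dd [b] f x - (x \<bullet> b) * dd [a] f x"

lemma smooth_on_euler_deriv:
  assumes "smooth_on S f" shows "smooth_on S (euler_deriv f)"
proof -
  have "smooth_on S (\<lambda>x. \<Sum>b\<in>Basis. (x \<bullet> b) * dd [b] f x)"
    using assms smooth_on_open[OF assms] smooth_on_dd[OF assms]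
    by (intro smooth_on_sum smooth_on_mult smooth_on_inner) auto
  then show ?thesis by (simp add: euler_deriv_def[abs_def])
qed

lemma smooth_on_rot_deriv:
  assumes "smooth_on S f" "a \<in> Basis" "b \<in> Basis" shows "smooth_on S (rot_deriv a b f)"
proof -
  have "smooth_on S (\<lambda>x. (x \<bullet> a) * dd [b] f x - (x \<bullet> b) * dd [a] f x)"
    using assms smooth_on_open[OF assms(1)] smooth_on_dd[OF assms(1)]
    by (intro smooth_on_diff smooth_on_mult smooth_on_inner) auto
  then show ?thesis by (simp add: rot_deriv_def[abs_def])
qed

lemma euler_deriv_cong_open:
  assumes "open S" "\<And>y. y \<in> S \<Longrightarrow> f y = g y" "x \<in> S"
  shows "euler_deriv f x = euler_deriv g x"
  unfolding euler_deriv_def by (intro sum.cong refl arg_cong2[of _ _ _ _ "(*)"] dd_cong_open[OF assms])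

lemma frechet_derivative_dd:
  assumes "f differentiable (at x)"
  shows "frechet_derivative f (at x) v = (\<Sum>b\<in>Basis. (v \<bullet> b) * dd [b] f x)"
proof -
  interpret linear "frechet_derivative f (at x)"
    using assms by (rule linear_frechet_derivative)
  have "frechet_derivative f (at x) v = frechet_derivative f (at x) (\<Sum>b\<in>Basis. (v \<bullet> b) *\<^sub>R b)"
    by (simp add: euclidean_representation)
  also have "\<dots> = (\<Sum>b\<in>Basis. (v \<bullet> b) * dd [b] f x)"
    by (simp add: sum scaleR dd_single)
  finally show ?thesis .
qed

lemma inner_grad: "grad f x \<bullet> v = (\<Sum>b\<in>Basis. (v \<bullet> b) * dd [b] f x)"
  unfolding grad_def inner_sum_left by (simp add: inner_commute mult.commute)

lemma frechet_derivative_grad: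
  "f differentiable (at x) \<Longrightarrow> frechet_derivative f (at x) v = grad f x \<bullet> v"
  by (simp only: frechet_derivative_dd inner_grad)

lemma frechet_derivative_euler:
  "f differentiable (at x) \<Longrightarrow> frechet_derivative f (at x) x = euler_deriv f x"
  by (simp only: frechet_derivative_dd euler_deriv_def)

lemma laplacian_add:
  assumes "smooth_on S f" "smooth_on S g" "x \<in> S"
  shows "laplacian (\<lambda>y. f y + g y) x = laplacian f x + laplacian g x"
proof -
  have "dd [b, b] (\<lambda>y. f y + g y) x = dd [b, b] f x + dd [b, b] g x" if "b \<in> Basis" for b
  proof -
    have "dd [b, b] (\<lambda>y. f y + g y) x = dd [b] (\<lambda>y. dd [b] f y + dd [b] g y) x"
      unfolding dd_pair
      by (rule dd_cong_open[OF smooth_on_open[OF assms(1)] _ assms(3)])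
        (intro dd_add smooth_on_differentiable[OF assms(1)] smooth_on_differentiable[OF assms(2)])
    also have "\<dots> = dd [b, b] f x + dd [b, b] g x"
      using that unfolding dd_pair
      by (intro dd_add smooth_on_differentiable[OF smooth_on_dd[OF assms(1)]]
          smooth_on_differentiable[OF smooth_on_dd[OF assms(2)]] assms(3)) auto
    finally show ?thesis .
  qed
  then show ?thesis unfolding laplacian_def by (simp add: sum.distrib)
qed

lemma laplacian_mult:
  assumes f: "smooth_on S f" and g: "smooth_on S g" and x: "x \<in> S"
  shows "laplacian (\<lambda>y. f y * g y) x =
    f x * laplacian g x + 2 * (\<Sum>b\<in>Basis. dd [b] f x * dd [b] g x) + laplacian f x * g x"
proof -
  have "dd [b, b] (\<lambda>y. f y * g y) x =
      f x * dd [b, b] g x + 2 * (dd [b] f x * dd [b] g x) + dd [b, b] f x * g x" if b: "b \<in> Basis" for b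
  proof -
    note df = smooth_on_differentiable[OF f] and dg = smooth_on_differentiable[OF g]
    have df': "dd [b] f differentiable (at x)" and dg': "dd [b] g differentiable (at x)"
      using smooth_on_dd[OF f, of "[b]"] smooth_on_dd[OF g, of "[b]"] b x smooth_on_differentiable
      by auto
    have "dd [b, b] (\<lambda>y. f y * g y) x = dd [b] (\<lambda>y. f y * dd [b] g y + dd [b] f y * g y) x"
      unfolding dd_pair
      by (rule dd_cong_open[OF smooth_on_open[OF f] _ x]) (intro dd_mult df dg)
    also have "\<dots> = f x * dd [b, b] g x + 2 * (dd [b] f x * dd [b] g x) + dd [b, b] f x * g x"
      using df[OF x] dg[OF x] df' dg' unfolding dd_pair
      by (simp add: dd_add dd_mult differentiable_mult)
    finally show ?thesis .
  qed
  then show ?thesis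
    unfolding laplacian_def by (simp add: sum.distrib sum_distrib_left sum_distrib_right)
qed

lemma laplacian_const [simp]: "laplacian (\<lambda>x::'a::euclidean_space. c) x = 0"
proof -
  have "dd [b] (\<lambda>x. c) = (\<lambda>x. 0)" for b :: 'a by (rule ext) (rule dd_const)
  then show ?thesis unfolding laplacian_def dd_pair by simp
qed

lemma laplacian_cmult:
  assumes "smooth_on S f" "x \<in> S"
  shows "laplacian (\<lambda>y. c * f y) x = c * laplacian f x"
  using laplacian_mult[OF smooth_on_const[OF smooth_on_open[OF assms(1)], of c] assms]
  by simp

lemma euler_deriv_add:
  "f differentiable (at x) \<Longrightarrow> g differentiable (at x) \<Longrightarrow>
    euler_deriv (\<lambda>y. f y + g y) x = euler_deriv f x + euler_deriv g x"
  unfolding euler_deriv_def by (simp add: dd_add sum.distrib ring_distribs)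

lemma euler_deriv_mult:
  "f differentiable (at x) \<Longrightarrow> g differentiable (at x) \<Longrightarrow>
    euler_deriv (\<lambda>y. f y * g y) x = f x * euler_deriv g x + euler_deriv f x * g x"
  unfolding euler_deriv_def
  by (simp add: dd_mult sum.distrib ring_distribs sum_distrib_left sum_distrib_right ac_simps
     )

lemma euler_deriv_cmult:
  "f differentiable (at x) \<Longrightarrow> euler_deriv (\<lambda>y. c * f y) x = c * euler_deriv f x"
  unfolding euler_deriv_def by (simp add: dd_cmult sum_distrib_left ac_simps)

lemma rot_deriv_mult:
  "f differentiable (at x) \<Longrightarrow> g differentiable (at x) \<Longrightarrow>
    rot_deriv a b (\<lambda>y. f y * g y) x = f x * rot_deriv a b g x + rot_deriv a b f x * g x"
  unfolding rot_deriv_def by (simp add: dd_mult ring_distribs)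

text \<open>The squared rotations add up to the spherical Laplacian. The sum runs over ordered
  pairs, so each coordinate plane is counted twice, whence the factor 1/2.\<close>

lemma laplacian_polar:
  fixes g :: "'a::euclidean_space \<Rightarrow> real"
  assumes g: "smooth_on S g" and x: "x \<in> S"
  shows "(x \<bullet> x) * laplacian g x = euler_deriv (euler_deriv g) x
    + (real DIM('a) - 2) * euler_deriv g x
    + (1/2) * (\<Sum>a\<in>Basis. \<Sum>b\<in>Basis. rot_deriv a b (rot_deriv a b g) x)"
proof -
  have S: "open S" using g by (rule smooth_on_open)
  have df: "dd [b] g differentiable (at x)" if "b \<in> Basis" for b
    using smooth_on_dd[OF g, of "[b]"] that x smooth_on_differentiable by auto
  have di: "(\<lambda>y. y \<bullet> a) differentiable (at x)" for a by simp
  define D where "D a b = dd [a, b] g x" for a b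
  define d where "d b = dd [b] g x" for b
  have D: "dd [c] (\<lambda>y. (y \<bullet> a) * dd [b] g y) x = (x \<bullet> a) * D c b + (c \<bullet> a) * d b"
    if "b \<in> Basis" for a b c
    using dd_mult[OF di df[OF that], of c a] unfolding D_def d_def dd_pair dd_inner .
  have R: "euler_deriv (euler_deriv g) x
      = (\<Sum>a\<in>Basis. \<Sum>b\<in>Basis. (x \<bullet> a) * (x \<bullet> b) * D a b) + (\<Sum>a\<in>Basis. (x \<bullet> a) * d a)"
  proof -
    have "dd [a] (euler_deriv g) x = (\<Sum>b\<in>Basis. (x \<bullet> b) * D a b) + d a" if "a \<in> Basis" for a
    proof -
      have "dd [a] (euler_deriv g) x = (\<Sum>b\<in>Basis. dd [a] (\<lambda>y. (y \<bullet> b) * dd [b] g y) x)"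
        unfolding euler_deriv_def[abs_def]
        by (rule dd_sum) (auto intro!: differentiable_mult df)
      also have "\<dots> = (\<Sum>b\<in>Basis. (x \<bullet> b) * D a b + (a \<bullet> b) * d b)"
        by (intro sum.cong D) auto
      also have "\<dots> = (\<Sum>b\<in>Basis. (x \<bullet> b) * D a b) + (\<Sum>b\<in>Basis. if a = b then d b else 0)"
        using that by (simp add: sum.distrib inner_Basis if_distrib[of "\<lambda>c. c * _"] cong: if_cong)
      finally show ?thesis using that by simp
    qed
    then show ?thesis
      unfolding euler_deriv_def[of "euler_deriv g"]
      by (simp add: ring_distribs sum.distrib sum_distrib_left mult.assoc)
  qed
  have L: "rot_deriv a b (rot_deriv a b g) x =
      (x \<bullet> a) * (x \<bullet> a) * D b b + (x \<bullet> b) * (x \<bullet> b) * D a a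
      - (x \<bullet> a) * (x \<bullet> b) * D b a - (x \<bullet> a) * (x \<bullet> b) * D a b
      + (if a = b then 2 * ((x \<bullet> a) * d a) else 0) - (x \<bullet> a) * d a - (x \<bullet> b) * d b"
    if a: "a \<in> Basis" and b: "b \<in> Basis" for a b
  proof -
    have eq: "dd [c] (rot_deriv a b g) x
        = dd [c] (\<lambda>y. (y \<bullet> a) * dd [b] g y) x - dd [c] (\<lambda>y. (y \<bullet> b) * dd [a] g y) x" for c
    proof -
      have 1: "(\<lambda>y. (y \<bullet> a) * dd [b] g y) differentiable (at x)"
        "(\<lambda>y. (y \<bullet> b) * dd [a] g y) differentiable (at x)"
        using df[OF a] df[OF b] by (auto intro!: differentiable_mult)
      show ?thesis
        using dd_add[OF 1(1) differentiable_mult[OF differentiable_const[of "-1"] 1(2)], of c]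
          dd_cmult[OF 1(2), of c "-1"]
        by (simp add: rot_deriv_def[abs_def])
    qed
    show ?thesis
      unfolding rot_deriv_def[of _ _ "rot_deriv a b g"] eq D[OF a] D[OF b]
      using a b by (auto simp: inner_Basis algebra_simps)
  qed
  \<comment> \<open>The mixed terms \<open>D a b\<close> and \<open>D b a\<close> are matched by
    relabelling the summation indices.\<close>
  have sw: "(\<Sum>a\<in>Basis. \<Sum>b\<in>Basis. (x \<bullet> a) * (x \<bullet> b) * D b a)
      = (\<Sum>a\<in>Basis. \<Sum>b\<in>Basis. (x \<bullet> a) * (x \<bullet> b) * D a b)"
    by (subst sum.swap) (simp add: mult.commute)
  have lap: "laplacian g x = (\<Sum>b\<in>Basis. D b b)"
    unfolding laplacian_def D_def by simp
  have xx: "x \<bullet> x = (\<Sum>a\<in>Basis. (x \<bullet> a) * (x \<bullet> a))"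
    by (rule euclidean_inner)
  have q1: "(\<Sum>a\<in>Basis. \<Sum>b\<in>Basis. (x \<bullet> a) * (x \<bullet> a) * D b b) = (x \<bullet> x) * laplacian g x"
    unfolding lap xx sum_product ..
  have q2: "(\<Sum>a\<in>Basis. \<Sum>b\<in>Basis. (x \<bullet> b) * (x \<bullet> b) * D a a) = (x \<bullet> x) * laplacian g x"
    by (subst sum.swap) (rule q1)
  have q3: "(\<Sum>a\<in>Basis. \<Sum>b\<in>Basis. if a = b then 2 * ((x \<bullet> a) * d a) else 0)
      = 2 * euler_deriv g x"
    unfolding euler_deriv_def d_def[symmetric] by (simp add: sum_distrib_left)
  have q4: "(\<Sum>a\<in>(Basis::'a set). \<Sum>b\<in>(Basis::'a set). (x \<bullet> a) * d a) = real DIM('a) * euler_deriv g x"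
    unfolding euler_deriv_def d_def[symmetric] by (simp add: sum_distrib_left)
  have q5: "(\<Sum>a\<in>(Basis::'a set). \<Sum>b\<in>(Basis::'a set). (x \<bullet> b) * d b) = real DIM('a) * euler_deriv g x"
    unfolding euler_deriv_def d_def[symmetric] by simp
  have "(\<Sum>a\<in>Basis. \<Sum>b\<in>Basis. rot_deriv a b (rot_deriv a b g) x)
      = 2 * ((x \<bullet> x) * laplacian g x)
      - 2 * (\<Sum>a\<in>Basis. \<Sum>b\<in>Basis. (x \<bullet> a) * (x \<bullet> b) * D a b)
      + 2 * euler_deriv g x - 2 * (real DIM('a) * euler_deriv g x)"
    using q1 q2 q3 q4 q5 sw
    by (simp add: L sum.distrib sum_subtractf cong: sum.cong)
  moreover have "(\<Sum>a\<in>Basis. (x \<bullet> a) * d a) = euler_deriv g x"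
    unfolding euler_deriv_def d_def ..
  ultimately show ?thesis unfolding R by (simp add: algebra_simps)
qed

section \<open>Harmonic polynomials\<close>

inductive hpoly :: "nat \<Rightarrow> ('a::euclidean_space \<Rightarrow> real) \<Rightarrow> bool" where
  const: "hpoly 0 (\<lambda>x. c)"
| add: "hpoly d f \<Longrightarrow> hpoly d g \<Longrightarrow> hpoly d (\<lambda>x. f x + g x)"
| var: "hpoly d f \<Longrightarrow> b \<in> Basis \<Longrightarrow> hpoly (Suc d) (\<lambda>x. (x \<bullet> b) * f x)"

lemma hpoly_zero: "hpoly d (\<lambda>x. 0)"
proof (induction d)
  case 0
  show ?case by (rule hpoly.const)
next
  case (Suc d)
  from hpoly.var[OF this SOME_Basis] show ?case by simp
qed

lemma hpoly_smooth: "hpoly d f \<Longrightarrow> open S \<Longrightarrow> smooth_on S f"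
  by (induction rule: hpoly.induct)
    (auto intro: smooth_on_const smooth_on_add smooth_on_mult smooth_on_inner)

lemma hpoly_differentiable: "hpoly d f \<Longrightarrow> f differentiable (at x)"
  using hpoly_smooth[of d f UNIV] smooth_on_differentiable by auto

lemma hpoly_homogeneous: "hpoly d f \<Longrightarrow> f (t *\<^sub>R x) = t ^ d * f x"
  by (induction rule: hpoly.induct) (auto simp: algebra_simps)

lemma hpoly_cmult: "hpoly d f \<Longrightarrow> hpoly d (\<lambda>x. c * f x)"
proof (induction rule: hpoly.induct)
  case (var d f b)
  from hpoly.var[OF var.IH var.hyps(2)] show ?case by (simp add: mult.left_commute)
qed (auto intro: hpoly.intros simp: ring_distribs)

lemma hpoly_sum: "(\<And>i. i \<in> I \<Longrightarrow> hpoly d (f i)) \<Longrightarrow> hpoly d (\<lambda>x. \<Sum>i\<in>I. f i x)"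
  by (induction I rule: infinite_finite_induct) (auto intro: hpoly_zero hpoly.add)

lemma hpoly_mult: "hpoly d f \<Longrightarrow> hpoly e g \<Longrightarrow> hpoly (d + e) (\<lambda>x. f x * g x)"
proof (induction rule: hpoly.induct)
  case (const c)
  then show ?case by (simp add: hpoly_cmult)
next
  case (add d f h)
  then show ?case by (simp add: ring_distribs hpoly.add)
next
  case (var d f b)
  from hpoly.var[OF var.IH[OF var.prems] var.hyps(2)] show ?case by (simp add: mult.assoc)
qed

text \<open>At degree 0 the truncated \<open>d - 1\<close> is again 0. The second conjunct repairs
  the \<open>var\<close> case there: the product of a variable with the derivative would otherwise
  have degree 1 instead of 0.\<close>

lemma hpoly_dd:
  fixes f :: "'a::euclidean_space \<Rightarrow> real"
  assumes "hpoly d f" "c \<in> Basis"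
  shows "hpoly (d - 1) (dd [c] f) \<and> (d = 0 \<longrightarrow> dd [c] f = (\<lambda>x. 0))"
  using assms(1)
proof (induction rule: hpoly.induct)
  case (const k)
  have "dd [c] (\<lambda>x::'a. k) = (\<lambda>x. 0)" by (rule ext) simp
  then show ?case by (simp add: hpoly.const)
next
  case (add d f g)
  have "dd [c] (\<lambda>x. f x + g x) = (\<lambda>x. dd [c] f x + dd [c] g x)"
    by (rule ext) (intro dd_add hpoly_differentiable[OF add.hyps(1)] hpoly_differentiable[OF add.hyps(2)])
  then show ?case using add.IH by (auto intro: hpoly.add)
next
  case (var d f b)
  have eq: "dd [c] (\<lambda>x. (x \<bullet> b) * f x) = (\<lambda>x. (x \<bullet> b) * dd [c] f x + (c \<bullet> b) * f x)"
    by (rule ext) (simp add: dd_mult hpoly_differentiable[OF var.hyps(1)])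
  have "hpoly d (\<lambda>x. (x \<bullet> b) * dd [c] f x)"
  proof (cases d)
    case 0
    then show ?thesis using var.IH by (simp add: hpoly_zero)
  next
    case (Suc k)
    then show ?thesis using var.IH hpoly.var[OF _ var.hyps(2), of k] by simp
  qed
  then show ?case
    using hpoly_cmult[OF var.hyps(1)] unfolding eq by (auto intro: hpoly.add)
qed

lemma hpoly_laplacian:
  assumes "hpoly d f"
  shows "hpoly (d - 2) (laplacian f)" "d < 2 \<Longrightarrow> laplacian f x = 0"
proof -
  have *: "hpoly (d - 2) (dd [b] (dd [b] f)) \<and> (d < 2 \<longrightarrow> dd [b] (dd [b] f) = (\<lambda>x. 0))"
    if "b \<in> Basis" for b
    using hpoly_dd[OF _ that, of "d - 1" "dd [b] f"] hpoly_dd[OF assms that]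
    by (auto simp: numeral_2_eq_2 diff_Suc less_Suc_eq split: nat.splits)
  show "hpoly (d - 2) (laplacian f)"
    unfolding laplacian_def[abs_def] dd_pair using * by (intro hpoly_sum) auto
  show "laplacian f x = 0" if "d < 2"
    unfolding laplacian_def dd_pair using * that by (intro sum.neutral) auto
qed

lemma hpoly_euler_deriv:
  assumes "hpoly d f"
  shows "euler_deriv f x = real d * f x"
  using assms
proof (induction rule: hpoly.induct)
  case (const c)
  then show ?case by (simp add: euler_deriv_def)
next
  case (add d f g)
  then show ?case
    by (simp add: euler_deriv_add hpoly_differentiable ring_distribs)
next
  case (var d f b)
  have "euler_deriv (\<lambda>x. x \<bullet> b) x = x \<bullet> b"
    unfolding euler_deriv_def dd_inner
    by (subst euclidean_inner[of x b]) (simp add: inner_commute)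
  then show ?case
    using var by (simp add: euler_deriv_mult hpoly_differentiable ring_distribs)
qed

lemma hpoly_norm_sq: "hpoly 2 (\<lambda>x::'a::euclidean_space. x \<bullet> x)"
proof -
  have "hpoly 2 (\<lambda>x::'a. \<Sum>b\<in>Basis. (x \<bullet> b) * ((x \<bullet> b) * 1))"
    unfolding numeral_2_eq_2 by (intro hpoly_sum hpoly.var hpoly.const)
  then show ?thesis by (simp add: euclidean_inner[symmetric])
qed

lemma dd_norm_sq: "dd [b] (\<lambda>x. x \<bullet> x) x = 2 * (x \<bullet> b)"
  by (rule has_derivative_imp_dd) (auto intro!: derivative_eq_intros simp: inner_commute)

lemma laplacian_norm_sq: "laplacian (\<lambda>x. x \<bullet> x) (x::'a::euclidean_space) = 2 * real DIM('a)"
proof -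
  have eq: "dd [b] (\<lambda>x. x \<bullet> x) = (\<lambda>x. 2 * (x \<bullet> b))" for b :: 'a by (rule ext) (rule dd_norm_sq)
  have "dd [b] (\<lambda>x. 2 * (x \<bullet> b)) x = 2" if "b \<in> Basis" for b
    using that by (subst dd_cmult) auto
  then show ?thesis unfolding laplacian_def dd_pair eq by simp
qed

lemma laplacian_norm_sq_mult:
  fixes f :: "'a::euclidean_space \<Rightarrow> real"
  assumes "hpoly d f"
  shows "laplacian (\<lambda>x. (x \<bullet> x) * f x) x
    = (2 * real DIM('a) + 4 * real d) * f x + (x \<bullet> x) * laplacian f x"
proof -
  have "(\<Sum>b\<in>Basis. 2 * (x \<bullet> b) * dd [b] f x) = 2 * euler_deriv f x"
    unfolding euler_deriv_def by (simp add: sum_distrib_left mult.assoc)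
  then show ?thesis
    using laplacian_mult[OF hpoly_smooth[OF hpoly_norm_sq open_UNIV] hpoly_smooth[OF assms open_UNIV], of x]
    by (simp add: dd_norm_sq laplacian_norm_sq hpoly_euler_deriv[OF assms] ring_distribs)
qed

definition solid_harmonic :: "nat \<Rightarrow> ('a::euclidean_space \<Rightarrow> real) \<Rightarrow> bool" where
  "solid_harmonic d Y \<longleftrightarrow> hpoly d Y \<and> (\<forall>x. laplacian Y x = 0)"

lemma solid_harmonic_hpoly: "solid_harmonic d Y \<Longrightarrow> hpoly d Y"
  by (simp add: solid_harmonic_def)

lemma hpoly_norm_sq_power_mult:
  assumes "hpoly l h" shows "hpoly (l + 2 * i) (\<lambda>x. (x \<bullet> x) ^ i * h x)"
proof (induction i)
  case (Suc i)
  then show ?case using hpoly_mult[OF hpoly_norm_sq Suc] by (simp add: mult.assoc)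
qed (use assms in simp)

text \<open>Iterates \<open>laplacian_norm_sq_mult\<close>. The numerical factor is positive, so
  multiplication by |x|^2 inverts the Laplacian up to a constant on each such product.\<close>

lemma laplacian_norm_sq_power_mult:
  fixes h :: "'a::euclidean_space \<Rightarrow> real"
  assumes "solid_harmonic l h"
  shows "laplacian (\<lambda>x. (x \<bullet> x) ^ Suc i * h x) x
    = 2 * (real i + 1) * (2 * real i + real DIM('a) + 2 * real l) * ((x \<bullet> x) ^ i * h x)"
proof (induction i arbitrary: x)
  case 0
  then show ?case
    using laplacian_norm_sq_mult[OF solid_harmonic_hpoly[OF assms]] assms by (simp add: solid_harmonic_def)
next
  case (Suc i)
  have "laplacian (\<lambda>x. (x \<bullet> x) ^ Suc (Suc i) * h x) x
      = laplacian (\<lambda>x. (x \<bullet> x) * ((x \<bullet> x) ^ Suc i * h x)) x"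
    by (simp add: mult.assoc)
  also have "\<dots> = (2 * real DIM('a) + 4 * real (l + 2 * Suc i)) * ((x \<bullet> x) ^ Suc i * h x)
      + (x \<bullet> x) * laplacian (\<lambda>x. (x \<bullet> x) ^ Suc i * h x) x"
    by (rule laplacian_norm_sq_mult[OF hpoly_norm_sq_power_mult[OF solid_harmonic_hpoly[OF assms]]])
  also have "\<dots> = ((2 * real DIM('a) + 4 * real (l + 2 * Suc i))
      + 2 * (real i + 1) * (2 * real i + real DIM('a) + 2 * real l)) * ((x \<bullet> x) ^ Suc i * h x)"
    unfolding Suc.IH by (simp add: algebra_simps)
  also have "(2 * real DIM('a) + 4 * real (l + 2 * Suc i))
      + 2 * (real i + 1) * (2 * real i + real DIM('a) + 2 * real l)
      = 2 * (real (Suc i) + 1) * (2 * real (Suc i) + real DIM('a) + 2 * real l)"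
    by (simp add: algebra_simps)
  finally show ?case .
qed

text \<open>Fischer decomposition: on the unit sphere the factors \<open>(x \<bullet> x) ^ i\<close>
  become 1, so a function of this class restricts to a sum of spherical harmonics. The scalar
  \<open>c\<close> in the base clause absorbs the division made when solving the Poisson
  equation.\<close>

inductive hdec :: "nat \<Rightarrow> ('a::euclidean_space \<Rightarrow> real) \<Rightarrow> bool" where
  base: "solid_harmonic l h \<Longrightarrow> hdec (l + 2 * i) (\<lambda>x. c * ((x \<bullet> x) ^ i * h x))"
| add: "hdec d f \<Longrightarrow> hdec d g \<Longrightarrow> hdec d (\<lambda>x. f x + g x)"

lemma hdec_hpoly: "hdec d f \<Longrightarrow> hpoly d f"
proof (induction rule: hdec.induct)
  case (base l h i c)
  show ?case by (rule hpoly_cmult[OF hpoly_norm_sq_power_mult[OF solid_harmonic_hpoly[OF base]]])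
qed (rule hpoly.add)

lemma hdec_laplacian_solve: "hdec d g \<Longrightarrow> \<exists>G. hdec (d + 2) G \<and> laplacian G = g"
proof (induction rule: hdec.induct)
  case (base l h i c)
  define k where "k = 2 * (real i + 1) * (2 * real i + real DIM('a) + 2 * real l)"
  have k: "k \<noteq> 0" unfolding k_def using DIM_positive[where 'a='a]
    by (auto simp: add_nonneg_eq_0_iff)
  have "hpoly (l + 2 * Suc i) (\<lambda>x. (x \<bullet> x) ^ Suc i * h x)"
    by (rule hpoly_norm_sq_power_mult[OF solid_harmonic_hpoly[OF base]])
  from laplacian_cmult[OF hpoly_smooth[OF this open_UNIV], of _ "c / k"]
  have "laplacian (\<lambda>x. c / k * ((x \<bullet> x) ^ Suc i * h x)) x = c * ((x \<bullet> x) ^ i * h x)" for x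
    using k unfolding laplacian_norm_sq_power_mult[OF base] k_def[symmetric] by simp
  then show ?case
    using hdec.base[OF base, of "Suc i" "c / k"]
    by (intro exI[of _ "\<lambda>x. c / k * ((x \<bullet> x) ^ Suc i * h x)"]) auto
next
  case (add d f g)
  then obtain F G where "hdec (d + 2) F" "laplacian F = f" "hdec (d + 2) G" "laplacian G = g" by auto
  then show ?case
    using laplacian_add[OF hpoly_smooth[OF hdec_hpoly open_UNIV] hpoly_smooth[OF hdec_hpoly open_UNIV],
        of "d + 2" F "d + 2" G]
    by (intro exI[of _ "\<lambda>x. F x + G x"]) (auto intro: hdec.add)
qed

text \<open>Subtracting a solution of \<open>laplacian G = laplacian f\<close> leaves a harmonic remainder.\<close>

lemma hpoly_hdec: "hpoly d f \<Longrightarrow> hdec d f"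
proof (induction d arbitrary: f rule: less_induct)
  case (less d)
  show ?case
  proof (cases "d < 2")
    case True
    then have "solid_harmonic d f" using less.prems hpoly_laplacian(2) by (auto simp: solid_harmonic_def)
    from hdec.base[OF this, of 0 1] show ?thesis by simp
  next
    case False
    then have "hdec (d - 2) (laplacian f)"
      using less.IH[of "d - 2"] hpoly_laplacian(1)[OF less.prems] by auto
    moreover have "d - 2 + 2 = d" using False by simp
    ultimately obtain G where G: "hdec d G" "laplacian G = laplacian f"
      using hdec_laplacian_solve[of "d - 2" "laplacian f"] by metis
    have Gp: "hpoly d G" by (rule hdec_hpoly[OF G(1)])
    have "laplacian (\<lambda>x. f x + (- 1) * G x) x = 0" for x
      using laplacian_add[OF hpoly_smooth[OF less.prems open_UNIV]
          hpoly_smooth[OF hpoly_cmult[OF Gp, of "-1"] open_UNIV], of x]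
        laplacian_cmult[OF hpoly_smooth[OF Gp open_UNIV], of x "-1"] G(2) by simp
    then have "solid_harmonic d (\<lambda>x. f x + (- 1) * G x)"
      using hpoly.add[OF less.prems hpoly_cmult[OF Gp, of "-1"]] by (simp add: solid_harmonic_def)
    from hdec.add[OF hdec.base[OF this, of 0 1, simplified] G(1)] show ?thesis by simp
  qed
qed

text \<open>\<open>P\<close> and \<open>Q\<close> are the real and imaginary part of the j-th power
  of the complex variable x_b + i x_c. The induction carries both, with the Cauchy-Riemann
  equations, because the Laplacian of x_b P - x_c Q is twice the difference of
  \<open>dd [b] P\<close> and \<open>dd [c] Q\<close>. Evaluating at \<open>b\<close> gives
  1.\<close>

lemma solid_harmonic_exists:
  assumes "DIM('a::euclidean_space) \<ge> 2"
  obtains Y :: "'a::euclidean_space \<Rightarrow> real" and e where "solid_harmonic j Y" "norm e = 1" "Y e = 1"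
proof -
  obtain b c :: 'a where bc: "b \<in> Basis" "c \<in> Basis" "b \<noteq> c"
  proof -
    obtain T :: "'a set" where T: "T \<subseteq> Basis" "card T = 2"
      using obtain_subset_with_card_n[OF assms] by metis
    then obtain b c where "T = {b, c}" "b \<noteq> c" by (meson card_2_iff)
    then show ?thesis using T that by auto
  qed
  have [simp]: "b \<bullet> b = 1" "c \<bullet> c = 1" "b \<bullet> c = 0" "c \<bullet> b = 0"
    using bc by (auto simp: inner_Basis)
  have "\<exists>P Q. hpoly j P \<and> hpoly j Q \<and> (\<forall>x. laplacian P x = 0) \<and> (\<forall>x. laplacian Q x = 0)
    \<and> (\<forall>x. dd [b] P x = dd [c] Q x) \<and> (\<forall>x. dd [c] P x = - dd [b] Q x) \<and> P b = 1"
  proof (induction j)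
    case 0
    show ?case
      by (intro exI[of _ "\<lambda>x. 1"] exI[of _ "\<lambda>x. 0"]) (auto intro: hpoly.const)
  next
    case (Suc j)
    then obtain P Q where P: "hpoly j P" and Q: "hpoly j Q"
      and l: "\<And>x. laplacian P x = 0" "\<And>x. laplacian Q x = 0"
      and cr: "\<And>x. dd [b] P x = dd [c] Q x" "\<And>x. dd [c] P x = - dd [b] Q x" and Pb: "P b = 1"
      by blast
    note d = hpoly_differentiable[OF P] hpoly_differentiable[OF Q]
    note sm = hpoly_smooth[OF _ open_UNIV]
    note v = hpoly.var[OF P bc(1)] hpoly.var[OF P bc(2)] hpoly.var[OF Q bc(1)] hpoly.var[OF Q bc(2)]
    have lap: "laplacian (\<lambda>x. (x \<bullet> a) * F x) x = 2 * dd [a] F x"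
      if "a \<in> Basis" "hpoly j F" "\<And>x. laplacian F x = 0" for a F x
    proof -
      have "laplacian (\<lambda>x. x \<bullet> a) x = 0"
        using hpoly_laplacian(2)[OF hpoly.var[OF hpoly.const[of 1] that(1)]] by simp
      moreover have "(\<Sum>i\<in>Basis. (i \<bullet> a) * dd [i] F x) = dd [a] F x"
        using that(1) by (subst sum.cong[OF refl, of _ _ "\<lambda>i. if i = a then dd [i] F x else 0"])
          (auto simp: inner_Basis)
      ultimately show ?thesis
        using laplacian_mult[OF smooth_on_inner[OF open_UNIV] sm[OF that(2)], of x a] that(3)
        by simp
    qed
    have cm: "hpoly (Suc j) (\<lambda>x. (- 1) * ((x \<bullet> c) * Q x))" by (rule hpoly_cmult[OF v(4)])
    define P' where "P' = (\<lambda>x. (x \<bullet> b) * P x + (- 1) * ((x \<bullet> c) * Q x))"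
    define Q' where "Q' = (\<lambda>x. (x \<bullet> b) * Q x + (x \<bullet> c) * P x)"
    have "laplacian P' x = 0" for x
      unfolding P'_def using laplacian_add[OF sm[OF v(1)] sm[OF cm], of x]
        laplacian_cmult[OF sm[OF v(4)], of x "-1"]
      by (simp add: lap[OF bc(1) P l(1)] lap[OF bc(2) Q l(2)] cr)
    moreover have "laplacian Q' x = 0" for x
      unfolding Q'_def using laplacian_add[OF sm[OF v(3)] sm[OF v(2)], of x]
      by (simp add: lap[OF bc(1) Q l(2)] lap[OF bc(2) P l(1)] cr)
    moreover have dP: "dd [a] P' x = (x \<bullet> b) * dd [a] P x + (a \<bullet> b) * P x
        - ((x \<bullet> c) * dd [a] Q x + (a \<bullet> c) * Q x)" for a x
      unfolding P'_def
      using dd_add[OF hpoly_differentiable[OF v(1)] hpoly_differentiable[OF cm], of a x]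
        dd_cmult[OF hpoly_differentiable[OF v(4)], of a "-1" x]
      by (simp add: dd_mult d)
    moreover have dQ: "dd [a] Q' x = (x \<bullet> b) * dd [a] Q x + (a \<bullet> b) * Q x
        + ((x \<bullet> c) * dd [a] P x + (a \<bullet> c) * P x)" for a x
      unfolding Q'_def
      using dd_add[OF hpoly_differentiable[OF v(3)] hpoly_differentiable[OF v(2)], of a x]
      by (simp add: dd_mult d)
    moreover have "hpoly (Suc j) P'" "hpoly (Suc j) Q'" unfolding P'_def Q'_def
      using hpoly.add[OF v(1) cm] hpoly.add[OF v(3) v(2)] by auto
    moreover have "P' b = 1" unfolding P'_def using Pb by simp
    ultimately show ?case
      by (intro exI[of _ P'] exI[of _ Q']) (simp add: cr)
  qed
  then obtain P where "solid_harmonic j P" "P b = 1" unfolding solid_harmonic_def by blast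
  then show ?thesis using that[of P b] bc by simp
qed

text \<open>In the polar formula the Laplacian vanishes and the Euler field acts as multiplication
  by \<open>j\<close>, which leaves the spherical eigenvalue.\<close>

lemma solid_harmonic_rot_deriv:
  fixes Y :: "'a::euclidean_space \<Rightarrow> real"
  assumes "solid_harmonic j Y"
  shows "(1/2) * (\<Sum>a\<in>Basis. \<Sum>b\<in>Basis. rot_deriv a b (rot_deriv a b Y) x)
    = - (real j * (real j + real DIM('a) - 2)) * Y x"
proof -
  have p: "hpoly j Y" and l: "laplacian Y x = 0" using assms by (auto simp: solid_harmonic_def)
  have e: "euler_deriv Y = (\<lambda>x. real j * Y x)" using hpoly_euler_deriv[OF p] by auto
  have "euler_deriv (euler_deriv Y) x = real j * (real j * Y x)"
    unfolding e using hpoly_euler_deriv[OF hpoly_cmult[OF p]] by simp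
  then show ?thesis
    using laplacian_polar[OF hpoly_smooth[OF p open_UNIV], of x] l unfolding e
    by (simp add: algebra_simps)
qed

section \<open>Spherical means\<close>

lemma DERIV_max_zero_square:
  "((\<lambda>t::real. (max 0 t)\<^sup>2) has_real_derivative 2 * max 0 t) (at t)"
proof -
  consider "t > 0" | "t < 0" | "t = 0" by linarith
  then show ?thesis
  proof cases
    case 1
    have "((\<lambda>t::real. t\<^sup>2) has_real_derivative 2 * t) (at t)"
      by (auto intro!: derivative_eq_intros)
    from has_field_derivative_transform_within_open[OF this, of "{0<..}" "\<lambda>t. (max 0 t)\<^sup>2"]
    show ?thesis using 1 by (auto simp: max_def)
  next
    case 2
    have "((\<lambda>t::real. 0) has_real_derivative 0) (at t)"
      by (auto intro!: derivative_eq_intros)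
    from has_field_derivative_transform_within_open[OF this, of "{..<0}" "\<lambda>t. (max 0 t)\<^sup>2"]
    show ?thesis using 2 by (auto simp: max_def)
  next
    case 3
    have "((\<lambda>h. (max 0 h)\<^sup>2 / h) \<longlongrightarrow> (0::real)) (at 0)"
    proof (rule Lim_null_comparison)
      show "\<forall>\<^sub>F h::real in at 0. norm ((max 0 h)\<^sup>2 / h) \<le> \<bar>h\<bar>"
        by (rule always_eventually) (auto simp: max_def power2_eq_square)
      show "((\<lambda>h::real. \<bar>h\<bar>) \<longlongrightarrow> 0) (at 0)" by (rule tendsto_rabs_zero) simp
    qed
    then show ?thesis using 3 by (simp add: DERIV_def)
  qed
qed

definition shell_poly :: "'a::euclidean_space \<Rightarrow> real" where
  "shell_poly x = (x \<bullet> x - 1) * (4 - x \<bullet> x)"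

text \<open>\<open>shell_poly\<close> is positive exactly for 1 < |x| < 2. Squaring its positive
  part gives a continuously differentiable radial weight that vanishes near the origin, where the
  direction x/|x| is singular.\<close>

definition bump :: "'a::euclidean_space \<Rightarrow> real" where
  "bump x = (max 0 (shell_poly x))\<^sup>2"

lemma bump_nonneg [simp]: "bump x \<ge> 0"
  by (simp add: bump_def)

lemma bump_eq_0: "norm x \<le> 1 \<or> 2 \<le> norm x \<Longrightarrow> bump x = 0"
proof -
  assume "norm x \<le> 1 \<or> 2 \<le> norm x"
  then have "x \<bullet> x \<le> 1 \<or> 4 \<le> x \<bullet> x"
    unfolding dot_square_norm using power_mono[of "norm x" 1 2] power_mono[of 2 "norm x" 2] by auto
  then have "shell_poly x \<le> 0"
    unfolding shell_poly_def by (auto simp: mult_le_0_iff)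
  then show ?thesis by (simp add: bump_def)
qed

lemma bump_pos: "norm \<omega> = 1 \<Longrightarrow> bump ((3/2) *\<^sub>R \<omega>) > 0"
  by (auto simp: bump_def shell_poly_def dot_square_norm power2_eq_square max_def)

lemma continuous_on_bump: "continuous_on S bump"
  unfolding bump_def[abs_def] shell_poly_def by (intro continuous_intros)

definition bump_slope :: "'a::euclidean_space \<Rightarrow> real" where
  "bump_slope x = 2 * max 0 (shell_poly x) * (2 * (5 - 2 * (x \<bullet> x)))"

lemma bump_has_derivative:
  "(bump has_derivative (\<lambda>v. bump_slope x * (x \<bullet> v))) (at x)"
proof -
  have 1: "(shell_poly has_derivative (\<lambda>v. 2 * (5 - 2 * (x \<bullet> x)) * (x \<bullet> v))) (at x)"
    unfolding shell_poly_def[abs_def]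
    by (auto intro!: derivative_eq_intros simp: inner_commute algebra_simps)
  have "((\<lambda>t::real. (max 0 t)\<^sup>2) has_derivative (\<lambda>h. 2 * max 0 (shell_poly x) * h)) (at (shell_poly x))"
    using DERIV_max_zero_square[of "shell_poly x"] by (simp add: has_field_derivative_def)
  from has_derivative_compose[OF 1 this] show ?thesis
    by (simp add: bump_def[abs_def] bump_slope_def mult.assoc)
qed

lemma continuous_on_bump_slope: "continuous_on S bump_slope"
  unfolding bump_slope_def[abs_def] shell_poly_def by (intro continuous_intros)

text \<open>It contains every point of norm below 4, so a function supported in norm at most 2 stays
  inside after a translation by less than 2.\<close>

abbreviation big_box :: "'a::euclidean_space set" where
  "big_box \<equiv> cbox (- 4 *\<^sub>R One) (4 *\<^sub>R One)"

lemma big_boxI: "norm x < 4 \<Longrightarrow> x \<in> big_box"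
proof -
  assume "norm x < 4"
  then have "\<bar>x \<bullet> i\<bar> \<le> 4" if "i \<in> Basis" for i
    using Basis_le_norm[OF that, of x] by simp
  then show ?thesis by (auto simp: mem_box abs_le_iff)
      (metis neg_le_iff_le minus_minus)
qed

lemma integral_translate_support:
  fixes F :: "'a::euclidean_space \<Rightarrow> real"
  assumes "F integrable_on big_box" "\<And>x. norm x \<ge> 2 \<Longrightarrow> F x = 0" "norm c < 2"
  shows "integral big_box (\<lambda>x. F (x + c)) = integral big_box F"
proof -
  let ?I = "integral big_box F"
  have "(F has_integral ?I) big_box" using assms(1) by (rule integrable_integral)
  from has_integral_shift_cbox[OF this, of c]
  have h: "((\<lambda>x. F (x + c)) has_integral ?I) UNIV"
  proof (rule has_integral_on_superset)
    fix x assume "x \<notin> cbox (- 4 *\<^sub>R One - c) (4 *\<^sub>R One - c)"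
    then have "x + c \<notin> big_box"
      by (auto simp: mem_box algebra_simps)
    then show "F (x + c) = 0" using big_boxI[of "x + c"] assms(2)[of "x + c"] by fastforce
  qed simp
  have eq: "(\<lambda>x. F (x + c)) = (\<lambda>x. if x \<in> big_box then F (x + c) else 0)"
  proof
    fix x
    have "F (x + c) = 0" if "x \<notin> big_box"
    proof (rule assms(2))
      have "norm x \<ge> 4" using big_boxI[of x] that by force
      then show "norm (x + c) \<ge> 2" using norm_triangle_ineq2[of x "- c"] assms(3) by simp
    qed
    then show "F (x + c) = (if x \<in> big_box then F (x + c) else 0)" by auto
  qed
  have "((\<lambda>x. F (x + c)) has_integral ?I) big_box"
    using h unfolding has_integral_restrict_UNIV[symmetric, of _ _ big_box] eq[symmetric] .
  then show ?thesis by (rule integral_unique)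
qed

text \<open>The integral of \<open>F (x + t *\<^sub>R b)\<close> over the box is constant for small
  t by \<open>integral_translate_support\<close>; its derivative at 0, taken under the integral
  sign, is the integral in question.\<close>

lemma integral_dd_eq_0:
  fixes F :: "'a::euclidean_space \<Rightarrow> real"
  assumes d: "\<And>x. F differentiable (at x)" and c: "continuous_on UNIV (dd [b] F)"
    and supp: "\<And>x. norm x \<ge> 2 \<Longrightarrow> F x = 0" and b: "b \<in> Basis"
  shows "integral big_box (dd [b] F) = 0"
proof -
  have cF: "continuous_on S F" for S
    using d by (meson continuous_at_imp_continuous_on differentiable_imp_continuous_within)
  have d1: "((\<lambda>t. integral big_box (\<lambda>x. F (x + t *\<^sub>R b))) has_field_derivative
      integral big_box (\<lambda>x. dd [b] F (x + 0 *\<^sub>R b))) (at 0 within {-1<..<1})"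
  proof (rule leibniz_rule_field_derivative)
    fix t :: real and x :: 'a
    have 1: "((\<lambda>t. x + t *\<^sub>R b) has_vector_derivative b) (at t within {-1<..<1})"
      by (auto intro!: derivative_eq_intros)
    have "(F has_derivative frechet_derivative F (at (x + t *\<^sub>R b))) (at (x + t *\<^sub>R b))"
      using d by (simp add: frechet_derivative_works)
    from vector_derivative_diff_chain_within[OF 1 has_derivative_at_withinI[OF this]]
    have "((\<lambda>t. F (x + t *\<^sub>R b)) has_vector_derivative
        frechet_derivative F (at (x + t *\<^sub>R b)) b) (at t within {-1<..<1})"
      by (simp add: o_def)
    then show "((\<lambda>t. F (x + t *\<^sub>R b)) has_field_derivative dd [b] F (x + t *\<^sub>R b)) (at t within {-1<..<1})"
      by (simp add: has_real_derivative_iff_has_vector_derivative dd_single)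
  next
    show "(\<lambda>x. F (x + t *\<^sub>R b)) integrable_on big_box" for t
      by (intro integrable_continuous continuous_on_compose2[OF cF[of UNIV]] continuous_intros) auto
    show "continuous_on ({- 1<..<1} \<times> big_box) (\<lambda>(t, x). dd [b] F (x + t *\<^sub>R b))"
      unfolding split_beta
      by (intro continuous_on_compose2[OF c] continuous_intros) auto
  qed auto
  have d2: "((\<lambda>t. integral big_box (\<lambda>x. F (x + t *\<^sub>R b))) has_field_derivative 0)
      (at 0 within {-1<..<1})"
  proof (rule has_field_derivative_transform_within[OF DERIV_const zero_less_one])
    fix t :: real assume "t \<in> {-1<..<1}"
    then have "norm (t *\<^sub>R b) < 2" using b by auto
    from integral_translate_support[OF integrable_continuous[OF cF] supp this]
    show "integral big_box F = integral big_box (\<lambda>x. F (x + t *\<^sub>R b))" by simp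
  qed auto
  have at: "at (0::real) within {-1<..<1} = at 0"
    by (rule at_within_open) auto
  show ?thesis using DERIV_unique[OF d1[unfolded at] d2[unfolded at]] by simp
qed

text \<open>The device for all integrands containing x/|x|: they are continuous off the origin and
  vanish on the unit ball because \<open>bump\<close> does.\<close>

lemma continuous_on_cut:
  assumes "open A" "open B" "continuous_on B f" "\<And>x. x \<in> A \<Longrightarrow> f x = (0::real)"
  shows "continuous_on (A \<union> B) f"
proof (rule continuous_on_open_Un[OF assms(1,2) _ assms(3)])
  show "continuous_on A f" using continuous_on_cong[of A A f "\<lambda>x. 0"] assms(4) by auto
qed

lemma inverse_norm_mult_norm [simp]:
  "inverse (norm x) * norm x = 1 \<longleftrightarrow> x \<noteq> 0"
  by auto

lemma ball_Un_punctured: "ball 0 1 \<union> - {0} = (UNIV :: 'a::real_normed_vector set)"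
  by auto

text \<open>A multiple of the surface integral over the unit sphere, written as a volume integral; the
  bump function is continuously differentiable, so that rotation fields can be integrated by parts.\<close>

definition sphere_mean :: "('a::euclidean_space \<Rightarrow> real) \<Rightarrow> real" where
  "sphere_mean g = integral big_box (\<lambda>x. bump x * g (x /\<^sub>R norm x))"

lemma continuous_on_sphere_mean_integrand:
  assumes "continuous_on (sphere 0 1) g"
  shows "continuous_on S (\<lambda>x. bump x * g (x /\<^sub>R norm x))"
proof -
  have "continuous_on (ball 0 1 \<union> - {0}) (\<lambda>x. bump x * g (x /\<^sub>R norm x))"
    by (rule continuous_on_cut)
      (auto simp: bump_eq_0 intro!: continuous_intros continuous_on_bump
        continuous_on_compose2[OF assms])
  then show ?thesis unfolding ball_Un_punctured using continuous_on_subset by blast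
qed

lemma sphere_mean_integrable:
  "continuous_on (sphere 0 1) g \<Longrightarrow> (\<lambda>x. bump x * g (x /\<^sub>R norm x)) integrable_on big_box"
  by (intro integrable_continuous continuous_on_sphere_mean_integrand)

lemma sphere_mean_cong:
  assumes "\<And>\<omega>. norm \<omega> = 1 \<Longrightarrow> f \<omega> = g \<omega>"
  shows "sphere_mean f = sphere_mean g"
proof -
  have "bump x * f (x /\<^sub>R norm x) = bump x * g (x /\<^sub>R norm x)" for x
    using assms[of "x /\<^sub>R norm x"] by (cases "x = 0") (auto simp: bump_eq_0)
  then show ?thesis unfolding sphere_mean_def by presburger
qed

lemma sphere_mean_add:
  assumes "continuous_on (sphere 0 1) f" "continuous_on (sphere 0 1) g"
  shows "sphere_mean (\<lambda>\<omega>. f \<omega> + g \<omega>) = sphere_mean f + sphere_mean g"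
  unfolding sphere_mean_def
  using integral_add[OF sphere_mean_integrable[OF assms(1)] sphere_mean_integrable[OF assms(2)]]
  by (simp add: ring_distribs)

lemma sphere_mean_cmult: "sphere_mean (\<lambda>\<omega>. c * f \<omega>) = c * sphere_mean f"
proof -
  have "sphere_mean (\<lambda>\<omega>. c * f \<omega>) = integral big_box (\<lambda>x. c * (bump x * f (x /\<^sub>R norm x)))"
    unfolding sphere_mean_def by (simp add: mult.left_commute)
  then show ?thesis unfolding sphere_mean_def by simp
qed

lemma sphere_mean_zero [simp]: "sphere_mean (\<lambda>\<omega>. 0) = 0"
  by (simp add: sphere_mean_def)

lemma sphere_mean_diff:
  assumes "continuous_on (sphere 0 1) f" "continuous_on (sphere 0 1) g"
  shows "sphere_mean (\<lambda>\<omega>. f \<omega> - g \<omega>) = sphere_mean f - sphere_mean g"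
  using sphere_mean_add[OF assms(1) continuous_on_minus[OF assms(2)]]
    sphere_mean_cmult[of "-1" g] by simp

lemma sphere_mean_sum:
  assumes "\<And>i. i \<in> I \<Longrightarrow> continuous_on (sphere 0 1) (f i)"
  shows "sphere_mean (\<lambda>\<omega>. \<Sum>i\<in>I. f i \<omega>) = (\<Sum>i\<in>I. sphere_mean (f i))"
  using assms
  by (induction I rule: infinite_finite_induct)
    (auto simp: sphere_mean_add continuous_on_sum)

lemma sphere_mean_eq_0D:
  assumes "continuous_on (sphere 0 1) g" "\<And>\<omega>. norm \<omega> = 1 \<Longrightarrow> g \<omega> \<ge> 0"
    and "sphere_mean g = 0" "norm \<omega> = 1"
  shows "g \<omega> = 0"
proof -
  have "bump x * g (x /\<^sub>R norm x) \<ge> 0" for x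
    using assms(2)[of "x /\<^sub>R norm x"] by (cases "x = 0") (auto simp: bump_eq_0)
  moreover have "(0::'a) \<in> box (- 4 *\<^sub>R One) (4 *\<^sub>R One)" by (auto simp: mem_box)
  ultimately have "\<forall>x\<in>big_box. bump x * g (x /\<^sub>R norm x) = 0"
    using integral_cbox_eq_0_iff[OF continuous_on_sphere_mean_integrand[OF assms(1)]] assms(3)
    unfolding sphere_mean_def by blast
  \<comment> \<open>Radius 3/2 lies inside the shell where \<open>bump\<close> is positive.\<close>
  from bspec[OF this big_boxI, of "(3/2) *\<^sub>R \<omega>"] show ?thesis
    using bump_pos[OF assms(4)] assms(4) by simp
qed

lemma sphere_mean_abs_le:
  fixes g :: "'a::euclidean_space \<Rightarrow> real"
  assumes "continuous_on (sphere 0 1) g" "\<And>\<omega>. norm \<omega> = 1 \<Longrightarrow> \<bar>g \<omega>\<bar> \<le> B"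
  shows "\<bar>sphere_mean g\<bar> \<le> B * sphere_mean (\<lambda>\<omega>::'a. 1)"
proof -
  have "norm (bump x * g (x /\<^sub>R norm x)) \<le> B * bump x" for x
    using assms(2)[of "x /\<^sub>R norm x"]
    by (cases "x = 0") (auto simp: bump_eq_0 abs_mult mult.commute[of B] intro: mult_left_mono)
  then have "norm (integral big_box (\<lambda>x. bump x * g (x /\<^sub>R norm x)))
      \<le> integral big_box (\<lambda>x::'a. B * bump x)"
    using sphere_mean_integrable[OF assms(1)]
    by (intro integral_norm_bound_integral)
      (auto intro!: integrable_continuous continuous_intros continuous_on_bump)
  then show ?thesis unfolding sphere_mean_def by simp
qed

lemma sphere_mean_has_derivative:
  fixes g :: "'a::euclidean_space \<Rightarrow> real"
  assumes g: "smooth_on V g" and V: "\<And>t \<omega>. p < t \<Longrightarrow> t < q \<Longrightarrow> norm \<omega> = 1 \<Longrightarrow> t *\<^sub>R \<omega> \<in> V"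
    and r: "p < r" "r < q" and Y: "continuous_on (sphere 0 1) Y"
  shows "((\<lambda>t. sphere_mean (\<lambda>\<omega>. g (t *\<^sub>R \<omega>) * Y \<omega>)) has_real_derivative
    sphere_mean (\<lambda>\<omega>. (\<Sum>b\<in>Basis. (\<omega> \<bullet> b) * dd [b] g (r *\<^sub>R \<omega>)) * Y \<omega>)) (at r)"
proof -
  let ?U = "{p<..<q}"
  let ?n = "\<lambda>x. x /\<^sub>R norm x"
  let ?f = "\<lambda>t x. bump x * (g (t *\<^sub>R ?n x) * Y (?n x))"
  let ?d = "\<lambda>t x. bump x * ((\<Sum>b\<in>Basis. (?n x \<bullet> b) * dd [b] g (t *\<^sub>R ?n x)) * Y (?n x))"
  have U: "at r within ?U = at r" by (rule at_within_open) (use r in auto)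
  have cd: "continuous_on V (dd [b] g)" if "b \<in> Basis" for b
    using smooth_on_continuous[OF smooth_on_dd[OF g, of "[b]"]] that by auto
  have Vn: "(t * inverse (norm x)) *\<^sub>R x \<in> V" if "p < t" "t < q" "x \<noteq> 0" for t x
    using V[of t "?n x"] that by simp
  have "((\<lambda>t. integral big_box (?f t)) has_field_derivative integral big_box (?d r)) (at r within ?U)"
  proof (rule leibniz_rule_field_derivative)
    fix t :: real and x :: 'a
    assume t: "t \<in> ?U"
    show "((\<lambda>t. ?f t x) has_field_derivative ?d t x) (at t within ?U)"
    proof (cases "x = 0")
      case True
      then show ?thesis by (simp add: bump_eq_0)
    next
      case False
      define w where "w = ?n x"
      have w: "norm w = 1" using False by (simp add: w_def)
      have gd: "g differentiable (at (t *\<^sub>R w))"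
        using t w by (intro smooth_on_differentiable[OF g] V) auto
      have 1: "((\<lambda>t. t *\<^sub>R w) has_vector_derivative w) (at t within ?U)"
        by (auto intro!: derivative_eq_intros)
      have "(g has_derivative frechet_derivative g (at (t *\<^sub>R w))) (at (t *\<^sub>R w))"
        using gd by (simp add: frechet_derivative_works)
      from vector_derivative_diff_chain_within[OF 1 has_derivative_at_withinI[OF this]]
      have "((\<lambda>t. g (t *\<^sub>R w)) has_vector_derivative
          frechet_derivative g (at (t *\<^sub>R w)) w) (at t within ?U)"
        by (simp add: o_def)
      then have "((\<lambda>t. g (t *\<^sub>R w)) has_field_derivative
          (\<Sum>b\<in>Basis. (w \<bullet> b) * dd [b] g (t *\<^sub>R w))) (at t within ?U)"
        using gd by (simp only: has_real_derivative_iff_has_vector_derivative frechet_derivative_dd)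
      then show ?thesis unfolding w_def[symmetric]
        by (auto intro!: derivative_eq_intros)
    qed
  next
    fix t :: real assume t: "t \<in> ?U"
    show "?f t integrable_on big_box"
      using t V by (intro sphere_mean_integrable continuous_intros Y
        continuous_on_compose2[OF smooth_on_continuous[OF g]]) auto
  next
    have "continuous_on ((?U \<times> ball 0 1) \<union> (?U \<times> - {0})) (\<lambda>z. ?d (fst z) (snd z))"
    proof (rule continuous_on_cut)
      show "continuous_on (?U \<times> - {0}) (\<lambda>z. ?d (fst z) (snd z))"
        by (intro continuous_intros continuous_on_compose2[OF continuous_on_bump[of UNIV]]
            continuous_on_compose2[OF cd] continuous_on_compose2[OF Y]) (auto intro!: Vn)
      show "open (?U \<times> ball (0::'a) 1)" "open (?U \<times> - {0::'a})"
        by (auto intro!: open_Times)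
    qed (auto simp: bump_eq_0)
    also have "(?U \<times> ball 0 1) \<union> (?U \<times> - {0}) = ?U \<times> (UNIV :: 'a set)"
      using ball_Un_punctured by blast
    finally show "continuous_on (?U \<times> big_box) (\<lambda>(t, x). ?d t x)"
      unfolding split_beta by (rule continuous_on_subset) auto
  qed (use r in auto)
  then show ?thesis unfolding sphere_mean_def U .
qed

text \<open>Rotation fields are free of divergence and annihilate radial functions. With
  \<open>G\<close> the extension of \<open>h\<close> from the sphere of radius \<open>r\<close> that
  is constant on rays, the integrand is therefore a difference of two partial derivatives of
  compactly supported functions, and \<open>integral_dd_eq_0\<close> applies to each.\<close>

lemma sphere_mean_rot_deriv:
  fixes h :: "'a::euclidean_space \<Rightarrow> real"
  assumes h: "smooth_on V h" and r: "r > 0" and V: "\<And>\<omega>. norm \<omega> = 1 \<Longrightarrow> r *\<^sub>R \<omega> \<in> V"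
    and a: "a \<in> Basis" and b: "b \<in> Basis"
  shows "sphere_mean (\<lambda>\<omega>. rot_deriv a b h (r *\<^sub>R \<omega>)) = 0"
proof -
  \<comment> \<open>Radial projection onto the sphere of radius \<open>r\<close>; \<open>yd\<close>
    is its derivative in direction \<open>c\<close>.\<close>
  define y where "y = (\<lambda>x::'a. (r / norm x) *\<^sub>R x)"
  define G where "G = (\<lambda>x. h (y x))"
  define yd where "yd = (\<lambda>x c. (r / norm x) *\<^sub>R c - (r * (x \<bullet> c) / norm x ^ 3) *\<^sub>R (x::'a))"
  define Gd where "Gd = (\<lambda>c x. \<Sum>e\<in>Basis. (yd x c \<bullet> e) * dd [e] h (y x))"
  define F where "F = (\<lambda>c x. (x \<bullet> c) * (bump x * G x))"
  define Fd where "Fd = (\<lambda>c e x. (e \<bullet> c) * (bump x * G x)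
      + (x \<bullet> c) * (bump x * Gd e x + bump_slope x * (x \<bullet> e) * G x))"
  have yV: "y x \<in> V" if "x \<noteq> 0" for x
    using V[of "x /\<^sub>R norm x"] that by (simp add: y_def divide_inverse)
  have cy: "continuous_on (- {0}) y" unfolding y_def by (intro continuous_intros) auto
  have cG: "continuous_on (- {0}) G"
    unfolding G_def by (rule continuous_on_compose2[OF smooth_on_continuous[OF h] cy]) (auto intro: yV)
  have cd: "continuous_on V (dd [e] h)" if "e \<in> Basis" for e
    using smooth_on_continuous[OF smooth_on_dd[OF h, of "[e]"]] that by auto
  have cGd: "continuous_on (- {0}) (Gd c)" for c
    unfolding Gd_def yd_def
    by (intro continuous_intros continuous_on_compose2[OF cd cy]) (auto intro: yV)
  have G': "(G has_derivative (\<lambda>c. Gd c x)) (at x)" if x: "x \<noteq> 0" for x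
  proof -
    have nd: "(norm has_derivative (\<lambda>h. inverse (norm x) * (x \<bullet> h))) (at x)"
      using has_derivative_norm[OF x] by (simp add: sgn_div_norm inner_commute)
    have "(y has_derivative (\<lambda>c. yd x c)) (at x)"
      unfolding y_def yd_def using x
      by (auto intro!: derivative_eq_intros nd simp: divide_inverse algebra_simps power3_eq_cube)
    moreover have hd: "h differentiable (at (y x))"
      by (rule smooth_on_differentiable[OF h yV[OF x]])
    ultimately have "(G has_derivative (\<lambda>c. frechet_derivative h (at (y x)) (yd x c))) (at x)"
      unfolding G_def using has_derivative_compose frechet_derivative_works by blast
    then show ?thesis unfolding Gd_def using hd by (simp only: frechet_derivative_dd)
  qed
  have F': "(F c has_derivative (\<lambda>e. Fd c e x)) (at x)" for c x
  proof (cases "x = 0")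
    case True
    have "((\<lambda>x::'a. 0) has_derivative (\<lambda>e. 0::real)) (at x)" by simp
    then have "(F c has_derivative (\<lambda>e. 0)) (at x)"
      by (rule has_derivative_transform_within_open[of _ _ _ _ "ball 0 1"])
        (auto simp: True F_def bump_eq_0)
    moreover have "Fd c e x = 0" for e unfolding Fd_def True by (simp add: bump_eq_0)
    ultimately show ?thesis by simp
  next
    case False
    show ?thesis unfolding F_def Fd_def
      by (rule has_derivative_eq_rhs)
        (auto intro!: derivative_eq_intros bump_has_derivative G'[OF False] simp: algebra_simps)
  qed
  have ddF: "dd [e] (F c) = Fd c e" for c e
    by (rule ext) (rule has_derivative_imp_dd[OF F'])
  have cFd: "continuous_on UNIV (Fd c e)" for c e
  proof -
    have "continuous_on (ball 0 1 \<union> - {0}) (Fd c e)"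
    proof (rule continuous_on_cut)
      show "continuous_on (- {0}) (Fd c e)"
        unfolding Fd_def by (intro continuous_intros cG cGd continuous_on_bump continuous_on_bump_slope)
      show "Fd c e x = 0" if "x \<in> ball 0 1" for x
      proof -
        have "bump x = 0" using that by (auto simp: bump_eq_0)
        then have "bump_slope x = 0" unfolding bump_def bump_slope_def by auto
        with \<open>bump x = 0\<close> show ?thesis by (simp add: Fd_def)
      qed
    qed auto
    then show ?thesis unfolding ball_Un_punctured .
  qed
  have int0: "integral big_box (Fd c e) = 0" if "e \<in> Basis" for c e
    unfolding ddF[symmetric]
  proof (rule integral_dd_eq_0)
    show "F c differentiable (at x)" for x using F' by (rule differentiableI)
    show "F c x = 0" if "2 \<le> norm x" for x using that by (simp add: F_def bump_eq_0)
  qed (use cFd that ddF in auto)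
  have "integral big_box (\<lambda>x. Fd a b x - Fd b a x) = 0"
    using int0[OF a] int0[OF b] continuous_on_subset[OF cFd subset_UNIV]
    by (subst integral_diff) (auto intro!: integrable_continuous)
  \<comment> \<open>The terms with \<open>e \<bullet> c\<close> and with \<open>bump_slope\<close>
    are symmetric in the two directions and cancel.\<close>
  moreover have "Fd a b x - Fd b a x = bump x * rot_deriv a b h (r *\<^sub>R (x /\<^sub>R norm x))" for x
  proof (cases "x = 0")
    case True
    then show ?thesis by (simp add: Fd_def bump_eq_0)
  next
    case False
    have yx: "r *\<^sub>R (x /\<^sub>R norm x) = y x" by (simp add: y_def divide_inverse)
    have "(x \<bullet> a) * Gd b x - (x \<bullet> b) * Gd a x
        = (\<Sum>e\<in>Basis. ((x \<bullet> a) * (yd x b \<bullet> e) - (x \<bullet> b) * (yd x a \<bullet> e)) * dd [e] h (y x))"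
      unfolding Gd_def by (simp add: sum_distrib_left sum_subtractf[symmetric] algebra_simps)
    also have "\<dots> = (\<Sum>e\<in>Basis. (if e = b then (y x \<bullet> a) * dd [e] h (y x) else 0)
        - (if e = a then (y x \<bullet> b) * dd [e] h (y x) else 0))"
    proof (rule sum.cong[OF refl])
      fix e :: 'a assume e: "e \<in> Basis"
      \<comment> \<open>The part of \<open>yd\<close> along \<open>x\<close> drops out by
        antisymmetry.\<close>
      have "(x \<bullet> a) * (yd x b \<bullet> e) - (x \<bullet> b) * (yd x a \<bullet> e) = (y x \<bullet> a) * (b \<bullet> e) - (y x \<bullet> b) * (a \<bullet> e)"
        unfolding yd_def y_def by (simp add: algebra_simps inner_diff_left)
      then show "((x \<bullet> a) * (yd x b \<bullet> e) - (x \<bullet> b) * (yd x a \<bullet> e)) * dd [e] h (y x)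
        = (if e = b then (y x \<bullet> a) * dd [e] h (y x) else 0)
        - (if e = a then (y x \<bullet> b) * dd [e] h (y x) else 0)"
        using a b e by (auto simp: inner_Basis)
    qed
    also have "\<dots> = rot_deriv a b h (y x)"
      using a b by (simp add: sum_subtractf rot_deriv_def)
    finally have "(x \<bullet> a) * Gd b x - (x \<bullet> b) * Gd a x = rot_deriv a b h (y x)" .
    then show ?thesis unfolding yx Fd_def using a b
      by (simp add: inner_commute algebra_simps flip: right_diff_distrib)
  qed
  ultimately show ?thesis unfolding sphere_mean_def by simp
qed

section \<open>The angular Laplacian and orthogonality of harmonics\<close>

definition angular_laplacian :: "('a::euclidean_space \<Rightarrow> real) \<Rightarrow> 'a \<Rightarrow> real" where
  "angular_laplacian f x = (1/2) * (\<Sum>a\<in>Basis. \<Sum>b\<in>Basis. rot_deriv a b (rot_deriv a b f) x)"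

lemma continuous_on_dilate:
  assumes "smooth_on V f" "\<And>\<omega>. norm \<omega> = 1 \<Longrightarrow> r *\<^sub>R \<omega> \<in> V"
  shows "continuous_on (sphere 0 1) (\<lambda>\<omega>. f (r *\<^sub>R \<omega>))"
  using assms(2)
  by (intro continuous_on_compose2[OF smooth_on_continuous[OF assms(1)]] continuous_intros) auto

lemma sphere_mean_rot_deriv_parts:
  assumes f: "smooth_on V f" and g: "smooth_on V g" and r: "r > 0"
    and V: "\<And>\<omega>. norm \<omega> = 1 \<Longrightarrow> r *\<^sub>R \<omega> \<in> V" and ab: "a \<in> Basis" "b \<in> Basis"
  shows "sphere_mean (\<lambda>\<omega>. rot_deriv a b f (r *\<^sub>R \<omega>) * g (r *\<^sub>R \<omega>))
    = - sphere_mean (\<lambda>\<omega>. f (r *\<^sub>R \<omega>) * rot_deriv a b g (r *\<^sub>R \<omega>))"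
proof -
  have "0 = sphere_mean (\<lambda>\<omega>. rot_deriv a b (\<lambda>x. f x * g x) (r *\<^sub>R \<omega>))"
    using sphere_mean_rot_deriv[OF smooth_on_mult[OF f g] r V ab] by simp
  also have "\<dots> = sphere_mean (\<lambda>\<omega>. f (r *\<^sub>R \<omega>) * rot_deriv a b g (r *\<^sub>R \<omega>)
      + rot_deriv a b f (r *\<^sub>R \<omega>) * g (r *\<^sub>R \<omega>))"
    using V by (intro sphere_mean_cong rot_deriv_mult smooth_on_differentiable[OF f]
        smooth_on_differentiable[OF g]) auto
  also have "\<dots> = sphere_mean (\<lambda>\<omega>. f (r *\<^sub>R \<omega>) * rot_deriv a b g (r *\<^sub>R \<omega>))
      + sphere_mean (\<lambda>\<omega>. rot_deriv a b f (r *\<^sub>R \<omega>) * g (r *\<^sub>R \<omega>))"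
    using ab V f g by (intro sphere_mean_add continuous_on_mult continuous_on_dilate[of V])
      (auto intro: smooth_on_rot_deriv)
  finally show ?thesis by simp
qed

text \<open>Two integrations by parts per pair of directions; the signs cancel, so the operator is
  symmetric on every sphere.\<close>

lemma sphere_mean_angular_laplacian:
  fixes f g :: "'a::euclidean_space \<Rightarrow> real"
  assumes f: "smooth_on V f" and g: "smooth_on V g" and r: "r > 0"
    and V: "\<And>\<omega>. norm \<omega> = 1 \<Longrightarrow> r *\<^sub>R \<omega> \<in> V"
  shows "sphere_mean (\<lambda>\<omega>. angular_laplacian f (r *\<^sub>R \<omega>) * g (r *\<^sub>R \<omega>))
    = sphere_mean (\<lambda>\<omega>. f (r *\<^sub>R \<omega>) * angular_laplacian g (r *\<^sub>R \<omega>))"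
proof -
  have expand: "sphere_mean (\<lambda>\<omega>. angular_laplacian u (r *\<^sub>R \<omega>) * v (r *\<^sub>R \<omega>))
      = (1/2) * (\<Sum>a\<in>Basis. \<Sum>b\<in>Basis.
        sphere_mean (\<lambda>\<omega>. rot_deriv a b (rot_deriv a b u) (r *\<^sub>R \<omega>) * v (r *\<^sub>R \<omega>)))"
    if u: "smooth_on V u" and v: "smooth_on V v" for u v :: "'a \<Rightarrow> real"
  proof -
    have c: "continuous_on (sphere 0 1) (\<lambda>\<omega>. rot_deriv a b (rot_deriv a b u) (r *\<^sub>R \<omega>) * v (r *\<^sub>R \<omega>))"
      if "a \<in> Basis" "b \<in> Basis" for a b
      using that V u v by (intro continuous_on_mult continuous_on_dilate[of V])
        (auto intro: smooth_on_rot_deriv)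
    have "sphere_mean (\<lambda>\<omega>. angular_laplacian u (r *\<^sub>R \<omega>) * v (r *\<^sub>R \<omega>))
      = sphere_mean (\<lambda>\<omega>. (1/2) * (\<Sum>a\<in>Basis. \<Sum>b\<in>Basis.
         rot_deriv a b (rot_deriv a b u) (r *\<^sub>R \<omega>) * v (r *\<^sub>R \<omega>)))"
      unfolding angular_laplacian_def by (simp add: sum_distrib_right)
    also have "\<dots> = (1/2) * sphere_mean (\<lambda>\<omega>. \<Sum>a\<in>Basis. \<Sum>b\<in>Basis.
         rot_deriv a b (rot_deriv a b u) (r *\<^sub>R \<omega>) * v (r *\<^sub>R \<omega>))"
      by (rule sphere_mean_cmult)
    finally show ?thesis using c
      by (simp add: sphere_mean_sum continuous_on_sum)
  qed
  have "sphere_mean (\<lambda>\<omega>. rot_deriv a b (rot_deriv a b f) (r *\<^sub>R \<omega>) * g (r *\<^sub>R \<omega>))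
      = sphere_mean (\<lambda>\<omega>. rot_deriv a b (rot_deriv a b g) (r *\<^sub>R \<omega>) * f (r *\<^sub>R \<omega>))"
    if ab: "a \<in> Basis" "b \<in> Basis" for a b
    using sphere_mean_rot_deriv_parts[OF smooth_on_rot_deriv[OF f ab] g r V ab]
      sphere_mean_rot_deriv_parts[OF smooth_on_rot_deriv[OF g ab] f r V ab]
    by (simp add: mult.commute)
  then have "sphere_mean (\<lambda>\<omega>. angular_laplacian f (r *\<^sub>R \<omega>) * g (r *\<^sub>R \<omega>))
    = sphere_mean (\<lambda>\<omega>. angular_laplacian g (r *\<^sub>R \<omega>) * f (r *\<^sub>R \<omega>))"
    unfolding expand[OF f g] expand[OF g f] by (intro arg_cong2[of _ _ _ _ "(*)"] sum.cong refl) auto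
  then show ?thesis by (simp add: mult.commute)
qed

lemma angular_laplacian_harm:
  "solid_harmonic j (Y :: 'a::euclidean_space \<Rightarrow> real) \<Longrightarrow>
    angular_laplacian Y x = - (real j * (real j + real DIM('a) - 2)) * Y x"
  unfolding angular_laplacian_def by (rule solid_harmonic_rot_deriv)

lemma solid_harmonic_smooth: "solid_harmonic j Y \<Longrightarrow> open S \<Longrightarrow> smooth_on S Y"
  by (intro hpoly_smooth solid_harmonic_hpoly)

lemma solid_harmonic_continuous: "solid_harmonic j Y \<Longrightarrow> continuous_on S Y"
  using smooth_on_continuous[OF solid_harmonic_smooth[OF _ open_UNIV]] continuous_on_subset by blast

text \<open>Both factors are eigenfunctions of a symmetric operator, and the eigenvalues j (j + n -
  2) increase strictly with the degree when n >= 2.\<close>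

lemma solid_harmonic_orthogonal:
  fixes Y Z :: "'a::euclidean_space \<Rightarrow> real"
  assumes n: "DIM('a) \<ge> 2" and "solid_harmonic i Y" "solid_harmonic j Z" "i < j"
  shows "sphere_mean (\<lambda>\<omega>. Y \<omega> * Z \<omega>) = 0"
proof -
  let ?l = "\<lambda>j. real j * (real j + real DIM('a) - 2)"
  have "sphere_mean (\<lambda>\<omega>. angular_laplacian Y (1 *\<^sub>R \<omega>) * Z (1 *\<^sub>R \<omega>))
    = sphere_mean (\<lambda>\<omega>. Y (1 *\<^sub>R \<omega>) * angular_laplacian Z (1 *\<^sub>R \<omega>))"
    using solid_harmonic_smooth[OF assms(2) open_UNIV] solid_harmonic_smooth[OF assms(3) open_UNIV]
    by (intro sphere_mean_angular_laplacian[of UNIV]) auto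
  moreover have "sphere_mean (\<lambda>\<omega>. c * Y \<omega> * Z \<omega>) = c * sphere_mean (\<lambda>\<omega>. Y \<omega> * Z \<omega>)"
    "sphere_mean (\<lambda>\<omega>. Y \<omega> * (c * Z \<omega>)) = c * sphere_mean (\<lambda>\<omega>. Y \<omega> * Z \<omega>)" for c
    unfolding sphere_mean_cmult[symmetric] by (simp_all only: ac_simps)
  ultimately have "- ?l i * sphere_mean (\<lambda>\<omega>. Y \<omega> * Z \<omega>) = - ?l j * sphere_mean (\<lambda>\<omega>. Y \<omega> * Z \<omega>)"
    unfolding angular_laplacian_harm[OF assms(2)] angular_laplacian_harm[OF assms(3)] scaleR_one
    by (simp only:)
  moreover have "?l i < ?l j"
    using assms(1,4) by (intro mult_strict_mono') auto
  ultimately show ?thesis by simp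
qed

section \<open>Spherical harmonic coefficients as functions of the radius\<close>

definition sph_coeff :: "('a::euclidean_space \<Rightarrow> real) \<Rightarrow> ('a \<Rightarrow> real) \<Rightarrow> real \<Rightarrow> real" where
  "sph_coeff Y g r = sphere_mean (\<lambda>\<omega>. g (r *\<^sub>R \<omega>) * Y \<omega>)"

text \<open>The polar form of the Laplacian, tested against \<open>Y\<close>: symmetry moves the
  angular part onto \<open>Y\<close>, where it acts as a scalar. The result is an ordinary
  differential equation in r d/dr.\<close>

lemma sph_coeff_laplacian:
  fixes g Y :: "'a::euclidean_space \<Rightarrow> real"
  assumes Y: "solid_harmonic j Y" and g: "smooth_on V g" and r: "r > 0"
    and V: "\<And>\<omega>. norm \<omega> = 1 \<Longrightarrow> r *\<^sub>R \<omega> \<in> V"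
  shows "r\<^sup>2 * sph_coeff Y (laplacian g) r = sph_coeff Y (euler_deriv (euler_deriv g)) r
    + (real DIM('a) - 2) * sph_coeff Y (euler_deriv g) r
    - real j * (real j + real DIM('a) - 2) * sph_coeff Y g r"
proof -
  let ?n = "real DIM('a)"
  have VY: "smooth_on V Y" by (rule solid_harmonic_smooth[OF Y smooth_on_open[OF g]])
  have hom: "Y (r *\<^sub>R \<omega>) = r ^ j * Y \<omega>" for \<omega> by (rule hpoly_homogeneous[OF solid_harmonic_hpoly[OF Y]])
  have ang: "sphere_mean (\<lambda>\<omega>. angular_laplacian g (r *\<^sub>R \<omega>) * Y \<omega>)
      = - (real j * (real j + ?n - 2)) * sph_coeff Y g r"
  proof -
    \<comment> \<open>Symmetry of the angular part is available for both factors at radius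
      \<open>r\<close>, whereas the coefficient uses \<open>Y\<close> at radius 1; homogeneity
      bridges the two.\<close>
    have "r ^ j * sphere_mean (\<lambda>\<omega>. angular_laplacian g (r *\<^sub>R \<omega>) * Y \<omega>)
        = sphere_mean (\<lambda>\<omega>. angular_laplacian g (r *\<^sub>R \<omega>) * Y (r *\<^sub>R \<omega>))"
      unfolding hom sphere_mean_cmult[symmetric] by (simp add: ac_simps)
    also have "\<dots> = sphere_mean (\<lambda>\<omega>. g (r *\<^sub>R \<omega>) * angular_laplacian Y (r *\<^sub>R \<omega>))"
      by (rule sphere_mean_angular_laplacian[OF g VY r V])
    also have "\<dots> = sphere_mean (\<lambda>\<omega>. (- (real j * (real j + ?n - 2)) * r ^ j) * (g (r *\<^sub>R \<omega>) * Y \<omega>))"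
      unfolding angular_laplacian_harm[OF Y] hom by (simp add: ac_simps)
    also have "\<dots> = r ^ j * (- (real j * (real j + ?n - 2)) * sph_coeff Y g r)"
      unfolding sphere_mean_cmult sph_coeff_def by simp
    finally show ?thesis using r by (metis mult_left_cancel power_not_zero less_irrefl)
  qed
  note cont = continuous_on_mult[OF continuous_on_dilate[OF _ V] solid_harmonic_continuous[OF Y]]
  have c: "continuous_on (sphere 0 1) (\<lambda>\<omega>. euler_deriv (euler_deriv g) (r *\<^sub>R \<omega>) * Y \<omega>)"
    "continuous_on (sphere 0 1) (\<lambda>\<omega>. (?n - 2) * (euler_deriv g (r *\<^sub>R \<omega>) * Y \<omega>))"
    using cont[OF smooth_on_euler_deriv[OF smooth_on_euler_deriv[OF g]]]
      cont[OF smooth_on_euler_deriv[OF g]]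
    by (auto intro: continuous_on_mult_left)
  have ca: "continuous_on (sphere 0 1) (\<lambda>\<omega>. angular_laplacian g (r *\<^sub>R \<omega>) * Y \<omega>)"
  proof -
    have "smooth_on V (angular_laplacian g)"
      unfolding angular_laplacian_def[abs_def]
      by (intro smooth_on_cmult smooth_on_sum smooth_on_rot_deriv g smooth_on_open[OF g])
    then show ?thesis by (rule cont)
  qed
  have "r\<^sup>2 * sph_coeff Y (laplacian g) r = sphere_mean (\<lambda>\<omega>. r\<^sup>2 * laplacian g (r *\<^sub>R \<omega>) * Y \<omega>)"
    unfolding sph_coeff_def sphere_mean_cmult[symmetric] by (simp add: mult.assoc)
  also have "\<dots> = sphere_mean (\<lambda>\<omega>. (euler_deriv (euler_deriv g) (r *\<^sub>R \<omega>) * Y \<omega>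
      + (?n - 2) * (euler_deriv g (r *\<^sub>R \<omega>) * Y \<omega>)) + angular_laplacian g (r *\<^sub>R \<omega>) * Y \<omega>)"
  proof (rule sphere_mean_cong)
    fix \<omega> :: 'a assume w: "norm \<omega> = 1"
    have rr: "(r *\<^sub>R \<omega>) \<bullet> (r *\<^sub>R \<omega>) = r\<^sup>2"
      using w by (simp add: dot_square_norm power2_eq_square)
    have "r\<^sup>2 * laplacian g (r *\<^sub>R \<omega>) = euler_deriv (euler_deriv g) (r *\<^sub>R \<omega>)
        + (?n - 2) * euler_deriv g (r *\<^sub>R \<omega>) + angular_laplacian g (r *\<^sub>R \<omega>)"
      using laplacian_polar[OF g V[OF w]] unfolding rr angular_laplacian_def .
    then show "r\<^sup>2 * laplacian g (r *\<^sub>R \<omega>) * Y \<omega> = (euler_deriv (euler_deriv g) (r *\<^sub>R \<omega>) * Y \<omega>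
      + (?n - 2) * (euler_deriv g (r *\<^sub>R \<omega>) * Y \<omega>)) + angular_laplacian g (r *\<^sub>R \<omega>) * Y \<omega>"
      by (simp add: ring_distribs)
  qed
  also have "\<dots> = sph_coeff Y (euler_deriv (euler_deriv g)) r
      + (?n - 2) * sph_coeff Y (euler_deriv g) r
      + sphere_mean (\<lambda>\<omega>. angular_laplacian g (r *\<^sub>R \<omega>) * Y \<omega>)"
    using c ca by (simp add: sphere_mean_add sphere_mean_cmult continuous_on_add sph_coeff_def)
  finally show ?thesis unfolding ang by simp
qed

lemma sph_coeff_has_derivative:
  fixes g Y :: "'a::euclidean_space \<Rightarrow> real"
  assumes Y: "solid_harmonic j Y" and g: "smooth_on V g"
    and V: "\<And>t \<omega>. p < t \<Longrightarrow> t < q \<Longrightarrow> norm \<omega> = 1 \<Longrightarrow> t *\<^sub>R \<omega> \<in> V"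
    and r: "p < r" "r < q" "r > 0"
  shows "(sph_coeff Y g has_real_derivative sph_coeff Y (euler_deriv g) r / r) (at r)"
proof -
  have "sph_coeff Y (euler_deriv g) r
      = sphere_mean (\<lambda>\<omega>. r * ((\<Sum>b\<in>Basis. (\<omega> \<bullet> b) * dd [b] g (r *\<^sub>R \<omega>)) * Y \<omega>))"
    unfolding sph_coeff_def euler_deriv_def by (simp add: sum_distrib_left[symmetric] mult.assoc)
  then have eq: "sph_coeff Y (euler_deriv g) r / r
      = sphere_mean (\<lambda>\<omega>. (\<Sum>b\<in>Basis. (\<omega> \<bullet> b) * dd [b] g (r *\<^sub>R \<omega>)) * Y \<omega>)"
    using r(3) by (simp add: sphere_mean_cmult)
  show ?thesis
    unfolding eq unfolding sph_coeff_def[abs_def]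
    by (rule sphere_mean_has_derivative[OF g V r(1,2) solid_harmonic_continuous[OF Y]])
qed

lemma sph_coeff_continuous:
  fixes g Y :: "'a::euclidean_space \<Rightarrow> real"
  assumes Y: "solid_harmonic j Y" and g: "smooth_on V g"
    and V: "\<And>t \<omega>. p < t \<Longrightarrow> t < q \<Longrightarrow> norm \<omega> = 1 \<Longrightarrow> t *\<^sub>R \<omega> \<in> V"
  shows "continuous_on {p<..<q} (sph_coeff Y g)"
proof (intro continuous_at_imp_continuous_on ballI)
  fix r assume "r \<in> {p<..<q}"
  then have r: "p < r" "r < q" by auto
  show "isCont (sph_coeff Y g) r"
    unfolding sph_coeff_def[abs_def]
    by (rule DERIV_isCont[OF sphere_mean_has_derivative[OF g V r solid_harmonic_continuous[OF Y]]])
qed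

section \<open>Completeness of the spherical harmonics\<close>

inductive sum_of_hpoly :: "('a::euclidean_space \<Rightarrow> real) \<Rightarrow> bool" where
  base: "hpoly d f \<Longrightarrow> sum_of_hpoly f"
| add: "sum_of_hpoly f \<Longrightarrow> sum_of_hpoly g \<Longrightarrow> sum_of_hpoly (\<lambda>x. f x + g x)"

lemma sum_of_hpoly_mult:
  "sum_of_hpoly f \<Longrightarrow> sum_of_hpoly g \<Longrightarrow> sum_of_hpoly (\<lambda>x. f x * g x)"
proof (induction rule: sum_of_hpoly.induct)
  case (base d f)
  from base(2,1) show ?case
    by (induction rule: sum_of_hpoly.induct)
      (auto simp: ring_distribs intro: sum_of_hpoly.intros hpoly_mult)
qed (auto simp: ring_distribs intro: sum_of_hpoly.add)

lemma sum_of_hpoly_continuous: "sum_of_hpoly f \<Longrightarrow> continuous_on S f"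
  by (induction rule: sum_of_hpoly.induct)
    (auto intro: continuous_on_add continuous_on_subset smooth_on_continuous[OF hpoly_smooth[OF _ open_UNIV]])

text \<open>By the Fischer decomposition \<open>g\<close> is orthogonal to every homogeneous
  polynomial, hence to the algebra \<open>sum_of_hpoly\<close>, which mixes degrees as
  Stone-Weierstrass requires. Uniform approximation of \<open>g\<close> by that algebra makes the
  mean of \<open>g\<close> squared arbitrarily small.\<close>

lemma sphere_mean_complete:
  fixes g :: "'a::euclidean_space \<Rightarrow> real"
  assumes g: "continuous_on (sphere 0 1) g"
    and orth: "\<And>j Y. solid_harmonic j Y \<Longrightarrow> sphere_mean (\<lambda>\<omega>. g \<omega> * Y \<omega>) = 0"
    and w: "norm \<omega> = 1"
  shows "g \<omega> = 0"
proof -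
  have hd: "sphere_mean (\<lambda>\<omega>. g \<omega> * f \<omega>) = 0" if "hdec d f" for d f
    using that
  proof (induction rule: hdec.induct)
    case (base l h i c)
    have "sphere_mean (\<lambda>\<omega>. g \<omega> * (c * ((\<omega> \<bullet> \<omega>) ^ i * h \<omega>))) = sphere_mean (\<lambda>\<omega>. c * (g \<omega> * h \<omega>))"
      by (rule sphere_mean_cong) (simp add: dot_square_norm)
    then show ?case using orth[OF base] by (simp add: sphere_mean_cmult)
  next
    case (add d f h)
    have "continuous_on (sphere 0 1) f" "continuous_on (sphere 0 1) h"
      using add.hyps hdec_hpoly sum_of_hpoly.base sum_of_hpoly_continuous by blast+
    then show ?case using add.IH g
      by (simp add: ring_distribs sphere_mean_add continuous_on_mult)
  qed
  have sh: "sphere_mean (\<lambda>\<omega>. g \<omega> * f \<omega>) = 0" if "sum_of_hpoly f" for f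
    using that
  proof (induction rule: sum_of_hpoly.induct)
    case (add f h)
    then show ?case using g
      by (simp add: ring_distribs sphere_mean_add continuous_on_mult sum_of_hpoly_continuous)
  qed (use hd hpoly_hdec in blast)
  interpret function_ring_on "{f. sum_of_hpoly f}" "sphere (0::'a) 1"
  proof
    fix x y :: 'a assume "x \<noteq> y"
    then obtain b where b: "b \<in> Basis" "x \<bullet> b \<noteq> y \<bullet> b" using euclidean_eqI by blast
    have "sum_of_hpoly (\<lambda>x. (x \<bullet> b) * 1)"
      by (rule sum_of_hpoly.base[OF hpoly.var[OF hpoly.const b(1)]])
    then show "\<exists>f\<in>{f. sum_of_hpoly f}. f x \<noteq> f y"
      using b(2) by (intro bexI[of _ "\<lambda>x. (x \<bullet> b) * 1"]) auto
  qed (auto intro: sum_of_hpoly.intros hpoly.const sum_of_hpoly_mult sum_of_hpoly_continuous)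
  let ?M = "sphere_mean (\<lambda>\<omega>::'a. 1)"
  obtain B where B: "B > 0" "\<And>\<omega>. norm \<omega> = 1 \<Longrightarrow> \<bar>g \<omega>\<bar> \<le> B"
    using compact_imp_bounded[OF compact_continuous_image[OF g compact_sphere]]
    unfolding bounded_pos by auto
  have M: "?M \<ge> 0" unfolding sphere_mean_def by (rule integral_nonneg)
      (auto intro!: integrable_continuous continuous_on_bump)
  have "\<bar>sphere_mean (\<lambda>\<omega>. g \<omega> * g \<omega>)\<bar> \<le> e" if e: "e > 0" for e
  proof -
    \<comment> \<open>The error of the approximation is at most \<open>B * d * ?M\<close>; the
      summand 1 keeps the denominator positive.\<close>
    define d where "d = e / (B * ?M + 1)"
    have BM: "B * ?M \<ge> 0" using B(1) M by simp
    have d: "d > 0" unfolding d_def using e BM by simp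
    from Stone_Weierstrass_basic[OF g d] obtain f where f: "sum_of_hpoly f"
      "\<And>x. norm x = 1 \<Longrightarrow> \<bar>g x - f x\<bar> < d" by auto
    have cf: "continuous_on (sphere 0 1) f" using f(1) by (rule sum_of_hpoly_continuous)
    have "sphere_mean (\<lambda>\<omega>. g \<omega> * g \<omega>) = sphere_mean (\<lambda>\<omega>. g \<omega> * (g \<omega> - f \<omega>))"
      using sh[OF f(1)] g cf by (simp add: right_diff_distrib sphere_mean_diff continuous_on_mult)
    also have "\<bar>\<dots>\<bar> \<le> (B * d) * ?M"
    proof (rule sphere_mean_abs_le)
      show "\<bar>g \<omega> * (g \<omega> - f \<omega>)\<bar> \<le> B * d" if "norm \<omega> = 1" for \<omega>
        unfolding abs_mult using B f(2)[OF that] that by (intro mult_mono) (auto simp: less_imp_le)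
    qed (intro continuous_intros g cf)
    also have "\<dots> = d * (B * ?M)" by simp
    also have "\<dots> \<le> d * (B * ?M + 1)" using d by simp
    also have "\<dots> = e" unfolding d_def using BM by simp
    finally show ?thesis .
  qed
  then have "sphere_mean (\<lambda>\<omega>. g \<omega> * g \<omega>) = 0"
    by (meson abs_le_zero_iff field_le_epsilon le_add_same_cancel1 order.trans zero_le_square
        dense_ge)
  from sphere_mean_eq_0D[OF _ _ this w] show ?thesis using g by (simp add: continuous_on_mult)
qed

section \<open>Radial profiles\<close>

text \<open>The form \<open>r ^ d / r\<close> avoids the truncated exponent \<open>d - 1\<close> and
  so needs no case \<open>d = 0\<close> later.\<close>

lemma DERIV_power_pos:
  "r > 0 \<Longrightarrow> ((\<lambda>r::real. r ^ d) has_real_derivative real d * r ^ d / r) (at r)"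
  using DERIV_pow[of d r] by (cases d) auto

text \<open>For a function \<open>c(r) Y\<close> with \<open>Y\<close> a spherical harmonic of degree \<open>j\<close> in dimension \<open>d + 2\<close> and
  \<open>l = j (j + d)\<close>, the function \<open>c1\<close> is \<open>r c'\<close> and \<open>w\<close> is the radial part of the Laplacian. The case
  \<open>e = 0\<close> is the ball.\<close>

definition radial_profile ::
  "nat \<Rightarrow> real \<Rightarrow> real \<Rightarrow> (real \<Rightarrow> real) \<Rightarrow> (real \<Rightarrow> real) \<Rightarrow> (real \<Rightarrow> real) \<Rightarrow> bool" where
  "radial_profile d l e c c1 w \<longleftrightarrow> 0 \<le> e \<and> e < 1 \<and> c1 1 = 0 \<and> c1 e = 0 \<and>
    continuous_on {e..1} c \<and> continuous_on {e..1} c1 \<and> continuous_on {e..1} w \<and>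
    (\<forall>r. e < r \<and> r < 1 \<longrightarrow> (c has_real_derivative c1 r / r) (at r) \<and>
      (c1 has_real_derivative (r\<^sup>2 * w r - real d * c1 r + l * c r) / r) (at r))"

lemma radial_profileD:
  assumes "radial_profile d l e c c1 w" "e < r" "r < 1"
  shows "(c has_real_derivative c1 r / r) (at r)"
    "(c1 has_real_derivative (r\<^sup>2 * w r - real d * c1 r + l * c r) / r) (at r)"
  using assms by (simp_all add: radial_profile_def)

text \<open>h(r) Y is harmonic and \<open>h1\<close> is r h'. There are no boundary conditions, so
  that singular solutions can serve as test functions.\<close>

definition radial_harmonic :: "nat \<Rightarrow> real \<Rightarrow> real \<Rightarrow> (real \<Rightarrow> real) \<Rightarrow> (real \<Rightarrow> real) \<Rightarrow> bool" where
  "radial_harmonic d l e h h1 \<longleftrightarrow> continuous_on {e..1} h \<and> continuous_on {e..1} h1 \<and>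
    (\<forall>r. e < r \<and> r < 1 \<longrightarrow> (h has_real_derivative h1 r / r) (at r) \<and>
      (h1 has_real_derivative (l * h r - real d * h1 r) / r) (at r))"

text \<open>Green's second identity for h Y and c Y, with weight r^(n-1) for n = d + 2. The Neumann
  conditions on \<open>c1\<close> remove half of the boundary terms, so only boundary values of
  \<open>c\<close> remain.\<close>

lemma radial_green:
  assumes c: "radial_profile d l e c c1 w" and h: "radial_harmonic d l e h h1"
  shows "((\<lambda>r. r ^ Suc d * (h r * w r)) has_integral (e ^ d * (h1 e * c e) - h1 1 * c 1)) {e..1}"
proof -
  let ?F = "\<lambda>r. r ^ d * (h r * c1 r - h1 r * c r)"
  have e: "0 \<le> e" "e < 1" and b: "c1 1 = 0" "c1 e = 0"
    using c by (auto simp: radial_profile_def)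
  have "((\<lambda>r. r ^ Suc d * (h r * w r)) has_integral (?F 1 - ?F e)) {e..1}"
  proof (rule fundamental_theorem_of_calculus_interior)
    show "continuous_on {e..1} ?F"
      using c h unfolding radial_profile_def radial_harmonic_def by (intro continuous_intros) auto
    fix r assume "r \<in> {e<..<1}"
    then have r: "e < r" "r < 1" "r > 0" using e by auto
    have D: "(c has_real_derivative c1 r / r) (at r)"
      "(c1 has_real_derivative (r\<^sup>2 * w r - real d * c1 r + l * c r) / r) (at r)"
      "(h has_real_derivative h1 r / r) (at r)"
      "(h1 has_real_derivative (l * h r - real d * h1 r) / r) (at r)"
      using c h r unfolding radial_profile_def radial_harmonic_def by auto
    have P: "((\<lambda>r. r ^ d) has_real_derivative real d * r ^ d / r) (at r)"
      using r(3) by (rule DERIV_power_pos)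
    have "(?F has_real_derivative (real d * r ^ d / r) * (h r * c1 r - h1 r * c r)
        + r ^ d * ((h1 r / r * c1 r + h r * ((r\<^sup>2 * w r - real d * c1 r + l * c r) / r))
          - ((l * h r - real d * h1 r) / r * c r + h1 r * (c1 r / r)))) (at r)"
      by (rule derivative_eq_intros P D refl)+ (simp add: algebra_simps)
    also have "(real d * r ^ d / r) * (h r * c1 r - h1 r * c r)
        + r ^ d * ((h1 r / r * c1 r + h r * ((r\<^sup>2 * w r - real d * c1 r + l * c r) / r))
          - ((l * h r - real d * h1 r) / r * c r + h1 r * (c1 r / r)))
        = r ^ Suc d * (h r * w r)"
      using r(3) by (simp add: field_simps power2_eq_square)
    finally show "(?F has_vector_derivative r ^ Suc d * (h r * w r)) (at r)"
      by (simp add: has_real_derivative_iff_has_vector_derivative)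
  qed (use e in auto)
  then show ?thesis using b by (simp add: algebra_simps)
qed

definition radial_energy :: "nat \<Rightarrow> real \<Rightarrow> (real \<Rightarrow> real) \<Rightarrow> real" where
  "radial_energy d e w = integral {e..1} (\<lambda>r. r ^ Suc d * (w r)\<^sup>2)"

lemma radial_energy_nonneg: "0 \<le> e \<Longrightarrow> radial_energy d e w \<ge> 0"
  unfolding radial_energy_def
  by (cases "(\<lambda>r. r ^ Suc d * (w r)\<^sup>2) integrable_on {e..1}")
    (auto intro!: integral_nonneg simp: not_integrable_integral)

text \<open>Pointwise w^2 >= 2 h w - h^2, and the mixed term is known from
  \<open>radial_green\<close>. Every harmonic \<open>h\<close> thus bounds the energy below by
  boundary values of \<open>c\<close> alone.\<close>

lemma radial_energy_test:
  assumes c: "radial_profile d l e c c1 w" and h: "radial_harmonic d l e h h1"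
    and I: "integral {e..1} (\<lambda>r. r ^ Suc d * (h r)\<^sup>2) \<le> I"
  shows "radial_energy d e w \<ge> 2 * (e ^ d * (h1 e * c e) - h1 1 * c 1) - I"
proof -
  have e: "0 \<le> e" and cw: "continuous_on {e..1} w" and ch: "continuous_on {e..1} h"
    using c h by (auto simp: radial_profile_def radial_harmonic_def)
  have 1: "((\<lambda>r. 2 * (r ^ Suc d * (h r * w r)) - r ^ Suc d * (h r)\<^sup>2) has_integral
     2 * (e ^ d * (h1 e * c e) - h1 1 * c 1) - integral {e..1} (\<lambda>r. r ^ Suc d * (h r)\<^sup>2)) {e..1}"
    by (intro has_integral_diff has_integral_mult_right radial_green[OF c h] integrable_integral
        integrable_continuous_interval continuous_intros ch)
  have 2: "((\<lambda>r. r ^ Suc d * (w r)\<^sup>2) has_integral radial_energy d e w) {e..1}"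
    unfolding radial_energy_def
    by (intro integrable_integral integrable_continuous_interval continuous_intros cw)
  have "2 * (r ^ Suc d * (h r * w r)) - r ^ Suc d * (h r)\<^sup>2 \<le> r ^ Suc d * (w r)\<^sup>2"
    if "r \<in> {e..1}" for r
  proof -
    have "0 \<le> r ^ Suc d * (h r - w r)\<^sup>2" using that e by auto
    then show ?thesis by (simp add: power2_diff algebra_simps)
  qed
  from has_integral_le[OF 1 2 this] I show ?thesis by linarith
qed

text \<open>Zero energy gives w = 0. Then r^d c1 c is nondecreasing and zero at both ends, so its
  derivative, proportional to l c^2 + c1^2, vanishes and \<open>c\<close> is constant. The condition
  \<open>c 1 = 0\<close> removes the constant that survives for l = 0.\<close>

lemma radial_vanish:
  assumes c: "radial_profile d l e c c1 w" and l: "l \<ge> 0"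
    and w: "radial_energy d e w \<le> 0" and c1: "c 1 = 0" and r: "r \<in> {e..1}"
  shows "c r = 0"
proof -
  have e: "0 \<le> e" "e < 1" and b: "c1 1 = 0" "c1 e = 0"
    and cc: "continuous_on {e..1} c" "continuous_on {e..1} c1" "continuous_on {e..1} w"
    using c by (auto simp: radial_profile_def)
  have "radial_energy d e w = 0" using w radial_energy_nonneg[OF e(1)] by (metis antisym)
  then have "\<forall>r\<in>{e..1}. r ^ Suc d * (w r)\<^sup>2 = 0"
  proof -
    have "continuous_on (cbox e 1) (\<lambda>r. r ^ Suc d * (w r)\<^sup>2)"
      unfolding cbox_interval by (intro continuous_intros cc)
    from integral_cbox_eq_0_iff[OF this] show ?thesis
      using e \<open>radial_energy d e w = 0\<close> by (simp add: radial_energy_def)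
  qed
  then have w0: "w r = 0" if "e < r" "r < 1" for r
    using bspec[of "{e..1}" "\<lambda>r. r ^ Suc d * (w r)\<^sup>2 = 0" r] that e(1) by simp
  let ?F = "\<lambda>r. r ^ d * (c1 r * c r)"
  have cF: "continuous_on {e..1} ?F" by (intro continuous_intros cc)
  have dF: "(?F has_real_derivative r ^ d * (l * (c r)\<^sup>2 + (c1 r)\<^sup>2) / r) (at r)"
    if "e < r" "r < 1" for r
  proof -
    have r: "r > 0" using that e by linarith
    have D: "(c has_real_derivative c1 r / r) (at r)"
      "(c1 has_real_derivative (r\<^sup>2 * w r - real d * c1 r + l * c r) / r) (at r)"
      using c that unfolding radial_profile_def by auto
    have P: "((\<lambda>r. r ^ d) has_real_derivative real d * r ^ d / r) (at r)"
      using r by (rule DERIV_power_pos)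
    have "(?F has_real_derivative (real d * r ^ d / r) * (c1 r * c r)
       + r ^ d * ((r\<^sup>2 * w r - real d * c1 r + l * c r) / r * c r + c1 r * (c1 r / r))) (at r)"
      by (rule derivative_eq_intros P D refl)+ (simp add: algebra_simps)
    also have "(real d * r ^ d / r) * (c1 r * c r)
       + r ^ d * ((r\<^sup>2 * w r - real d * c1 r + l * c r) / r * c r + c1 r * (c1 r / r))
       = r ^ d * (l * (c r)\<^sup>2 + (c1 r)\<^sup>2) / r"
      using r w0[OF that] by (simp add: field_simps power2_eq_square)
    finally show ?thesis .
  qed
  have dF0: "r ^ d * (l * (c r)\<^sup>2 + (c1 r)\<^sup>2) / r \<ge> 0" if "e < r" for r
    using that e l by auto
  have mono: "?F x \<le> ?F y" if "e \<le> x" "x \<le> y" "y \<le> 1" for x y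
  proof (rule DERIV_nonneg_imp_increasing_open[OF that(2)])
    show "continuous_on {x..y} ?F" using cF by (rule continuous_on_subset) (use that in auto)
    fix r assume "x < r" "r < y"
    then show "\<exists>z. (?F has_real_derivative z) (at r) \<and> 0 \<le> z"
      using dF[of r] dF0[of r] that by (intro exI conjI) auto
  qed
  have F0: "?F r = 0" if "e \<le> r" "r \<le> 1" for r
    using mono[of e r] mono[of r 1] that b by simp
  have c10: "c1 r = 0" if "e < r" "r < 1" for r
  proof -
    have r: "r > 0" using that e by linarith
    have "(?F has_real_derivative 0) (at r)"
      by (rule has_field_derivative_transform_within_open[of "\<lambda>r. 0" _ _ "{e<..<1}"])
        (use that F0 in \<open>auto simp del: mult_eq_0_iff\<close>)
    from DERIV_unique[OF this dF[OF that]] r l have "l * (c r)\<^sup>2 + (c1 r)\<^sup>2 = 0" by auto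
    moreover have "l * (c r)\<^sup>2 \<ge> 0" using l by simp
    moreover have "(c1 r)\<^sup>2 \<ge> 0" by simp
    ultimately have "(c1 r)\<^sup>2 = 0" by linarith
    then show ?thesis by simp
  qed
  have "c r = c 1" if "e \<le> r" "r < 1" for r
  proof (rule DERIV_isconst_end[symmetric, OF that(2)])
    show "continuous_on {r..1} c" using cc(1) by (rule continuous_on_subset) (use that in auto)
    fix x assume "r < x" "x < 1"
    then show "(c has_real_derivative 0) (at x)"
      using c c10[of x] that unfolding radial_profile_def
      by (metis div_0 order.strict_trans1)
  qed
  then show ?thesis using r c1 by (cases "r = 1") auto
qed

text \<open>Allows one estimate, in degree k, to serve all degrees j >= k. The same \<open>c\<close>
  is a profile for l' once \<open>w\<close> is changed by (l - l') c / r^2; expanding the square,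
  the energy can only have dropped if the integral of r^(d-1) w' c is at most 0, which is where l'
  >= 1 enters.\<close>

lemma radial_energy_mono:
  assumes c: "radial_profile d l e c c1 w" and e: "e > 0" and l: "1 \<le> l'" "l' \<le> l"
  obtains w' where "radial_profile d l' e c c1 w'" "radial_energy d e w' \<le> radial_energy d e w"
proof -
  define m where "m = l - l'"
  define w' where "w' r = w r + m * c r / r\<^sup>2" for r
  have e1: "e < 1" and b: "c1 1 = 0" "c1 e = 0"
    and cc: "continuous_on {e..1} c" "continuous_on {e..1} c1" "continuous_on {e..1} w"
    using c by (auto simp: radial_profile_def)
  have cw': "continuous_on {e..1} w'"
    unfolding w'_def[abs_def] using e by (intro continuous_intros cc) auto
  have prof: "radial_profile d l' e c c1 w'"
  proof -
    have eq: "r\<^sup>2 * w' r - real d * c1 r + l' * c r = r\<^sup>2 * w r - real d * c1 r + l * c r" if "r > 0" for r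
      using that unfolding w'_def m_def by (simp add: field_simps)
    have "(c1 has_real_derivative (r\<^sup>2 * w' r - real d * c1 r + l' * c r) / r) (at r)"
      if "e < r" "r < 1" for r
    proof -
      have "r > 0" using that e by linarith
      then show ?thesis using radial_profileD(2)[OF c that] by (simp only: eq)
    qed
    then show ?thesis using c cw' radial_profileD(1)[OF c] by (simp add: radial_profile_def)
  qed
  \<comment> \<open>The weight r^(d-2) is chosen so that in the derivative the terms without
    \<open>w'\<close> form (l' - 1) c^2 + (c - c1)^2. \<open>?F\<close> vanishes at both ends, hence
    \<open>?q\<close> has integral 0.\<close>
  let ?F = "\<lambda>r. r ^ d / r\<^sup>2 * (c1 r * c r)"
  let ?q = "\<lambda>r. r ^ d / r ^ 3 * (r\<^sup>2 * w' r * c r + ((l' - 1) * (c r)\<^sup>2 + (c r - c1 r)\<^sup>2))"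
  have "(?q has_integral (?F 1 - ?F e)) {e..1}"
  proof (rule fundamental_theorem_of_calculus_interior)
    show "continuous_on {e..1} ?F" using e by (intro continuous_intros cc) auto
    fix r assume "r \<in> {e<..<1}"
    then have r: "e < r" "r < 1" "r > 0" using e by auto
    have D: "(c has_real_derivative c1 r / r) (at r)"
      "(c1 has_real_derivative (r\<^sup>2 * w' r - real d * c1 r + l' * c r) / r) (at r)"
      using prof r unfolding radial_profile_def by auto
    have "(real d * r ^ d / r * r\<^sup>2 - r ^ d * (real 2 * r\<^sup>2 / r)) / (r\<^sup>2 * r\<^sup>2)
        = (real d - 2) * r ^ d / r ^ 3"
      using r(3) by (simp add: field_simps power2_eq_square power3_eq_cube)
    with DERIV_divide[OF DERIV_power_pos[OF r(3), of d] DERIV_power_pos[OF r(3), of 2]] r(3)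
    have P: "((\<lambda>r. r ^ d / r\<^sup>2) has_real_derivative (real d - 2) * r ^ d / r ^ 3) (at r)"
      by simp
    have "(?F has_real_derivative ((real d - 2) * r ^ d / r ^ 3) * (c1 r * c r)
       + r ^ d / r\<^sup>2 * ((r\<^sup>2 * w' r - real d * c1 r + l' * c r) / r * c r + c1 r * (c1 r / r))) (at r)"
      by (rule derivative_eq_intros P D refl)+ (simp add: algebra_simps)
    also have "((real d - 2) * r ^ d / r ^ 3) * (c1 r * c r)
       + r ^ d / r\<^sup>2 * ((r\<^sup>2 * w' r - real d * c1 r + l' * c r) / r * c r + c1 r * (c1 r / r)) = ?q r"
      using r(3) by (simp add: field_simps power2_eq_square power3_eq_cube)
    finally show "(?F has_vector_derivative ?q r) (at r)"
      by (simp add: has_real_derivative_iff_has_vector_derivative)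
  qed (use e1 in auto)
  then have q0: "integral {e..1} ?q = 0" using b by (simp add: integral_unique)
  let ?s = "\<lambda>r. r ^ d / r * (w' r * c r)"
  have ints: "?s integrable_on {e..1}" and iq: "?q integrable_on {e..1}"
    using e by (intro integrable_continuous_interval continuous_intros cc cw'; auto)+
  have s0: "integral {e..1} ?s \<le> 0"
    unfolding q0[symmetric]
  proof (rule integral_le[OF ints iq])
    fix r assume "r \<in> {e..1}"
    then have r: "r > 0" using e by auto
    have "0 \<le> r ^ d / r ^ 3 * ((l' - 1) * (c r)\<^sup>2 + (c r - c1 r)\<^sup>2)"
      using r l by (intro mult_nonneg_nonneg add_nonneg_nonneg) auto
    moreover have "?q r = ?s r + r ^ d / r ^ 3 * ((l' - 1) * (c r)\<^sup>2 + (c r - c1 r)\<^sup>2)"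
      using r by (simp add: field_simps power2_eq_square power3_eq_cube)
    ultimately show "?s r \<le> ?q r" by linarith
  qed
  have iw: "(\<lambda>r. r ^ Suc d * (w r)\<^sup>2) integrable_on {e..1}"
    and iw': "(\<lambda>r. r ^ Suc d * (w' r)\<^sup>2) integrable_on {e..1}"
    by (intro integrable_continuous_interval continuous_intros cc cw')+
  have "((\<lambda>r. r ^ Suc d * (w' r)\<^sup>2 - 2 * m * ?s r) has_integral
      radial_energy d e w' - 2 * m * integral {e..1} ?s) {e..1}"
    unfolding radial_energy_def
    by (intro has_integral_diff has_integral_mult_right integrable_integral iw' ints)
  then have "radial_energy d e w' - 2 * m * integral {e..1} ?s
      = integral {e..1} (\<lambda>r. r ^ Suc d * (w' r)\<^sup>2 - 2 * m * ?s r)"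
    by (rule integral_unique[symmetric])
  also have "\<dots> \<le> radial_energy d e w"
    unfolding radial_energy_def
  proof (rule integral_le)
    show "(\<lambda>r. r ^ Suc d * (w' r)\<^sup>2 - 2 * m * ?s r) integrable_on {e..1}"
      using ints iw' by (intro integrable_diff integrable_on_mult_right)
    fix r assume "r \<in> {e..1}"
    then have r: "r > 0" using e by auto
    have ww: "w r = w' r - m * c r / r\<^sup>2" by (simp add: w'_def)
    have "r ^ Suc d * (w r)\<^sup>2 = r ^ Suc d * (w' r)\<^sup>2 - 2 * m * ?s r + r ^ Suc d * (m * c r / r\<^sup>2)\<^sup>2"
      unfolding ww using r by (simp add: field_simps power2_eq_square)
    moreover have "r ^ Suc d * (m * c r / r\<^sup>2)\<^sup>2 \<ge> 0" using r by simp
    ultimately show "r ^ Suc d * (w' r)\<^sup>2 - 2 * m * ?s r \<le> r ^ Suc d * (w r)\<^sup>2" by linarith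
  qed (rule iw)
  finally have "radial_energy d e w' - 2 * m * integral {e..1} ?s \<le> radial_energy d e w" .
  moreover have "2 * m * integral {e..1} ?s \<le> 0"
    using s0 l by (intro mult_nonneg_nonpos) (auto simp: m_def)
  ultimately have "radial_energy d e w' \<le> radial_energy d e w" by linarith
  with prof show ?thesis by (rule that)
qed

text \<open>The eigenvalue of the unit ball in dimension \<open>d + 2\<close> of angular degree \<open>k\<close>.\<close>

definition ball_eigval :: "nat \<Rightarrow> nat \<Rightarrow> real" where
  "ball_eigval d k = (real k)\<^sup>2 * real (2 * k + d + 2)"

text \<open>The sum of the coefficients of the mixed products of outer and inner boundary value in
  \<open>radial_energy_lower\<close>. It enters squared because Young's inequality shifts these
  products onto the outer value.\<close>

definition eigval_loss :: "nat \<Rightarrow> nat \<Rightarrow> real" where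
  "eigval_loss d k = 2 * real (k + d) + 2 * ball_eigval d k + real k * real (2 * k + d + 2)"

text \<open>The test function \<open>\<alpha> r^k + \<beta> r^(-k-d)\<close> is the harmonic profile of the ball, corrected by a
  singular term that detects the inner boundary value \<open>c e = e^k t\<close>; taking \<open>\<beta>\<close> of order \<open>e^(2k+d)\<close>
  keeps the loss in the first term below the gain in boundary area.\<close>

lemma radial_energy_lower:
  assumes c: "radial_profile d (real k * real (k + d)) e c c1 w"
    and e: "0 < e" "e \<le> 1/2" and q: "k + d \<ge> 1"
  shows "radial_energy d e w \<ge> (ball_eigval d k - (eigval_loss d k)\<^sup>2 * e ^ (2 * k + d)) * (c 1)\<^sup>2 + e ^ d * (c e)\<^sup>2"
proof -
  define N where "N = 2 * k + d"
  define q where "q = k + d"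
  define x where "x = c 1"
  define t where "t = c e / e ^ k"
  \<comment> \<open>For h = a r^k alone the test bound is - 2 a k x - a^2 / (N + 2); this choice of
    the coefficient maximises it, with value \<open>ball_eigval d k * x\<^sup>2\<close>.\<close>
  define \<alpha> where "\<alpha> = - (real k * real (N + 2) * x)"
  define \<beta> where "\<beta> = - (e ^ N * t)"
  define h where "h = (\<lambda>r. \<alpha> * r ^ k + \<beta> / r ^ q)"
  define h1 where "h1 = (\<lambda>r. \<alpha> * real k * r ^ k - \<beta> * real q / r ^ q)"
  have ce: "c e = e ^ k * t" using e by (simp add: t_def)
  have q1: "q \<ge> 1" and N1: "N \<ge> 1" using q by (auto simp: q_def N_def)
  have harm: "radial_harmonic d (real k * real (k + d)) e h h1"
    unfolding radial_harmonic_def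
  proof (intro conjI allI impI)
    show "continuous_on {e..1} h" "continuous_on {e..1} h1"
      unfolding h_def h1_def using e by (intro continuous_intros; auto)+
    fix r assume "e < r \<and> r < 1"
    then have r: "r > 0" using e by auto
    have P: "((\<lambda>r. r ^ k) has_real_derivative real k * r ^ k / r) (at r)"
      using r by (rule DERIV_power_pos)
    have Q: "((\<lambda>r. 1 / r ^ q) has_real_derivative - real q / r ^ q / r) (at r)"
      using DERIV_divide[OF DERIV_const[of 1] DERIV_power_pos[OF r, of q]] r by (simp add: field_simps)
    have "((\<lambda>r. \<alpha> * r ^ k + \<beta> * (1 / r ^ q)) has_real_derivative
        \<alpha> * (real k * r ^ k / r) + \<beta> * (- real q / r ^ q / r)) (at r)"
      by (intro DERIV_add DERIV_cmult P Q)
    moreover have "\<alpha> * (real k * r ^ k / r) + \<beta> * (- real q / r ^ q / r) = h1 r / r"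
      unfolding h1_def using r by (simp add: field_simps)
    ultimately show "(h has_real_derivative h1 r / r) (at r)"
      unfolding h_def by simp
    have "((\<lambda>r. \<alpha> * real k * r ^ k - \<beta> * real q * (1 / r ^ q)) has_real_derivative
        \<alpha> * real k * (real k * r ^ k / r) - \<beta> * real q * (- real q / r ^ q / r)) (at r)"
      by (intro DERIV_diff DERIV_cmult P Q)
    moreover have "\<alpha> * real k * (real k * r ^ k / r) - \<beta> * real q * (- real q / r ^ q / r)
        = (real k * real (k + d) * h r - real d * h1 r) / r"
      unfolding h_def h1_def using r by (simp add: q_def field_simps)
    ultimately show "(h1 has_real_derivative (real k * real (k + d) * h r - real d * h1 r) / r) (at r)"
      unfolding h1_def by simp
  qed
  have I: "integral {e..1} (\<lambda>r. r ^ Suc d * (h r)\<^sup>2)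
      \<le> \<alpha>\<^sup>2 / real (N + 2) + \<bar>\<alpha> * \<beta>\<bar> + \<beta>\<^sup>2 * (e / e ^ N)"
  proof -
    \<comment> \<open>An antiderivative of the majorant \<open>?g\<close>. In \<open>?g\<close> the
      nonincreasing factor r / r^N is replaced by its value at \<open>e\<close>; this avoids a
      logarithm at N = 2 and costs only an extra e e^N t^2.\<close>
    let ?G = "\<lambda>r. \<alpha>\<^sup>2 * r ^ (N + 2) / real (N + 2) + \<bar>\<alpha> * \<beta>\<bar> * r\<^sup>2 + \<beta>\<^sup>2 * (e / e ^ N) * r"
    let ?g = "\<lambda>r. \<alpha>\<^sup>2 * r ^ (N + 1) + \<bar>\<alpha> * \<beta>\<bar> * (2 * r) + \<beta>\<^sup>2 * (e / e ^ N)"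
    have G: "(?g has_integral (?G 1 - ?G e)) {e..1}"
    proof (rule fundamental_theorem_of_calculus)
      fix r assume "r \<in> {e..1}"
      have "((\<lambda>r. r ^ (N + 2) / real (N + 2)) has_real_derivative r ^ (N + 1)) (at r within {e..1})"
        by (auto intro!: derivative_eq_intros simp del: of_nat_add power_Suc)
      then have "((\<lambda>r. \<alpha>\<^sup>2 * (r ^ (N + 2) / real (N + 2)) + \<bar>\<alpha> * \<beta>\<bar> * r\<^sup>2 + \<beta>\<^sup>2 * (e / e ^ N) * r)
          has_real_derivative ?g r) (at r within {e..1})"
        by (intro DERIV_add DERIV_cmult DERIV_cmult_Id)
          (auto intro!: derivative_eq_intros simp del: of_nat_add power_Suc)
      then show "(?G has_vector_derivative ?g r) (at r within {e..1})"
        by (simp add: has_real_derivative_iff_has_vector_derivative)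
    qed (use e in auto)
    have H: "((\<lambda>r. r ^ Suc d * (h r)\<^sup>2) has_integral
        integral {e..1} (\<lambda>r. r ^ Suc d * (h r)\<^sup>2)) {e..1}"
      using harm unfolding radial_harmonic_def
      by (intro integrable_integral integrable_continuous_interval continuous_intros) auto
    have "r ^ Suc d * (h r)\<^sup>2 \<le> ?g r" if "r \<in> {e..1}" for r
    proof -
      have r: "r > 0" "e \<le> r" "r \<le> 1" using that e by auto
      have "r ^ Suc d * (h r)\<^sup>2 = \<alpha>\<^sup>2 * r ^ (N + 1) + \<alpha> * \<beta> * (2 * r) + \<beta>\<^sup>2 * (r / r ^ N)"
      proof -
        have expand: "D * s * (\<alpha> * A + \<beta> / (A * D))\<^sup>2
            = \<alpha>\<^sup>2 * (A * A * D * s) + \<alpha> * \<beta> * (2 * s) + \<beta>\<^sup>2 * (s / (A * A * D))"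
          if "A \<noteq> 0" "D \<noteq> 0" for A D s :: real
          using that by (simp add: field_simps power2_eq_square)
        have pw: "r ^ (2 * k + d + 1) = r ^ k * r ^ k * r ^ d * r" "r ^ (2 * k + d) = r ^ k * r ^ k * r ^ d"
          "r ^ Suc d = r ^ d * r" "r ^ (k + d) = r ^ k * r ^ d"
          by (simp_all add: mult_2 power_add)
        show ?thesis
          unfolding h_def N_def q_def pw by (rule expand) (use r in auto)
      qed
      moreover have "\<alpha> * \<beta> * (2 * r) \<le> \<bar>\<alpha> * \<beta>\<bar> * (2 * r)"
        using r by (intro mult_right_mono) auto
      moreover have "r / r ^ N \<le> e / e ^ N"
      proof -
        obtain M where M: "N = Suc M" using N1 by (cases N) auto
        have "1 / r ^ M \<le> 1 / e ^ M"
          using r e by (intro divide_left_mono power_mono mult_pos_pos) auto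
        then show ?thesis using r e unfolding M by simp
      qed
      then have "\<beta>\<^sup>2 * (r / r ^ N) \<le> \<beta>\<^sup>2 * (e / e ^ N)"
        by (rule mult_left_mono) simp
      ultimately show ?thesis by linarith
    qed
    from has_integral_le[OF H G this]
    have "integral {e..1} (\<lambda>r. r ^ Suc d * (h r)\<^sup>2) \<le> ?G 1 - ?G e" .
    moreover have "?G e \<ge> 0" using e by (intro add_nonneg_nonneg mult_nonneg_nonneg divide_nonneg_nonneg) auto
    ultimately show ?thesis by simp
  qed
  have eN: "e ^ N > 0" using e by simp
  have t1: "e ^ d * (h1 e * c e) = \<alpha> * real k * (e ^ N * t) - \<beta> * real q * t"
    unfolding h1_def ce N_def q_def using e(1)
    by (simp add: field_simps power_add mult_2_right)
  have t2: "h1 1 * c 1 = (\<alpha> * real k - \<beta> * real q) * x"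
    unfolding h1_def x_def by simp
  have t3: "\<alpha>\<^sup>2 / real (N + 2) = ball_eigval d k * x\<^sup>2"
    unfolding \<alpha>_def ball_eigval_def N_def by (simp add: power2_eq_square field_simps)
  have t4: "\<beta>\<^sup>2 * (e / e ^ N) = e * (e ^ N * t\<^sup>2)"
    unfolding \<beta>_def using eN by (simp add: power2_eq_square field_simps)
  have t5: "\<bar>\<alpha> * \<beta>\<bar> = real k * real (N + 2) * (e ^ N * \<bar>x * t\<bar>)"
    unfolding \<alpha>_def \<beta>_def using eN by (simp add: abs_mult)
  have t6: "\<alpha> * real k = - ball_eigval d k * x"
    unfolding \<alpha>_def ball_eigval_def N_def by (simp add: power2_eq_square)
  have E: "radial_energy d e w \<ge> 2 * ((\<alpha> * real k * (e ^ N * t) - \<beta> * real q * t)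
      - (\<alpha> * real k - \<beta> * real q) * x)
      - (ball_eigval d k * x\<^sup>2 + real k * real (N + 2) * (e ^ N * \<bar>x * t\<bar>) + e * (e ^ N * t\<^sup>2))"
    using radial_energy_test[OF c harm I] unfolding t1 t2 t3 t4 t5 .
  have "2 * ((\<alpha> * real k * (e ^ N * t) - \<beta> * real q * t) - (\<alpha> * real k - \<beta> * real q) * x)
     = 2 * ball_eigval d k * x\<^sup>2 + e ^ N * (2 * real q * t\<^sup>2 - 2 * real q * (x * t) - 2 * ball_eigval d k * (x * t))"
    unfolding t6 \<beta>_def by (simp add: algebra_simps power2_eq_square)
  then have E2: "radial_energy d e w \<ge> ball_eigval d k * x\<^sup>2
     + e ^ N * (2 * real q * t\<^sup>2 - 2 * real q * (x * t) - 2 * ball_eigval d k * (x * t)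
        - real k * real (N + 2) * \<bar>x * t\<bar> - e * t\<^sup>2)"
    using E by (simp add: algebra_simps)
  have s0: "ball_eigval d k \<ge> 0" unfolding ball_eigval_def by simp
  have "2 * real q * (x * t) + 2 * ball_eigval d k * (x * t) + real k * real (N + 2) * \<bar>x * t\<bar>
      \<le> eigval_loss d k * \<bar>x * t\<bar>"
    unfolding eigval_loss_def ring_distribs
    using mult_left_mono[OF abs_ge_self[of "x * t"], of "2 * real q"]
      mult_left_mono[OF abs_ge_self[of "x * t"], of "2 * ball_eigval d k"] s0
    by (simp add: N_def q_def)
  also have "eigval_loss d k * \<bar>x * t\<bar> \<le> (eigval_loss d k)\<^sup>2 * x\<^sup>2 + t\<^sup>2 / 4"
  proof -
    have "0 \<le> (eigval_loss d k * \<bar>x\<bar> - \<bar>t\<bar> / 2)\<^sup>2" by simp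
    then show ?thesis by (simp add: power2_diff power_mult_distrib abs_mult power_divide algebra_simps)
  qed
  finally have b1: "2 * real q * (x * t) + 2 * ball_eigval d k * (x * t) + real k * real (N + 2) * \<bar>x * t\<bar>
      \<le> (eigval_loss d k)\<^sup>2 * x\<^sup>2 + t\<^sup>2 / 4" .
  have b2: "2 * t\<^sup>2 \<le> 2 * real q * t\<^sup>2" using q1 by (intro mult_right_mono) auto
  have b3: "e * t\<^sup>2 \<le> t\<^sup>2 / 2" using e mult_right_mono[of e "1/2" "t\<^sup>2"] by simp
  \<comment> \<open>Balance for t^2: at least 2 from the singular term, minus 1/4 from Young's
    inequality and 1/2 from e <= 1/2, leaves more than 1.\<close>
  have "t\<^sup>2 - (eigval_loss d k)\<^sup>2 * x\<^sup>2 \<le> 2 * real q * t\<^sup>2 - 2 * real q * (x * t) - 2 * ball_eigval d k * (x * t)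
        - real k * real (N + 2) * \<bar>x * t\<bar> - e * t\<^sup>2"
    using b1 b2 b3 zero_le_power2[of t] by linarith
  from mult_left_mono[OF this less_imp_le[OF eN]] E2
  have "radial_energy d e w \<ge> ball_eigval d k * x\<^sup>2 + e ^ N * (t\<^sup>2 - (eigval_loss d k)\<^sup>2 * x\<^sup>2)" by linarith
  moreover have "e ^ N * t\<^sup>2 = e ^ d * (c e)\<^sup>2"
    unfolding ce N_def by (simp add: power_add power2_eq_square mult_2_right algebra_simps)
  ultimately show ?thesis unfolding N_def x_def by (simp add: algebra_simps)
qed

text \<open>Controls the logarithmic test function of the planar case; it is ln y <= y - 1 at y = 1
  / sqrt r.\<close>

lemma ln_square_bound:
  assumes "0 < r" "r \<le> (1::real)" shows "r * (ln r)\<^sup>2 \<le> 4"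
proof -
  have "ln (1 / sqrt r) \<le> 1 / sqrt r - 1"
    using assms by (intro ln_le_minus_one) auto
  then have "- ln r \<le> 2 / sqrt r"
    using assms by (simp add: ln_div ln_sqrt)
  moreover have "ln r \<le> 0" using assms by simp
  ultimately have "(ln r)\<^sup>2 \<le> (2 / sqrt r)\<^sup>2"
    using power_mono[of "- ln r" "2 / sqrt r" 2] by simp
  also have "\<dots> = 4 / r" using assms by (simp add: power_divide)
  finally show ?thesis using assms by (simp add: field_simps)
qed

text \<open>The low degrees, after their outer boundary value has been removed. For k = d = 0, the
  radial part in the plane, the singular power r^(-k-d) degenerates to a constant and the logarithm
  takes its place.\<close>

lemma radial_energy_lower_zero:
  assumes c: "radial_profile d (real k * real (k + d)) e c c1 w"
    and e: "0 < e" "e \<le> 1/2" and x: "c 1 = 0"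
  shows "radial_energy d e w \<ge> e ^ d * (c e)\<^sup>2 / 4"
proof (cases "k + d \<ge> 1")
  case True
  have "e ^ d * (c e)\<^sup>2 \<ge> 0" using e by simp
  with radial_energy_lower[OF c e True] x show ?thesis by simp
next
  case False
  then have kd: "k = 0" "d = 0" by auto
  \<comment> \<open>The maximiser of 2 b c(e) - 4 b^2, where the term 4 b^2 bounds the integral of
    the test function squared.\<close>
  define \<beta> where "\<beta> = c e / 4"
  have harm: "radial_harmonic 0 0 e (\<lambda>r. \<beta> * ln r) (\<lambda>r. \<beta>)"
    unfolding radial_harmonic_def using e
    by (auto intro!: continuous_intros derivative_eq_intros)
  have "integral {e..1} (\<lambda>r. r ^ Suc 0 * (\<beta> * ln r)\<^sup>2) \<le> integral {e..1} (\<lambda>r. 4 * \<beta>\<^sup>2)"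
  proof (rule integral_le)
    show "(\<lambda>r. r ^ Suc 0 * (\<beta> * ln r)\<^sup>2) integrable_on {e..1}"
      using e by (intro integrable_continuous_interval continuous_intros) auto
    fix r assume r: "r \<in> {e..1}"
    have "r * (ln r)\<^sup>2 * \<beta>\<^sup>2 \<le> 4 * \<beta>\<^sup>2"
      using r e by (intro mult_right_mono ln_square_bound) auto
    then show "r ^ Suc 0 * (\<beta> * ln r)\<^sup>2 \<le> 4 * \<beta>\<^sup>2"
      by (simp add: power_mult_distrib algebra_simps)
  qed auto
  also have "\<dots> \<le> 4 * \<beta>\<^sup>2" using e by (simp add: algebra_simps)
  finally have I: "integral {e..1} (\<lambda>r. r ^ Suc 0 * (\<beta> * ln r)\<^sup>2) \<le> 4 * \<beta>\<^sup>2" .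
  have c': "radial_profile 0 0 e c c1 w" using c kd by simp
  from radial_energy_test[OF c' harm I] x show ?thesis
    unfolding kd \<beta>_def by (simp add: power2_eq_square)
qed

text \<open>After reduction to degree k, the upper and lower energy bounds leave a sum of c(1)^2 and
  e^d c(e)^2 with positive coefficients that is at most 0. The inner coefficient is 1 - T e, because
  the upper bound carries one more power of \<open>e\<close>.\<close>

lemma radial_vanish_high:
  assumes c: "radial_profile d (real j * real (j + d)) e c c1 w"
    and e: "0 < e" "e \<le> 1/2" and k: "1 \<le> k" "k \<le> j"
    and E: "radial_energy d e w \<le> T * ((c 1)\<^sup>2 + e ^ Suc d * (c e)\<^sup>2)"
    and T: "T < ball_eigval d k - (eigval_loss d k)\<^sup>2 * e ^ (2 * k + d)" "T * e < 1" and r: "r \<in> {e..1}"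
  shows "c r = 0"
proof -
  have l: "1 \<le> real k * real (k + d)" "real k * real (k + d) \<le> real j * real (j + d)"
  proof -
    have "1 \<le> k * (k + d)" "k * (k + d) \<le> j * (j + d)"
      using k by (auto intro: mult_mono)
    then show "1 \<le> real k * real (k + d)" "real k * real (k + d) \<le> real j * real (j + d)"
      by (metis of_nat_mult of_nat_1 of_nat_le_iff)+
  qed
  from radial_energy_mono[OF c e(1) l] obtain w' where
    w': "radial_profile d (real k * real (k + d)) e c c1 w'" "radial_energy d e w' \<le> radial_energy d e w"
    by blast
  have "radial_energy d e w' \<ge> (ball_eigval d k - (eigval_loss d k)\<^sup>2 * e ^ (2 * k + d)) * (c 1)\<^sup>2 + e ^ d * (c e)\<^sup>2"
    using radial_energy_lower[OF w'(1) e] k by simp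
  then have "(ball_eigval d k - (eigval_loss d k)\<^sup>2 * e ^ (2 * k + d) - T) * (c 1)\<^sup>2 + (1 - T * e) * (e ^ d * (c e)\<^sup>2) \<le> 0"
    using w'(2) E by (simp add: algebra_simps)
  moreover have "(ball_eigval d k - (eigval_loss d k)\<^sup>2 * e ^ (2 * k + d) - T) * (c 1)\<^sup>2 \<ge> 0" using T by simp
  moreover have "(1 - T * e) * (e ^ d * (c e)\<^sup>2) \<ge> 0" using T e by simp
  ultimately have "(ball_eigval d k - (eigval_loss d k)\<^sup>2 * e ^ (2 * k + d) - T) * (c 1)\<^sup>2 = 0"
    "(1 - T * e) * (e ^ d * (c e)\<^sup>2) = 0" by linarith+
  then have 0: "c 1 = 0" "c e = 0" using T e by auto
  show ?thesis
    by (rule radial_vanish[OF c _ _ 0(1) r]) (use E 0 in auto)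
qed

text \<open>Here the outer value is zero by the choice of the combination; the inner value alone
  cannot sustain the energy once T e < 1/4.\<close>

lemma radial_vanish_low:
  assumes c: "radial_profile d (real k * real (k + d)) e c c1 w"
    and e: "0 < e" "e \<le> 1/2" and x: "c 1 = 0"
    and E: "radial_energy d e w \<le> T * ((c 1)\<^sup>2 + e ^ Suc d * (c e)\<^sup>2)"
    and T: "T * e < 1/4" and r: "r \<in> {e..1}"
  shows "c r = 0"
proof -
  have "(1/4 - T * e) * (e ^ d * (c e)\<^sup>2) \<le> 0"
    using radial_energy_lower_zero[OF c e x] E x by (simp add: algebra_simps)
  moreover have "(1/4 - T * e) * (e ^ d * (c e)\<^sup>2) \<ge> 0" using T e by simp
  ultimately have "(1/4 - T * e) * (e ^ d * (c e)\<^sup>2) = 0" by linarith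
  then have 0: "c e = 0" using T e by auto
  show ?thesis
    by (rule radial_vanish[OF c _ _ x r]) (use E 0 x in auto)
qed

section \<open>Hausdorff measure of spheres\<close>

definition fine_cover :: "real \<Rightarrow> 'a::euclidean_space set \<Rightarrow> (nat \<Rightarrow> 'a set) \<Rightarrow> bool" where
  "fine_cover \<delta> A C \<longleftrightarrow> A \<subseteq> (\<Union>i. C i) \<and> (\<forall>i. bounded (C i) \<and> diameter (C i) \<le> \<delta>)"

text \<open>The empty set contributes 0, as its diameter is 0 and \<open>0 powr s = 0\<close>;
  finite covers may therefore be padded with empty sets.\<close>

definition gauge_vol :: "real \<Rightarrow> 'a::euclidean_space set \<Rightarrow> ennreal" where
  "gauge_vol s B = ennreal (unit_ball_vol s * (diameter B / 2) powr s)"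

definition hausdorff_pre :: "real \<Rightarrow> real \<Rightarrow> 'a::euclidean_space set \<Rightarrow> ennreal" where
  "hausdorff_pre s \<delta> A = (INF C\<in>{C. fine_cover \<delta> A C}. \<Sum>i. gauge_vol s (C i))"

lemma hausdorff_measure_eq_SUP: "hausdorff_measure s A = (SUP \<delta>\<in>{0<..}. hausdorff_pre s \<delta> A)"
  unfolding hausdorff_measure_def hausdorff_pre_def fine_cover_def gauge_vol_def ..

lemma hausdorff_pre_le_measure: "\<delta> > 0 \<Longrightarrow> hausdorff_pre s \<delta> A \<le> hausdorff_measure s A"
  unfolding hausdorff_measure_eq_SUP by (intro SUP_upper) auto

lemma hausdorff_pre_le_sum: "fine_cover \<delta> A C \<Longrightarrow> hausdorff_pre s \<delta> A \<le> (\<Sum>i. gauge_vol s (C i))"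
  unfolding hausdorff_pre_def by (intro INF_lower) auto

lemma hausdorff_pre_antimono: "\<delta> \<le> \<delta>' \<Longrightarrow> hausdorff_pre s \<delta>' A \<le> hausdorff_pre s \<delta> A"
  unfolding hausdorff_pre_def fine_cover_def by (intro INF_superset_mono) (auto intro: order_trans)

lemma unit_ball_vol_pos: "s > 0 \<Longrightarrow> unit_ball_vol s > 0"
  unfolding unit_ball_vol_def by (auto intro!: divide_pos_pos Gamma_real_pos)

section \<open>Scaling and separation for Hausdorff measure\<close>

lemma hausdorff_measure_scale_le:
  fixes A :: "'a::euclidean_space set"
  assumes e: "e > 0" and s: "s > 0"
  shows "ennreal (e powr - s) * hausdorff_measure s ((*\<^sub>R) e ` A) \<le> hausdorff_measure s A"
  unfolding hausdorff_measure_eq_SUP[of s "(*\<^sub>R) e ` A"] SUP_mult_left_ennreal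
proof (rule SUP_least)
  fix \<delta> :: real assume d: "\<delta> \<in> {0<..}"
  have "ennreal (e powr - s) * hausdorff_pre s \<delta> ((*\<^sub>R) e ` A) \<le> hausdorff_pre s (\<delta> / e) A"
    unfolding hausdorff_pre_def[of s "\<delta> / e"]
  proof (rule INF_greatest)
    fix C assume "C \<in> {C. fine_cover (\<delta> / e) A C}"
    then have C: "A \<subseteq> (\<Union>i. C i)" "\<And>i. bounded (C i)" "\<And>i. diameter (C i) \<le> \<delta> / e"
      by (auto simp: fine_cover_def)
    define D where "D i = (*\<^sub>R) e ` C i" for i
    have diam: "diameter (D i) \<le> e * diameter (C i)" for i
    proof (rule diameter_le)
      show "D i \<noteq> {} \<or> 0 \<le> e * diameter (C i)" using e diameter_ge_0[OF C(2)] by simp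
      fix x y assume "x \<in> D i" "y \<in> D i"
      then obtain u v where uv: "u \<in> C i" "v \<in> C i" "x = e *\<^sub>R u" "y = e *\<^sub>R v" by (auto simp: D_def)
      have "norm (x - y) = e * dist u v" using e uv by (simp add: dist_norm flip: scaleR_diff_right)
      then show "norm (x - y) \<le> e * diameter (C i)"
        using diameter_bounded_bound[OF C(2) uv(1,2)] e by simp
    qed
    have "fine_cover \<delta> ((*\<^sub>R) e ` A) D"
      unfolding fine_cover_def
    proof (intro conjI allI)
      show "(*\<^sub>R) e ` A \<subseteq> (\<Union>i. D i)" using C(1) unfolding D_def by blast
      show "bounded (D i)" for i unfolding D_def by (rule bounded_scaling[OF C(2)])
      show "diameter (D i) \<le> \<delta>" for i
        using diam[of i] C(3)[of i] e by (simp add: field_simps)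
    qed
    from hausdorff_pre_le_sum[OF this]
    have "ennreal (e powr - s) * hausdorff_pre s \<delta> ((*\<^sub>R) e ` A)
        \<le> ennreal (e powr - s) * (\<Sum>i. gauge_vol s (D i))"
      by (rule mult_left_mono) simp
    also have "\<dots> = (\<Sum>i. ennreal (e powr - s) * gauge_vol s (D i))" by simp
    also have "\<dots> \<le> (\<Sum>i. gauge_vol s (C i))"
    proof (rule suminf_le)
      fix i
      have "0 \<le> diameter (D i)"
        unfolding D_def by (rule diameter_ge_0[OF bounded_scaling[OF C(2)]])
      then have "(diameter (D i) / 2) powr s \<le> (e * (diameter (C i) / 2)) powr s"
        using diam[of i] s by (intro powr_mono2) auto
      also have "\<dots> = e powr s * (diameter (C i) / 2) powr s"
        by (rule powr_mult)
      finally have "e powr - s * (diameter (D i) / 2) powr s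
          \<le> e powr - s * (e powr s * (diameter (C i) / 2) powr s)"
        by (rule mult_left_mono) simp
      also have "\<dots> = (diameter (C i) / 2) powr s"
        using e by (simp add: mult.assoc[symmetric] powr_add[symmetric])
      finally have "unit_ball_vol s * (e powr - s * (diameter (D i) / 2) powr s)
          \<le> unit_ball_vol s * (diameter (C i) / 2) powr s"
        using unit_ball_vol_pos[OF s] by (intro mult_left_mono) auto
      then show "ennreal (e powr - s) * gauge_vol s (D i) \<le> gauge_vol s (C i)"
        unfolding gauge_vol_def
        by (subst ennreal_mult[symmetric]) (auto intro!: ennreal_leI simp: mult_ac
            unit_ball_vol_pos[OF s] less_imp_le)
    qed auto
    finally show "ennreal (e powr - s) * hausdorff_pre s \<delta> ((*\<^sub>R) e ` A) \<le> (\<Sum>i. gauge_vol s (C i))" .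
  qed
  also have "\<dots> \<le> hausdorff_measure s A" using d e by (intro hausdorff_pre_le_measure) auto
  finally show "ennreal (e powr - s) * hausdorff_pre s \<delta> ((*\<^sub>R) e ` A) \<le> hausdorff_measure s A" .
qed

text \<open>The preceding inequality for the ratio 1/e, applied to the scaled set.\<close>

lemma hausdorff_measure_scale_ge:
  fixes A :: "'a::euclidean_space set"
  assumes e: "e > 0" and s: "s > 0"
  shows "ennreal (e powr s) * hausdorff_measure s A \<le> hausdorff_measure s ((*\<^sub>R) e ` A)"
proof -
  have "(*\<^sub>R) (1 / e) ` ((*\<^sub>R) e ` A) = A" using e by (simp add: image_image)
  with hausdorff_measure_scale_le[of "1 / e" s "(*\<^sub>R) e ` A"] e s show ?thesis
    by (simp add: powr_minus_divide powr_divide)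
qed

text \<open>A set of diameter below the separation cannot meet both \<open>A\<close> and
  \<open>B\<close>. A fine cover of the union thus splits into a cover of \<open>A\<close> (the
  members meeting \<open>A\<close>) and one of \<open>B\<close> (the others) without paying for any
  member twice.\<close>

lemma hausdorff_measure_separated:
  fixes A B :: "'a::euclidean_space set"
  assumes sep: "\<And>a b. a \<in> A \<Longrightarrow> b \<in> B \<Longrightarrow> dist a b \<ge> \<eta>" and eta: "\<eta> > 0"
  shows "hausdorff_measure s A + hausdorff_measure s B \<le> hausdorff_measure s (A \<union> B)"
proof -
  have main: "hausdorff_pre s \<delta> A + hausdorff_pre s \<delta> B \<le> hausdorff_pre s \<delta> (A \<union> B)"
    if d: "0 < \<delta>" "\<delta> < \<eta>" for \<delta>
    unfolding hausdorff_pre_def[of s \<delta> "A \<union> B"]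
  proof (rule INF_greatest)
    fix C assume "C \<in> {C. fine_cover \<delta> (A \<union> B) C}"
    then have C: "A \<union> B \<subseteq> (\<Union>i. C i)" "\<And>i. bounded (C i)" "\<And>i. diameter (C i) \<le> \<delta>"
      by (auto simp: fine_cover_def)
    define P where "P i = (if C i \<inter> A = {} then {} else C i)" for i
    define Q where "Q i = (if C i \<inter> A = {} then C i else {})" for i
    have "fine_cover \<delta> A P"
      unfolding fine_cover_def
    proof (intro conjI allI)
      show "A \<subseteq> (\<Union>i. P i)"
      proof
        fix a assume a: "a \<in> A"
        then obtain i where "a \<in> C i" using C(1) by auto
        with a show "a \<in> (\<Union>i. P i)" by (auto simp: P_def intro!: exI[of _ i])
      qed
    qed (use C d in \<open>auto simp: P_def\<close>)
    moreover have "fine_cover \<delta> B Q"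
      unfolding fine_cover_def
    proof (intro conjI allI)
      show "B \<subseteq> (\<Union>i. Q i)"
      proof
        fix b assume b: "b \<in> B"
        then obtain i where i: "b \<in> C i" using C(1) by auto
        have "C i \<inter> A = {}"
        proof (rule ccontr)
          assume "C i \<inter> A \<noteq> {}"
          then obtain a where a: "a \<in> C i" "a \<in> A" by auto
          from diameter_bounded_bound[OF C(2) a(1) i] C(3)[of i] sep[OF a(2) b] d show False by linarith
        qed
        then show "b \<in> (\<Union>i. Q i)" using i by (auto simp: Q_def)
      qed
    qed (use C d in \<open>auto simp: Q_def\<close>)
    ultimately have "hausdorff_pre s \<delta> A + hausdorff_pre s \<delta> B
        \<le> (\<Sum>i. gauge_vol s (P i)) + (\<Sum>i. gauge_vol s (Q i))"
      by (intro add_mono hausdorff_pre_le_sum)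
    also have "\<dots> = (\<Sum>i. gauge_vol s (P i) + gauge_vol s (Q i))"
      by (rule suminf_add) auto
    also have "\<dots> = (\<Sum>i. gauge_vol s (C i))"
      by (intro suminf_cong) (auto simp: P_def Q_def gauge_vol_def)
    finally show "hausdorff_pre s \<delta> A + hausdorff_pre s \<delta> B \<le> (\<Sum>i. gauge_vol s (C i))" .
  qed
  \<comment> \<open>Decouples the two mesh sizes through a common smaller one, so that the suprema
    can be taken one at a time.\<close>
  have two: "hausdorff_pre s \<delta>1 A + hausdorff_pre s \<delta>2 B \<le> hausdorff_measure s (A \<union> B)"
    if "\<delta>1 > 0" "\<delta>2 > 0" for \<delta>1 \<delta>2
  proof -
    define \<delta> where "\<delta> = min (min \<delta>1 \<delta>2) (\<eta> / 2)"
    have d: "0 < \<delta>" "\<delta> < \<eta>" "\<delta> \<le> \<delta>1" "\<delta> \<le> \<delta>2" using that eta by (auto simp: \<delta>_def)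
    have "hausdorff_pre s \<delta>1 A + hausdorff_pre s \<delta>2 B \<le> hausdorff_pre s \<delta> A + hausdorff_pre s \<delta> B"
      by (intro add_mono hausdorff_pre_antimono d)
    also have "\<dots> \<le> hausdorff_pre s \<delta> (A \<union> B)" by (rule main[OF d(1,2)])
    also have "\<dots> \<le> hausdorff_measure s (A \<union> B)" by (rule hausdorff_pre_le_measure[OF d(1)])
    finally show ?thesis .
  qed
  have one: "hausdorff_measure s A + hausdorff_pre s \<delta> B \<le> hausdorff_measure s (A \<union> B)"
    if d: "\<delta> > 0" for \<delta>
  proof -
    have "hausdorff_measure s A + hausdorff_pre s \<delta> B
        = (SUP \<delta>1\<in>{0<..}. hausdorff_pre s \<delta>1 A + hausdorff_pre s \<delta> B)"
      unfolding hausdorff_measure_eq_SUP by (rule ennreal_SUP_add_left[symmetric]) auto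
    also have "\<dots> \<le> hausdorff_measure s (A \<union> B)" using two d by (intro SUP_least) auto
    finally show ?thesis .
  qed
  have "hausdorff_measure s A + hausdorff_measure s B
      = (SUP \<delta>\<in>{0<..}. hausdorff_measure s A + hausdorff_pre s \<delta> B)"
    unfolding hausdorff_measure_eq_SUP[of s B] by (rule ennreal_SUP_add_right) auto
  also have "\<dots> \<le> hausdorff_measure s (A \<union> B)" using one by (intro SUP_least) auto
  finally show ?thesis .
qed

section \<open>Finiteness of the measure of spheres\<close>

lemma measure_disjoint_balls:
  fixes P :: "'a::euclidean_space set"
  assumes P: "finite P" "\<And>p q. p \<in> P \<Longrightarrow> q \<in> P \<Longrightarrow> p \<noteq> q \<Longrightarrow> dist p q \<ge> \<delta>"
    and d: "\<delta> > 0" and sub: "(\<Union>p\<in>P. ball p (\<delta> / 2)) \<subseteq> T" and T: "T \<in> fmeasurable lborel"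
  shows "real (card P) * ((\<delta> / 2) ^ DIM('a) * measure lborel (ball (0::'a) 1)) \<le> measure lborel T"
proof -
  have "ball p (\<delta> / 2) \<inter> ball q (\<delta> / 2) = {}" if "p \<in> P" "q \<in> P" "p \<noteq> q" for p q
  proof (rule ccontr)
    assume "ball p (\<delta> / 2) \<inter> ball q (\<delta> / 2) \<noteq> {}"
    then obtain x where "dist p x < \<delta> / 2" "dist q x < \<delta> / 2" by auto
    then have "dist p q < \<delta>" using dist_triangle2[of p q x] by linarith
    then show False using P(2)[OF that] by simp
  qed
  then have "disjoint_family_on (\<lambda>p. ball p (\<delta> / 2)) P" by (auto simp: disjoint_family_on_def)
  then have "measure lborel (\<Union>p\<in>P. ball p (\<delta> / 2)) = (\<Sum>p\<in>P. measure lborel (ball p (\<delta> / 2)))"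
    using P(1) emeasure_lborel_ball_finite by (intro measure_finite_Union) (auto simp: less_top)
  also have "\<dots> = real (card P) * ((\<delta> / 2) ^ DIM('a) * measure lborel (ball (0::'a) 1))"
    using d by (simp add: content_ball_conv_unit_ball[of "\<delta> / 2"])
  finally have eq: "measure lborel (\<Union>p\<in>P. ball p (\<delta> / 2))
      = real (card P) * ((\<delta> / 2) ^ DIM('a) * measure lborel (ball (0::'a) 1))" .
  have "measure lborel (\<Union>p\<in>P. ball p (\<delta> / 2)) \<le> measure lborel T"
    using sub T P(1) by (intro measure_mono_fmeasurable) auto
  then show ?thesis unfolding eq .
qed

text \<open>A maximal \<open>\<delta>\<close>-separated subset is \<open>\<delta>\<close>-dense, and disjointness of the half-size balls
  bounds its size by the volume of the \<open>\<delta>\<close>-neighbourhood.\<close>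

lemma hausdorff_measure_finite:
  fixes K :: "'a::euclidean_space set"
  assumes n: "DIM('a) \<ge> 2" and d0: "\<delta>0 > 0"
    and T: "\<And>\<delta>. 0 < \<delta> \<Longrightarrow> \<delta> < \<delta>0 \<Longrightarrow> \<exists>T \<in> fmeasurable lborel. (\<Union>p\<in>K. ball p \<delta>) \<subseteq> T \<and> measure lborel T \<le> M * \<delta>"
  shows "hausdorff_measure (real DIM('a) - 1) K < \<infinity>"
proof -
  define s where "s = real DIM('a) - 1"
  define \<omega> where "\<omega> = measure lborel (ball (0::'a) 1)"
  define c where "c = M * 2 ^ DIM('a) * unit_ball_vol s / \<omega>"
  have s: "s > 0" using n by (simp add: s_def)
  have w: "\<omega> > 0" by (simp add: \<omega>_def content_ball_pos)
  have main: "hausdorff_pre s (2 * \<delta>) K \<le> ennreal c" if d: "0 < \<delta>" "\<delta> < \<delta>0" for \<delta>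
  proof -
    obtain T where T: "T \<in> fmeasurable lborel" "(\<Union>p\<in>K. ball p \<delta>) \<subseteq> T" "measure lborel T \<le> M * \<delta>"
      using T[OF d] by auto
    define adm where "adm P \<longleftrightarrow> finite P \<and> P \<subseteq> K \<and>
      (\<forall>p\<in>P. \<forall>q\<in>P. p \<noteq> q \<longrightarrow> dist p q \<ge> \<delta>)" for P :: "'a set"
    have bound: "real (card P) * ((\<delta> / 2) ^ DIM('a) * \<omega>) \<le> M * \<delta>" if "adm P" for P
    proof -
      have "ball p (\<delta> / 2) \<subseteq> T" if "p \<in> P" for p
        using subset_ball[of "\<delta> / 2" \<delta> p] that T(2) d(1) \<open>adm P\<close> unfolding adm_def by fastforce
      then have sub: "(\<Union>p\<in>P. ball p (\<delta> / 2)) \<subseteq> T" by blast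
      have "finite P" "\<And>p q. p \<in> P \<Longrightarrow> q \<in> P \<Longrightarrow> p \<noteq> q \<Longrightarrow> dist p q \<ge> \<delta>"
        using that by (auto simp: adm_def)
      from measure_disjoint_balls[OF this d(1) sub T(1)] T(3) show ?thesis
        unfolding \<omega>_def[symmetric] by linarith
    qed
    have pw: "(\<delta> / 2) ^ DIM('a) * \<omega> > 0" using d w by simp
    have cb: "card P \<le> nat \<lceil>M * \<delta> / ((\<delta> / 2) ^ DIM('a) * \<omega>)\<rceil>" if "adm P" for P
    proof -
      have "real (card P) \<le> M * \<delta> / ((\<delta> / 2) ^ DIM('a) * \<omega>)"
        using bound[OF that] pw by (simp add: pos_le_divide_eq)
      then show ?thesis by linarith
    qed
    have "adm {}" by (simp add: adm_def)
    then obtain P where P: "adm P" and max: "\<And>Q. adm Q \<Longrightarrow> card Q \<le> card P"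
      using ex_has_greatest_nat[of adm "{}" card] cb by (metis less_Suc_eq_le)
    have dense: "\<exists>p\<in>P. x \<in> cball p \<delta>" if x: "x \<in> K" for x
    proof (rule ccontr)
      assume "\<not> ?thesis"
      then have far: "\<And>p. p \<in> P \<Longrightarrow> dist p x > \<delta>" by auto
      then have "x \<notin> P" using d by force
      moreover have "adm (insert x P)"
        using P x far by (auto simp: adm_def dist_commute less_imp_le)
      ultimately show False using max[of "insert x P"] P by (simp add: adm_def)
    qed
    obtain f where f: "bij_betw f {..<card P} P"
      using P ex_bij_betw_nat_finite[of P] by (auto simp: adm_def atLeast0LessThan)
    define C where "C i = (if i < card P then cball (f i) \<delta> else {})" for i
    have "fine_cover (2 * \<delta>) K C"
      unfolding fine_cover_def
    proof (intro conjI allI subsetI)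
      fix x assume "x \<in> K"
      from dense[OF this] obtain p where p: "p \<in> P" "x \<in> cball p \<delta>" by auto
      then obtain i where "i < card P" "f i = p"
        using bij_betw_imp_surj_on[OF f] by (metis imageE lessThan_iff)
      then show "x \<in> (\<Union>i. C i)" using p by (auto simp: C_def intro!: exI[of _ i])
    qed (use d in \<open>auto simp: C_def\<close>)
    from hausdorff_pre_le_sum[OF this, of s]
    have "hausdorff_pre s (2 * \<delta>) K \<le> (\<Sum>i. gauge_vol s (C i))" .
    also have "\<dots> = (\<Sum>i<card P. gauge_vol s (C i))"
      by (rule suminf_finite) (auto simp: C_def gauge_vol_def)
    also have "\<dots> = (\<Sum>i<card P. ennreal (unit_ball_vol s * \<delta> powr s))"
      using d by (intro sum.cong refl) (simp add: C_def gauge_vol_def)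
    also have "\<dots> = ennreal (real (card P) * (unit_ball_vol s * \<delta> powr s))"
      using unit_ball_vol_pos[OF s] by (simp add: ennreal_of_nat_eq_real_of_nat ennreal_mult)
    also have "\<dots> \<le> ennreal c"
    proof (rule ennreal_leI)
      have dp: "\<delta> powr s * \<delta> = \<delta> ^ DIM('a)"
      proof -
        have "\<delta> powr s * \<delta> = \<delta> powr (s + 1)" using d by (simp add: powr_add)
        also have "\<dots> = \<delta> ^ DIM('a)" using d by (simp add: s_def powr_realpow)
        finally show ?thesis .
      qed
      have "real (card P) * \<delta> ^ DIM('a) * \<omega> \<le> M * \<delta> * 2 ^ DIM('a)"
        using bound[OF P] by (simp add: power_divide field_simps)
      then have "real (card P) * \<delta> powr s * \<omega> * \<delta> \<le> M * 2 ^ DIM('a) * \<delta>"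
        unfolding dp[symmetric] by (simp add: mult_ac)
      then have "real (card P) * \<delta> powr s * \<omega> \<le> M * 2 ^ DIM('a)" using d by simp
      then have "real (card P) * \<delta> powr s \<le> M * 2 ^ DIM('a) / \<omega>"
        using w by (simp add: pos_le_divide_eq)
      from mult_left_mono[OF this less_imp_le[OF unit_ball_vol_pos[OF s]]]
      show "real (card P) * (unit_ball_vol s * \<delta> powr s) \<le> c"
        unfolding c_def by (simp add: mult_ac)
    qed
    finally show ?thesis .
  qed
  have "hausdorff_measure s K \<le> ennreal c"
    unfolding hausdorff_measure_eq_SUP
  proof (rule SUP_least)
    fix \<delta> :: real assume "\<delta> \<in> {0<..}"
    then have d: "\<delta> > 0" by simp
    define \<delta>' where "\<delta>' = min \<delta> \<delta>0 / 2"
    have "hausdorff_pre s \<delta> K \<le> hausdorff_pre s (2 * \<delta>') K"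
      by (rule hausdorff_pre_antimono) (simp add: \<delta>'_def)
    also have "\<dots> \<le> ennreal c" by (rule main) (use d d0 in \<open>auto simp: \<delta>'_def min_def\<close>)
    finally show "hausdorff_pre s \<delta> K \<le> ennreal c" .
  qed
  then show ?thesis unfolding s_def by (rule le_less_trans) simp
qed

lemma power_diff_le:
  fixes x y :: real
  assumes "0 \<le> y" "y \<le> x" "x \<le> 2"
  shows "x ^ n - y ^ n \<le> real n * 2 ^ n * (x - y)"
proof (induction n)
  case (Suc n)
  have "x ^ Suc n - y ^ Suc n = x * (x ^ n - y ^ n) + y ^ n * (x - y)" by (simp add: algebra_simps)
  also have "\<dots> \<le> 2 * (real n * 2 ^ n * (x - y)) + 2 ^ n * (x - y)"
    using assms Suc by (intro add_mono mult_mono power_mono) (auto intro: power_mono)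
  also have "\<dots> \<le> real (Suc n) * 2 ^ Suc n * (x - y)"
    using assms by (simp add: algebra_simps mult_left_mono)
  finally show ?case .
qed simp

text \<open>The neighbourhood of width \<delta> of a sphere lies in a spherical layer whose volume
  is of order \<delta>, which is the hypothesis of \<open>hausdorff_measure_finite\<close>.\<close>

lemma hausdorff_spheres_finite:
  assumes n: "DIM('a::euclidean_space) \<ge> 2" and r: "0 < e" "e \<le> 1"
  shows "hausdorff_measure (real DIM('a) - 1) (sphere (0::'a) 1 \<union> sphere 0 e) < \<infinity>"
proof -
  define \<omega> where "\<omega> = measure lborel (ball (0::'a) 1)"
  define B where "B = \<omega> * (real DIM('a) * 2 ^ DIM('a) * 2)"
  define S where "S r \<delta> = ball (0::'a) (r + \<delta>) - ball 0 (r - \<delta>)" for r \<delta>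
  have S: "S r \<delta> \<in> fmeasurable lborel" "measure lborel (S r \<delta>) \<le> B * \<delta>"
      "(\<Union>p\<in>sphere 0 r. ball p \<delta>) \<subseteq> S r \<delta>"
    if "0 < \<delta>" "\<delta> < r" "r \<le> 1" for r \<delta>
  proof -
    have fb: "ball (0::'a) t \<in> fmeasurable lborel" for t
      using emeasure_lborel_ball_finite by (intro fmeasurableI) auto
    show "S r \<delta> \<in> fmeasurable lborel" unfolding S_def by (intro fmeasurable_Diff fb) auto
    have "measure lborel (S r \<delta>) = measure lborel (ball (0::'a) (r + \<delta>)) - measure lborel (ball (0::'a) (r - \<delta>))"
      unfolding S_def using that emeasure_lborel_ball_finite
      by (intro measure_Diff) (auto simp: less_top intro: subset_ball)
    also have "\<dots> = \<omega> * ((r + \<delta>) ^ DIM('a) - (r - \<delta>) ^ DIM('a))"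
      using content_ball_conv_unit_ball[of "r + \<delta>" "0::'a"]
        content_ball_conv_unit_ball[of "r - \<delta>" "0::'a"] that
      unfolding \<omega>_def[symmetric] by (simp only: right_diff_distrib mult.commute)
    also have "\<dots> \<le> \<omega> * (real DIM('a) * 2 ^ DIM('a) * ((r + \<delta>) - (r - \<delta>)))"
      using that by (intro mult_left_mono power_diff_le) (auto simp: \<omega>_def)
    also have "\<dots> = B * \<delta>" unfolding B_def by simp
    finally show "measure lborel (S r \<delta>) \<le> B * \<delta>" .
    show "(\<Union>p\<in>sphere 0 r. ball p \<delta>) \<subseteq> S r \<delta>"
    proof (intro UN_least subsetI)
      fix p x :: 'a assume "p \<in> sphere 0 r" "x \<in> ball p \<delta>"
      then show "x \<in> S r \<delta>"
        using norm_triangle_ineq2[of p x] norm_triangle_ineq2[of x p]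
        by (auto simp: S_def dist_norm norm_minus_commute)
    qed
  qed
  show ?thesis
  proof (rule hausdorff_measure_finite[OF n r(1), where M = "2 * B"])
    fix \<delta> assume d: "0 < \<delta>" "\<delta> < e"
    note S1 = S[OF d(1) _ order_refl] and S2 = S[OF d r(2)]
    have d1: "\<delta> < 1" using d r by simp
    have "measure lborel (S 1 \<delta> \<union> S e \<delta>) \<le> measure lborel (S 1 \<delta>) + measure lborel (S e \<delta>)"
      by (rule measure_Un_le) (auto simp: S_def)
    also have "\<dots> \<le> 2 * B * \<delta>" using S1(2)[OF d1] S2(2) by simp
    finally show "\<exists>T\<in>fmeasurable lborel. (\<Union>p\<in>sphere (0::'a) 1 \<union> sphere 0 e. ball p \<delta>) \<subseteq> T \<and> measure lborel T \<le> 2 * B * \<delta>"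
      using S1(1,3)[OF d1] S2(1,3) by (intro bexI[of _ "S 1 \<delta> \<union> S e \<delta>"]) (auto intro: fmeasurable.Un)
  qed
qed

text \<open>The truncated cone over a small piece of the sphere is covered by about \<open>1 / d\<close> balls
  of radius \<open>2 d\<close>.\<close>

lemma truncated_cone_cover:
  fixes B :: "'a::euclidean_space set"
  assumes n: "DIM('a) \<ge> 2" and B: "bounded B" "diameter B \<le> 1"
  defines "K \<equiv> 3 * 2 ^ DIM('a) * measure lborel (ball (0::'a) 1)"
  shows "\<exists>T \<in> sets lborel. (\<forall>x\<in>B \<inter> sphere 0 1. \<forall>t\<in>{1/2..1}. t *\<^sub>R x \<in> T) \<and>
    emeasure lborel T \<le> ennreal (K * diameter B powr (real DIM('a) - 1))"
proof -
  define d where "d = diameter B"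
  have d: "0 \<le> d" "d \<le> 1" using diameter_ge_0[OF B(1)] B(2) by (auto simp: d_def)
  have dist: "dist x y \<le> d" if "x \<in> B" "y \<in> B" for x y
    using diameter_bounded_bound[OF B(1) that] by (simp add: d_def)
  consider "B \<inter> sphere 0 1 = {}" | x0 where "x0 \<in> B" "norm x0 = 1" "d = 0" | x0 where "x0 \<in> B" "norm x0 = 1" "d > 0"
    using d(1) by (fastforce simp: less_eq_real_def)
  then show ?thesis
  proof cases
    case 1
    then show ?thesis by (intro bexI[of _ "{}"]) auto
  next
    case (2 x0)
    \<comment> \<open>For diameter 0 the bound demands measure 0: the piece is one point, its cone
      lies on a line, and lines are null sets in dimension at least 2.\<close>
    have "dim (span {x0}) < DIM('a)"
      using dim_le_card[of "span {x0}" "{x0}"] n by simp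
    then have "negligible (span {x0})" by (rule negligible_lowdim)
    then have "span {x0} \<in> null_sets lborel"
      using null_sets_completion_iff[of "span {x0}" lborel] closed_subspace[OF subspace_span[of "{x0}"]]
      by (simp add: negligible_iff_null_sets borel_closed)
    then have "emeasure lborel (span {x0}) = 0" "span {x0} \<in> sets lborel" by auto
    moreover have "t *\<^sub>R x \<in> span {x0}" if "x \<in> B" for x t
      using dist[OF that 2(1)] 2(3) by (auto intro: span_mul span_base)
    ultimately show ?thesis by (intro bexI[of _ "span {x0}"]) auto
  next
    case (3 x0)
    \<comment> \<open>Balls are centred on the ray of \<open>x0\<close> at steps of length
      \<open>d\<close>; \<open>L\<close> steps carry the radius from 1/2 to 1. Radius 2 d covers the
      step and the width of the piece.\<close>
    define L where "L = nat \<lceil>1 / (2 * d)\<rceil>"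
    define T where "T = (\<Union>l\<le>L. cball ((1/2 + real l * d) *\<^sub>R x0) (2 * d))"
    have "T \<in> sets lborel" unfolding T_def by auto
    moreover have "t *\<^sub>R x \<in> T" if x: "x \<in> B" "norm x = 1" and t: "1/2 \<le> t" "t \<le> 1" for x t
    proof -
      define l where "l = nat \<lfloor>(t - 1/2) / d\<rfloor>"
      have "(t - 1/2) / d \<ge> 0" using t 3(3) by simp
      then have l: "real l \<le> (t - 1/2) / d" "(t - 1/2) / d < real l + 1"
        unfolding l_def by linarith+
      then have l2: "real l * d \<le> t - 1/2" "t - 1/2 < real l * d + d"
        using 3(3) by (auto simp: field_simps)
      have "real l \<le> 1 / (2 * d)"
        using l(1) t 3(3) by (rule_tac order_trans[OF l(1)]) (auto simp: field_simps)
      then have "l \<le> L" unfolding L_def by linarith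
      moreover have "dist ((1/2 + real l * d) *\<^sub>R x0) (t *\<^sub>R x) \<le> 2 * d"
      proof -
        let ?u = "1/2 + real l * d"
        have "t *\<^sub>R x - ?u *\<^sub>R x0 = (t - ?u) *\<^sub>R x + ?u *\<^sub>R (x - x0)" by (simp add: algebra_simps)
        then have "norm (t *\<^sub>R x - ?u *\<^sub>R x0) \<le> \<bar>t - ?u\<bar> * 1 + \<bar>?u\<bar> * norm (x - x0)"
          using x(2) norm_triangle_ineq[of "(t - ?u) *\<^sub>R x" "?u *\<^sub>R (x - x0)"] by simp
        also have "\<dots> \<le> d * 1 + 1 * d"
          using l2 t 3(3) dist[OF x(1) 3(1)]
          by (intro add_mono mult_mono) (auto simp: dist_norm)
        finally show ?thesis by (simp add: dist_norm norm_minus_commute)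
      qed
      ultimately show ?thesis unfolding T_def by auto
    qed
    moreover have "emeasure lborel T \<le> ennreal (K * d powr (real DIM('a) - 1))"
    proof -
      have "emeasure lborel T \<le> (\<Sum>l\<le>L. emeasure lborel (cball ((1/2 + real l * d) *\<^sub>R x0) (2 * d)))"
        unfolding T_def by (rule emeasure_subadditive_finite) auto
      also have "\<dots> = (\<Sum>l\<le>L. ennreal ((2 * d) ^ DIM('a) * measure lborel (ball (0::'a) 1)))"
      proof (rule sum.cong[OF refl])
        fix l
        have "emeasure lborel (cball ((1/2 + real l * d) *\<^sub>R x0) (2 * d))
            = ennreal (measure lborel (cball ((1/2 + real l * d) *\<^sub>R x0) (2 * d)))"
          using emeasure_lborel_cball_finite by (intro emeasure_eq_ennreal_measure) (auto simp: less_top)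
        then show "emeasure lborel (cball ((1/2 + real l * d) *\<^sub>R x0) (2 * d))
            = ennreal ((2 * d) ^ DIM('a) * measure lborel (ball (0::'a) 1))"
          using 3(3) by (simp add: content_cball_conv_ball content_ball_conv_unit_ball[of "2 * d"])
      qed
      also have "\<dots> = ennreal (real (Suc L) * ((2 * d) ^ DIM('a) * measure lborel (ball (0::'a) 1)))"
        using 3(3) by (simp add: ennreal_of_nat_eq_real_of_nat ennreal_mult del: of_nat_Suc)
      also have "\<dots> \<le> ennreal (K * d powr (real DIM('a) - 1))"
      proof (rule ennreal_leI)
        have "1 \<le> 1 / d" using d 3(3) by simp
        moreover have "real L \<le> 1 / (2 * d) + 1"
        proof -
          have "1 / (2 * d) \<ge> 0" using 3(3) by simp
          then show ?thesis unfolding L_def by linarith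
        qed
        \<comment> \<open>L + 1 <= 1 / (2 d) + 2, and 2 <= 2 / d because d <= 1. This is the origin
          of the factor 3 in \<open>K\<close>.\<close>
        ultimately have L: "real (Suc L) \<le> 3 / d" by (simp add: field_simps)
        have "d * d powr (real DIM('a) - 1) = d powr (1 + (real DIM('a) - 1))"
          using 3(3) by (subst powr_add) simp
        then have dp: "d ^ DIM('a) = d * d powr (real DIM('a) - 1)" using 3(3) by (simp add: powr_realpow)
        have "real (Suc L) * ((2 * d) ^ DIM('a) * measure lborel (ball (0::'a) 1))
            \<le> 3 / d * ((2 * d) ^ DIM('a) * measure lborel (ball (0::'a) 1))"
          using 3(3) by (intro mult_right_mono L) auto
        also have "\<dots> = K * d powr (real DIM('a) - 1)"
          unfolding K_def power_mult_distrib dp using 3(3) by simp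
        finally show "real (Suc L) * ((2 * d) ^ DIM('a) * measure lborel (ball (0::'a) 1)) \<le> K * d powr (real DIM('a) - 1)" .
      qed
      finally show ?thesis .
    qed
    ultimately show ?thesis unfolding d_def by (intro bexI[of _ T]) auto
  qed
qed

text \<open>Truncated cones over the members of a cover of the sphere cover a fixed solid ball
  \<open>W\<close>, and each cone has volume at most \<open>K\<close> times the s-th power of the
  diameter. The volume of \<open>W\<close> therefore bounds every gauge sum from below.\<close>

lemma hausdorff_sphere_pos:
  assumes n: "DIM('a::euclidean_space) \<ge> 2"
  shows "hausdorff_measure (real DIM('a) - 1) (sphere (0::'a) 1) > 0"
proof -
  define s where "s = real DIM('a) - 1"
  define K where "K = 3 * 2 ^ DIM('a) * measure lborel (ball (0::'a) 1)"
  define \<kappa> where "\<kappa> = K * 2 powr s / unit_ball_vol s"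
  have s: "s > 0" using n by (simp add: s_def)
  have K: "K > 0" unfolding K_def by (simp add: content_ball_pos)
  have u: "unit_ball_vol s > 0" by (rule unit_ball_vol_pos[OF s])
  \<comment> \<open>Centre at distance 3/4 and radius 1/4, so that \<open>W\<close> lies where 1/2
    <= |x| <= 1.\<close>
  define W where "W = ball ((3/4) *\<^sub>R (SOME b::'a. b \<in> Basis)) (1/4)"
  have W: "x \<in> W \<Longrightarrow> 1/2 \<le> norm x \<and> norm x \<le> 1" for x
  proof -
    assume "x \<in> W"
    then have "norm ((3/4) *\<^sub>R (SOME b::'a. b \<in> Basis) - x) < 1/4" by (simp add: W_def dist_norm)
    moreover have "norm ((3/4) *\<^sub>R (SOME b::'a. b \<in> Basis)) = 3/4" using SOME_Basis by simp
    ultimately show ?thesis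
      using norm_triangle_ineq2[of "(3/4) *\<^sub>R (SOME b::'a. b \<in> Basis)" x]
        norm_triangle_ineq2[of x "(3/4) *\<^sub>R (SOME b::'a. b \<in> Basis)"]
      by (simp add: norm_minus_commute)
  qed
  have Wpos: "emeasure lborel W > 0"
  proof -
    have "emeasure lborel W = ennreal (measure lborel W)"
      unfolding W_def using emeasure_lborel_ball_finite
      by (intro emeasure_eq_ennreal_measure) (auto simp: less_top)
    then show ?thesis unfolding W_def by (simp add: content_ball_pos)
  qed
    have "emeasure lborel W / ennreal \<kappa> \<le> hausdorff_pre s 1 (sphere (0::'a) 1)"
      unfolding hausdorff_pre_def
    proof (rule INF_greatest)
      fix C assume "C \<in> {C. fine_cover 1 (sphere (0::'a) 1) C}"
      then have C: "sphere 0 1 \<subseteq> (\<Union>i. C i)" "\<And>i. bounded (C i)" "\<And>i. diameter (C i) \<le> 1"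
        by (auto simp: fine_cover_def)
      have "\<forall>i. \<exists>T \<in> sets lborel. (\<forall>x\<in>C i \<inter> sphere 0 1. \<forall>t\<in>{1/2..1}. t *\<^sub>R x \<in> T) \<and>
          emeasure lborel T \<le> ennreal (K * diameter (C i) powr s)"
        using truncated_cone_cover[OF n C(2,3)] unfolding K_def s_def by blast
      then obtain T where T: "\<And>i. T i \<in> sets lborel"
          "\<And>i x t. x \<in> C i \<Longrightarrow> norm x = 1 \<Longrightarrow> 1/2 \<le> t \<Longrightarrow> t \<le> 1 \<Longrightarrow> t *\<^sub>R x \<in> T i"
          "\<And>i. emeasure lborel (T i) \<le> ennreal (K * diameter (C i) powr s)"
        by (metis (no_types, lifting) IntI atLeastAtMost_iff mem_sphere_0)
      have "W \<subseteq> (\<Union>i. T i)"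
      proof
        fix x assume x: "x \<in> W"
        then have nx: "1/2 \<le> norm x" "norm x \<le> 1" "x \<noteq> 0" using W[OF x] by auto
        then have "x /\<^sub>R norm x \<in> sphere 0 1" by simp
        then obtain i where "x /\<^sub>R norm x \<in> C i" using C(1) by blast
        from T(2)[OF this, of "norm x"] nx show "x \<in> (\<Union>i. T i)" by auto
      qed
      then have "emeasure lborel W \<le> emeasure lborel (\<Union>i. T i)"
        using T(1) by (intro emeasure_mono) auto
      also have "\<dots> \<le> (\<Sum>i. emeasure lborel (T i))"
        using T(1) by (intro emeasure_subadditive_countably) auto
      also have "\<dots> \<le> (\<Sum>i. ennreal (K * diameter (C i) powr s))" by (intro suminf_le T(3)) auto
      also have "\<dots> = (\<Sum>i. ennreal \<kappa> * gauge_vol s (C i))"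
      proof (rule suminf_cong)
        fix i
        have "K * diameter (C i) powr s = \<kappa> * (unit_ball_vol s * (diameter (C i) / 2) powr s)"
          using u diameter_ge_0[OF C(2)[of i]] by (simp add: \<kappa>_def powr_divide)
        then show "ennreal (K * diameter (C i) powr s) = ennreal \<kappa> * gauge_vol s (C i)"
          unfolding gauge_vol_def using K u by (simp add: ennreal_mult[symmetric] \<kappa>_def)
      qed
      finally have "emeasure lborel W \<le> ennreal \<kappa> * (\<Sum>i. gauge_vol s (C i))" by simp
      then show "emeasure lborel W / ennreal \<kappa> \<le> (\<Sum>i. gauge_vol s (C i))"
        using K u by (simp add: divide_le_posI_ennreal \<kappa>_def mult.commute)
    qed
    moreover have "emeasure lborel W / ennreal \<kappa> \<noteq> 0"
      using Wpos by (simp add: ennreal_divide_eq_0_iff)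
    ultimately have "hausdorff_pre s 1 (sphere (0::'a) 1) \<noteq> 0" by (metis le_zero_eq)
  then show ?thesis
    using hausdorff_pre_le_measure[of 1 s "sphere (0::'a) 1"]
    unfolding s_def by (simp add: zero_less_iff_neq_zero) (metis le_zero_eq)
qed

lemma boundary_area_ball_pos:
  "DIM('a::euclidean_space) \<ge> 2 \<Longrightarrow> boundary_area (ball (0::'a) 1) > 0"
  using hausdorff_sphere_pos hausdorff_spheres_finite[of 1]
  by (auto simp: boundary_area_def enn2real_positive_iff)

section \<open>Boundary area of the annulus\<close>

lemma frontier_annulus:
  assumes "0 < e" "e < 1"
  shows "frontier (ball 0 1 - cball (0::'a::euclidean_space) e) = sphere 0 1 \<union> sphere 0 e"
proof -
  have cl: "closure (ball 0 1 - cball (0::'a) e) = cball 0 1 - ball 0 e"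
  proof
    show "closure (ball 0 1 - cball (0::'a) e) \<subseteq> cball 0 1 - ball 0 e"
      by (rule closure_minimal) auto
    show "cball 0 1 - ball 0 e \<subseteq> closure (ball 0 1 - cball (0::'a) e)"
    proof
      fix x :: 'a assume x: "x \<in> cball 0 1 - ball 0 e"
      then have nx: "e \<le> norm x" "norm x \<le> 1" by auto
      \<comment> \<open>\<open>m *\<^sub>R x\<close> lies on the middle sphere of radius (1 + e) /
        2; boundary points are approached along the segment towards it.\<close>
      define m where "m = (1 + e) / (2 * norm x)"
      have "open_segment x (m *\<^sub>R x) \<subseteq> ball 0 1 - cball 0 e \<or> x \<in> ball 0 1 - cball 0 e"
      proof (cases "e < norm x \<and> norm x < 1")
        case True
        then show ?thesis by simp
      next
        case False
        show ?thesis
        proof (intro disjI1 subsetI)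
          fix y assume "y \<in> open_segment x (m *\<^sub>R x)"
          then obtain u where u: "0 < u" "u < 1" "y = (1 - u) *\<^sub>R x + u *\<^sub>R m *\<^sub>R x"
            by (auto simp: in_segment)
          have "y = ((1 - u) + u * m) *\<^sub>R x" by (simp add: u(3) algebra_simps)
          moreover have "m > 0" unfolding m_def using assms nx by (intro divide_pos_pos) linarith+
          ultimately have "norm y = ((1 - u) + u * m) * norm x" using u by (simp add: abs_of_pos add_pos_pos)
          also have "\<dots> = (1 - u) * norm x + u * ((1 + e) / 2)"
          proof -
            have "norm x \<noteq> 0" using nx assms by linarith
            then have "m * norm x = (1 + e) / 2" by (simp add: m_def)
            then show ?thesis by (simp add: distrib_right mult.assoc)
          qed
          finally have ny: "norm y = (1 - u) * norm x + u * ((1 + e) / 2)" .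
          have "(1 - u) * e \<le> (1 - u) * norm x" "(1 - u) * norm x \<le> (1 - u) * 1"
            using u nx by (auto intro: mult_left_mono)
          moreover have "u * e < u * ((1 + e) / 2)" "u * ((1 + e) / 2) < u * 1"
            using u assms by (auto intro!: mult_strict_left_mono)
          ultimately have "(1 - u) * e + u * e < norm y" "norm y < (1 - u) * 1 + u * 1"
            unfolding ny by (auto intro: add_le_less_mono simp del: mult_1_right)
          then have "e < norm y" "norm y < 1" by (simp_all add: algebra_simps)
          then show "y \<in> ball 0 1 - cball 0 e" by simp
        qed
      qed
      moreover have "x \<in> closure (open_segment x (m *\<^sub>R x))" if "\<not> (e < norm x \<and> norm x < 1)"
      proof -
        have "m \<noteq> 1" using that assms nx by (auto simp: m_def)
        moreover have "x \<noteq> 0" using nx assms by auto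
        ultimately have "x \<noteq> m *\<^sub>R x" by (metis scaleR_cancel_right scaleR_one)
        then show ?thesis by simp
      qed
      ultimately show "x \<in> closure (ball 0 1 - cball 0 e)"
        by (metis (no_types, lifting) Diff_iff closure_mono closure_subset mem_ball_0 mem_cball_0
            not_le subsetD)
    qed
  qed
  have int: "interior (ball 0 1 - cball (0::'a) e) = ball 0 1 - cball 0 e"
    by (intro interior_open open_Diff) auto
  show ?thesis unfolding frontier_def cl int using assms by auto
qed

lemma sphere_scale: "e > 0 \<Longrightarrow> (*\<^sub>R) e ` sphere (0::'a::euclidean_space) 1 = sphere 0 e"
proof (intro equalityI subsetI)
  fix x :: 'a assume "e > 0" "x \<in> sphere 0 e"
  then show "x \<in> (*\<^sub>R) e ` sphere 0 1"
    by (intro image_eqI[of _ _ "x /\<^sub>R e"]) auto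
qed auto

text \<open>The two spheres have distance 1 - e, so their measures add up to at most that of the
  union, and the inner one is a scaled copy of the outer. Finiteness is essential for the passage to
  reals, since \<open>enn2real\<close> sends infinity to 0.\<close>

lemma boundary_area_annulus:
  assumes n: "DIM('a::euclidean_space) \<ge> 2" and e: "0 < e" "e < 1"
  shows "boundary_area (ball 0 1 - cball (0::'a) e)
    \<ge> (1 + e ^ (DIM('a) - 1)) * boundary_area (ball (0::'a) 1)"
proof -
  define s where "s = real DIM('a) - 1"
  let ?H = "\<lambda>r. hausdorff_measure s (sphere (0::'a) r)"
  let ?U = "hausdorff_measure s (sphere (0::'a) 1 \<union> sphere 0 e)"
  have s: "s > 0" using n by (simp add: s_def)
  have fin1: "?H 1 < \<infinity>" using hausdorff_spheres_finite[OF n, of 1] by (simp add: s_def)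
  have fin2: "?U < \<infinity>" using hausdorff_spheres_finite[OF n e(1)] e by (simp add: s_def)
  have es: "e powr s = e ^ (DIM('a) - 1)"
  proof -
    have "s = real (DIM('a) - 1)" using n by (simp add: s_def of_nat_diff)
    then show ?thesis using e by (simp only: powr_realpow)
  qed
  have "?H 1 + ennreal (e powr s) * ?H 1 \<le> ?H 1 + ?H e"
    using hausdorff_measure_scale_ge[OF e(1) s, of "sphere (0::'a) 1"] unfolding sphere_scale[OF e(1)]
    by (rule add_left_mono)
  also have "\<dots> \<le> ?U"
  proof (rule hausdorff_measure_separated[of _ _ "1 - e"])
    fix a b :: 'a assume "a \<in> sphere 0 1" "b \<in> sphere 0 e"
    then show "dist a b \<ge> 1 - e" using norm_triangle_ineq2[of a b] by (simp add: dist_norm)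
  qed (use e in simp)
  finally have "enn2real (?H 1 + ennreal (e powr s) * ?H 1) \<le> enn2real ?U"
    using fin2 by (intro enn2real_mono) auto
  moreover have "enn2real (?H 1 + ennreal (e powr s) * ?H 1) = (1 + e powr s) * enn2real (?H 1)"
    using fin1 by (subst enn2real_plus) (auto simp: enn2real_mult ennreal_mult_less_top algebra_simps)
  ultimately have "(1 + e ^ (DIM('a) - 1)) * enn2real (?H 1) \<le> enn2real ?U"
    unfolding es by simp
  then show ?thesis
    unfolding boundary_area_def frontier_annulus[OF e] s_def by simp
qed

section \<open>Balls and annuli\<close>

lemma local_defining_zero:
  assumes "open \<Omega>" "p \<in> frontier \<Omega>" "local_defining \<Omega> p U \<phi>"
  shows "\<phi> p = 0"
proof -
  have U: "open U" "p \<in> U" and sm: "smooth_on U \<phi>" and eq: "\<Omega> \<inter> U = {x \<in> U. \<phi> x < 0}"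
    using assms(3) by (auto simp: local_defining_def)
  have "p \<notin> \<Omega>" "p \<in> closure \<Omega>" using assms(1,2) by (auto simp: frontier_def interior_open)
  have "\<phi> p \<ge> 0" using \<open>p \<notin> \<Omega>\<close> U(2) eq by (metis Int_iff mem_Collect_eq not_le)
  moreover have "\<not> \<phi> p > 0"
  proof
    assume "\<phi> p > 0"
    have "open (U \<inter> \<phi> -` {0<..})"
      using smooth_on_continuous[OF sm] U(1) by (intro continuous_open_preimage) auto
    moreover have "p \<in> U \<inter> \<phi> -` {0<..}" using U(2) \<open>\<phi> p > 0\<close> by auto
    ultimately obtain y where "y \<in> \<Omega>" "y \<in> U" "\<phi> y > 0"
      using \<open>p \<in> closure \<Omega>\<close> by (auto simp: closure_iff_nhds_not_empty)
    then show False using eq by (metis Int_iff mem_Collect_eq not_less_iff_gr_or_eq)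
  qed
  ultimately show ?thesis by linarith
qed

lemma smooth_on_directional_derivative:
  assumes "smooth_on U \<phi>" "p \<in> U"
  shows "((\<lambda>t. \<phi> (p + t *\<^sub>R v)) has_real_derivative grad \<phi> p \<bullet> v) (at 0)"
proof -
  have d: "\<phi> differentiable (at p)" by (rule smooth_on_differentiable[OF assms])
  have 1: "((\<lambda>t. p + t *\<^sub>R v) has_vector_derivative v) (at 0)"
    by (auto intro!: derivative_eq_intros)
  have "(\<phi> has_derivative frechet_derivative \<phi> (at p)) (at (p + 0 *\<^sub>R v))"
    using d by (simp add: frechet_derivative_works)
  from vector_derivative_diff_chain_within[OF 1 has_derivative_at_withinI[OF this]]
  show ?thesis
    by (simp add: o_def has_real_derivative_iff_has_vector_derivative frechet_derivative_grad[OF d])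
qed

text \<open>Along \<open>v\<close> the function \<psi> becomes negative, so the path enters
  \<Omega>, where \<phi> is negative as well; an increase of \<phi> from its boundary value 0 is
  impossible.\<close>

lemma local_defining_grad_le:
  assumes "open \<Omega>" "p \<in> frontier \<Omega>" and phi: "local_defining \<Omega> p U \<phi>"
    and psi: "local_defining \<Omega> p V \<psi>" and v: "grad \<psi> p \<bullet> v < 0"
  shows "grad \<phi> p \<bullet> v \<le> 0"
proof (rule ccontr)
  assume "\<not> ?thesis"
  then have pos: "grad \<phi> p \<bullet> v > 0" by simp
  have U: "open U" "p \<in> U" "smooth_on U \<phi>" "\<Omega> \<inter> U = {x \<in> U. \<phi> x < 0}"
    and V: "open V" "p \<in> V" "smooth_on V \<psi>" "\<Omega> \<inter> V = {x \<in> V. \<psi> x < 0}"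
    using phi psi by (auto simp: local_defining_def)
  have 0: "\<phi> p = 0" "\<psi> p = 0"
    using local_defining_zero[OF assms(1,2)] phi psi by auto
  obtain d1 where d1: "d1 > 0" "\<And>h. h > 0 \<Longrightarrow> h < d1 \<Longrightarrow> \<phi> (p + h *\<^sub>R v) > 0"
    using DERIV_pos_inc_right[OF smooth_on_directional_derivative[OF U(3,2)] pos] 0 by auto
  obtain d2 where d2: "d2 > 0" "\<And>h. h > 0 \<Longrightarrow> h < d2 \<Longrightarrow> \<psi> (p + h *\<^sub>R v) < 0"
    using DERIV_neg_dec_right[OF smooth_on_directional_derivative[OF V(3,2)] v] 0 by auto
  have "((\<lambda>t. p + t *\<^sub>R v) \<longlongrightarrow> p + 0 *\<^sub>R v) (at_right 0)" by (intro tendsto_intros)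
  then have "\<forall>\<^sub>F t in at_right 0. p + t *\<^sub>R v \<in> U \<inter> V"
    using U V by (intro topological_tendstoD) auto
  then obtain d3 where d3: "d3 > 0" "\<And>t. 0 < t \<Longrightarrow> t < d3 \<Longrightarrow> p + t *\<^sub>R v \<in> U \<inter> V"
    by (auto simp: eventually_at_right_field)
  define t where "t = min d1 (min d2 d3) / 2"
  have t: "0 < t" "t < d1" "t < d2" "t < d3" using d1(1) d2(1) d3(1) by (auto simp: t_def min_def)
  have "p + t *\<^sub>R v \<in> \<Omega>" using d2(2)[OF t(1,3)] d3(2)[OF t(1,4)] V(4) by auto
  then have "\<phi> (p + t *\<^sub>R v) < 0" using d3(2)[OF t(1,4)] U(4) by auto
  then show False using d1(2)[OF t(1,2)] by simp
qed

text \<open>The open half-space below \<open>b\<close> lies in the closed one below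
  \<open>a\<close>, which leaves a single common normal direction.\<close>

lemma unit_vectors_eq:
  fixes a b :: "'a::euclidean_space"
  assumes "norm a = 1" "norm b = 1" and le: "\<And>v. b \<bullet> v < 0 \<Longrightarrow> a \<bullet> v \<le> 0"
  shows "a = b"
proof -
  have n: "a \<bullet> a = 1" "b \<bullet> b = 1" using assms by (auto simp: dot_square_norm)
  define c where "c = a \<bullet> b"
  have cb: "b \<bullet> a = c" by (simp add: c_def inner_commute)
  have "a \<bullet> (- b) \<le> 0" by (rule le) (simp add: n)
  then have c0: "c \<ge> 0" by (simp add: c_def)
  have "1 - c * c \<le> e" if "e > 0" for e
  proof -
    define \<eta> where "\<eta> = e / (c + 1)"
    have e: "\<eta> > 0" using that c0 by (simp add: \<eta>_def)
    \<comment> \<open>The test vector is the component of \<open>a\<close> orthogonal to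
      \<open>b\<close>, pushed slightly into the half-space.\<close>
    have "a \<bullet> (a - c *\<^sub>R b - \<eta> *\<^sub>R b) \<le> 0"
      by (rule le) (simp add: inner_diff_right n cb e)
    then have "1 - c * c \<le> \<eta> * c" by (simp add: inner_diff_right n c_def)
    also have "\<dots> \<le> e" using that c0 by (simp add: \<eta>_def field_simps)
    finally show ?thesis .
  qed
  then have "1 - c * c \<le> 0" by (meson dense_ge)
  then have "c \<ge> 1" using c0 mult_strict_mono[of c 1 c 1] by force
  then have "(a - b) \<bullet> (a - b) \<le> 0" by (simp add: inner_diff_left inner_diff_right n cb c_def[symmetric])
  then show ?thesis by (metis eq_iff_diff_eq_0 inner_eq_zero_iff inner_ge_zero order_antisym)
qed

text \<open>Evaluates the \<open>SOME\<close> in the definition: by the half-space comparison all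
  local defining functions yield the same unit vector.\<close>

lemma outward_normal_eq:
  assumes "open \<Omega>" "p \<in> frontier \<Omega>" "local_defining \<Omega> p U \<phi>"
  shows "outward_normal \<Omega> p = (1 / norm (grad \<phi> p)) *\<^sub>R grad \<phi> p"
  unfolding outward_normal_def
proof (rule some_equality)
  show "\<exists>V \<psi>. local_defining \<Omega> p V \<psi> \<and>
      (1 / norm (grad \<phi> p)) *\<^sub>R grad \<phi> p = (1 / norm (grad \<psi> p)) *\<^sub>R grad \<psi> p"
    using assms(3) by blast
  fix \<nu> assume "\<exists>V \<psi>. local_defining \<Omega> p V \<psi> \<and> \<nu> = (1 / norm (grad \<psi> p)) *\<^sub>R grad \<psi> p"
  then obtain V \<psi> where psi: "local_defining \<Omega> p V \<psi>" and nu: "\<nu> = (1 / norm (grad \<psi> p)) *\<^sub>R grad \<psi> p"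
    by blast
  have nz: "grad \<phi> p \<noteq> 0" "grad \<psi> p \<noteq> 0" using assms(3) psi by (auto simp: local_defining_def)
  show "\<nu> = (1 / norm (grad \<phi> p)) *\<^sub>R grad \<phi> p"
    unfolding nu
  proof (rule unit_vectors_eq)
    fix v assume "((1 / norm (grad \<phi> p)) *\<^sub>R grad \<phi> p) \<bullet> v < 0"
    then have "grad \<phi> p \<bullet> v < 0" using nz by (simp add: divide_less_0_iff)
    from local_defining_grad_le[OF assms(1,2) psi assms(3) this]
    show "((1 / norm (grad \<psi> p)) *\<^sub>R grad \<psi> p) \<bullet> v \<le> 0"
      by (simp add: divide_nonpos_nonneg)
  qed (use nz in auto)
qed

text \<open>One family for all defining functions in use: |x|^2 - 1 at the outer sphere and e^2 -
  |x|^2 at the inner one.\<close>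

definition norm_sq_affine :: "real \<Rightarrow> real \<Rightarrow> 'a::euclidean_space \<Rightarrow> real" where
  "norm_sq_affine c k x = c * (x \<bullet> x) + k"

lemma smooth_norm_sq_affine: "open U \<Longrightarrow> smooth_on U (norm_sq_affine c k)"
  unfolding norm_sq_affine_def[abs_def]
  by (intro smooth_on_add smooth_on_cmult smooth_on_const hpoly_smooth[OF hpoly_norm_sq])

lemma grad_norm_sq_affine: "grad (norm_sq_affine c k) x = (2 * c) *\<^sub>R x"
proof -
  have "dd [b] (norm_sq_affine c k) x = 2 * c * (x \<bullet> b)" for b
    by (rule has_derivative_imp_dd)
      (auto simp: norm_sq_affine_def[abs_def] inner_commute intro!: derivative_eq_intros)
  then have "grad (norm_sq_affine c k) x = (\<Sum>b\<in>Basis. (2 * c) *\<^sub>R (x \<bullet> b) *\<^sub>R b)"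
    by (simp add: grad_def)
  also have "\<dots> = (2 * c) *\<^sub>R (\<Sum>b\<in>Basis. (x \<bullet> b) *\<^sub>R b)" by (rule scaleR_right.sum[symmetric])
  finally show ?thesis by (simp add: euclidean_representation)
qed

lemma local_defining_norm_sq_affine:
  assumes "open U" "p \<in> U" "0 \<notin> U" "c \<noteq> 0" "\<And>x. x \<in> U \<Longrightarrow> x \<in> \<Omega> \<longleftrightarrow> c * (x \<bullet> x) + k < 0"
  shows "local_defining \<Omega> p U (norm_sq_affine c k)"
  unfolding local_defining_def grad_norm_sq_affine
  using assms smooth_norm_sq_affine by (auto simp: norm_sq_affine_def)

lemma dot_less_square_iff: "0 \<le> r \<Longrightarrow> x \<bullet> x < r\<^sup>2 \<longleftrightarrow> norm x < r"
  unfolding dot_square_norm by (metis norm_ge_zero power2_less_imp_less power_strict_mono zero_less_numeral)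

lemma square_less_dot_iff: "0 \<le> r \<Longrightarrow> r\<^sup>2 < x \<bullet> x \<longleftrightarrow> r < norm x"
  unfolding dot_square_norm by (metis norm_ge_zero power2_less_imp_less power_strict_mono zero_less_numeral)

lemma local_defining_ball:
  "norm p = 1 \<Longrightarrow> local_defining (ball 0 1) p (- {0}) (norm_sq_affine 1 (- 1))"
  using dot_less_square_iff[of 1] by (intro local_defining_norm_sq_affine) auto

abbreviation annulus :: "real \<Rightarrow> 'a::euclidean_space set" where
  "annulus e \<equiv> ball 0 1 - cball 0 e"

lemma open_annulus: "open (annulus e)"
  by (intro open_Diff) auto

lemma local_defining_annulus_outer:
  assumes "0 < e" "e < 1" "norm p = 1"
  shows "local_defining (annulus e) p (- cball 0 e) (norm_sq_affine 1 (- 1))"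
  using assms dot_less_square_iff[of 1]
  by (intro local_defining_norm_sq_affine) auto

lemma local_defining_annulus_inner:
  fixes p :: "'a::euclidean_space"
  assumes "0 < e" "e < 1" "norm p = e"
  shows "local_defining (annulus e) p (ball 0 1 - {0}) (norm_sq_affine (- 1) (e\<^sup>2))"
proof (rule local_defining_norm_sq_affine)
  show "open (ball 0 1 - {0 :: 'a})" by (intro open_Diff) auto
  fix x :: 'a assume "x \<in> ball 0 1 - {0}"
  then show "x \<in> annulus e \<longleftrightarrow> - 1 * (x \<bullet> x) + e\<^sup>2 < 0"
    using square_less_dot_iff[of e x] assms(1) by (simp add: not_le)
qed (use assms in auto)

lemma smooth_bounded_domain_annulus:
  assumes n: "DIM('a::euclidean_space) \<ge> 2" and e: "0 < e" "e < 1"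
  shows "smooth_bounded_domain (annulus e :: 'a set)"
  unfolding smooth_bounded_domain_def
proof (intro conjI ballI)
  have "annulus e = {x::'a. e < norm (x - 0) \<and> norm (x - 0) < 1}" by auto
  then show "connected (annulus e :: 'a set)" using connected_annulus(1)[OF n] by metis
  obtain b :: 'a where b: "b \<in> Basis" using SOME_Basis by blast
  have "((1 + e) / 2) *\<^sub>R b \<in> annulus e" using b e by auto
  then show "annulus e \<noteq> ({} :: 'a set)" by blast
  show "bounded (annulus e :: 'a set)" by (rule bounded_subset[OF bounded_ball[of 0 1]]) auto
  fix p :: 'a assume "p \<in> frontier (annulus e)"
  then have "norm p = 1 \<or> norm p = e" unfolding frontier_annulus[OF e] by auto
  then show "\<exists>U \<phi>. local_defining (annulus e) p U \<phi>"
    using local_defining_annulus_outer[OF e] local_defining_annulus_inner[OF e] by blast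
qed (rule open_annulus)

lemma outward_normal_ball: "norm p = 1 \<Longrightarrow> outward_normal (ball 0 1) p = p"
  using outward_normal_eq[OF _ _ local_defining_ball[of p]] by (simp add: grad_norm_sq_affine)

lemma outward_normal_annulus:
  assumes e: "0 < e" "e < 1"
  shows "norm p = 1 \<Longrightarrow> outward_normal (annulus e) p = p"
    and "norm p = e \<Longrightarrow> outward_normal (annulus e) p = (- 1 / e) *\<^sub>R p"
proof -
  assume p: "norm p = 1"
  then have "p \<in> frontier (annulus e)" unfolding frontier_annulus[OF e] by auto
  from outward_normal_eq[OF open_annulus this local_defining_annulus_outer[OF e p]] p
  show "outward_normal (annulus e) p = p" by (simp add: grad_norm_sq_affine)
next
  assume p: "norm p = e"
  then have "p \<in> frontier (annulus e)" unfolding frontier_annulus[OF e] by auto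
  from outward_normal_eq[OF open_annulus this local_defining_annulus_inner[OF e p]] p e
  show "outward_normal (annulus e) p = (- 1 / e) *\<^sub>R p" by (simp add: grad_norm_sq_affine)
qed

definition shell :: "real \<Rightarrow> 'a::euclidean_space set" where
  "shell e = cball 0 1 - ball 0 e"

lemma closure_annulus:
  assumes "0 < e" "e < 1" shows "closure (annulus e) = (shell e :: 'a::euclidean_space set)"
proof -
  have "annulus e \<union> (sphere 0 1 \<union> sphere 0 e) = cball 0 1 - ball (0::'a) e"
    using assms by (auto simp: not_le)
  then show ?thesis
    by (simp only: closure_Un_frontier frontier_annulus[OF assms] shell_def)
qed

text \<open>A Steklov eigenfunction of the annulus with inner radius \<open>e\<close>, or of the ball if \<open>e = 0\<close>,
  with the Neumann data expressed through the Euler field.\<close>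

definition shell_eigenfunction :: "real \<Rightarrow> real \<Rightarrow> ('a::euclidean_space \<Rightarrow> real) \<Rightarrow> bool" where
  "shell_eigenfunction e \<xi> u \<longleftrightarrow> (\<exists>V. open V \<and> shell e \<subseteq> V \<and> smooth_on V u) \<and>
    (\<forall>x. e < norm x \<and> norm x < 1 \<longrightarrow> laplacian (laplacian u) x = 0) \<and>
    (\<forall>p. norm p = 1 \<longrightarrow> euler_deriv u p = 0 \<and> euler_deriv (laplacian u) p = - \<xi> * u p) \<and>
    (\<forall>p. norm p = e \<longrightarrow> euler_deriv u p = 0 \<and> euler_deriv (laplacian u) p = \<xi> * e * u p)"

lemma normal_deriv_euler:
  assumes "outward_normal \<Omega> p = c *\<^sub>R p" "u differentiable (at p)"
  shows "normal_deriv \<Omega> u p = c * euler_deriv u p"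
  using linear_frechet_derivative[OF assms(2)]
  unfolding normal_deriv_def assms(1) frechet_derivative_euler[OF assms(2), symmetric]
  by (simp add: linear_cmul)

lemma steklov_solution_ball:
  fixes u :: "'a::euclidean_space \<Rightarrow> real"
  shows "steklov_solution (ball 0 1) \<xi> u \<Longrightarrow> shell_eigenfunction 0 \<xi> u"
proof -
  assume "steklov_solution (ball 0 1) \<xi> u"
  then obtain V where V: "open V" "cball 0 1 \<subseteq> V" "smooth_on V u"
    and lap: "\<And>x. norm x < 1 \<Longrightarrow> laplacian (laplacian u) x = 0"
    and bc: "\<And>p. norm p = 1 \<Longrightarrow> normal_deriv (ball 0 1) u p = 0 \<and>
      normal_deriv (ball 0 1) (laplacian u) p + \<xi> * u p = 0"
    unfolding steklov_solution_def by auto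
  have nd: "normal_deriv (ball 0 1) f p = euler_deriv f p" if "norm p = 1" "smooth_on V f" for f p
  proof -
    have "p \<in> V" using V(2) that(1) by auto
    then show ?thesis
      using normal_deriv_euler[of "ball 0 1" p 1 f] outward_normal_ball[OF that(1)]
        smooth_on_differentiable[OF that(2)] by simp
  qed
  have "euler_deriv u p = 0 \<and> euler_deriv (laplacian u) p = - \<xi> * u p" if "norm p = 1" for p
    using bc[OF that] nd[OF that V(3)] nd[OF that smooth_on_laplacian[OF V(3)]] by auto
  \<comment> \<open>The inner condition now concerns only the origin, where the Euler field and the
    factor \<open>e\<close> both vanish.\<close>
  then show ?thesis
    using V lap unfolding shell_eigenfunction_def shell_def by (auto simp: euler_deriv_def)
qed

lemma steklov_solution_ballI:
  fixes u :: "'a::euclidean_space \<Rightarrow> real"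
  assumes u: "smooth_on UNIV u" and lap: "\<And>x. laplacian (laplacian u) x = 0"
    and bc: "\<And>p. norm p = 1 \<Longrightarrow> euler_deriv u p = 0 \<and> euler_deriv (laplacian u) p = - \<xi> * u p"
  shows "steklov_solution (ball 0 1) \<xi> u"
proof -
  have nd: "normal_deriv (ball 0 1) f p = euler_deriv f p" if "norm p = 1" "smooth_on UNIV f" for f p
    using normal_deriv_euler[of "ball 0 1" p 1 f] outward_normal_ball[OF that(1)]
      smooth_on_differentiable[OF that(2), of p] by auto
  show ?thesis
    unfolding steklov_solution_def
    using u lap bc nd[OF _ u] nd[OF _ smooth_on_laplacian[OF u]] by auto
qed

lemma steklov_solution_annulus:
  fixes u :: "'a::euclidean_space \<Rightarrow> real"
  assumes e: "0 < e" "e < 1"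
  shows "steklov_solution (annulus e) \<xi> u \<longleftrightarrow> shell_eigenfunction e \<xi> u"
proof -
  have nd1: "normal_deriv (annulus e) f p = euler_deriv f p"
    if "norm p = 1" "smooth_on V f" "p \<in> V" for f p V
    using normal_deriv_euler[of "annulus e" p 1 f] outward_normal_annulus(1)[OF e that(1)]
      smooth_on_differentiable[OF that(2,3)] by simp
  have nd2: "normal_deriv (annulus e) f p = (- 1 / e) * euler_deriv f p"
    if "norm p = e" "smooth_on V f" "p \<in> V" for f p V
    using normal_deriv_euler[of "annulus e" p "- 1 / e" f] outward_normal_annulus(2)[OF e that(1)]
      smooth_on_differentiable[OF that(2,3)] by simp
  have *: "(\<forall>p\<in>frontier (annulus e). normal_deriv (annulus e) u p = 0 \<and>
        normal_deriv (annulus e) (laplacian u) p + \<xi> * u p = 0) \<longleftrightarrow>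
      (\<forall>p. norm p = 1 \<longrightarrow> euler_deriv u p = 0 \<and> euler_deriv (laplacian u) p = - \<xi> * u p) \<and>
      (\<forall>p. norm p = e \<longrightarrow> euler_deriv u p = 0 \<and> euler_deriv (laplacian u) p = \<xi> * e * u p)"
    if V: "shell e \<subseteq> V" "smooth_on V u" for V
  proof -
    have pV: "p \<in> V" if "norm p = 1 \<or> norm p = e" for p
      using V(1) that e by (auto simp: shell_def)
    have 1: "normal_deriv (annulus e) u p = euler_deriv u p"
      "normal_deriv (annulus e) (laplacian u) p = euler_deriv (laplacian u) p" if "norm p = 1" for p
      using nd1[OF that V(2)] nd1[OF that smooth_on_laplacian[OF V(2)]] pV that by auto
    have 2: "normal_deriv (annulus e) u p = (- 1 / e) * euler_deriv u p"
      "normal_deriv (annulus e) (laplacian u) p = (- 1 / e) * euler_deriv (laplacian u) p"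
      if "norm p = e" for p
      using nd2[OF that V(2)] nd2[OF that smooth_on_laplacian[OF V(2)]] pV that by auto
    have A: "(normal_deriv (annulus e) u p = 0 \<and>
        normal_deriv (annulus e) (laplacian u) p + \<xi> * u p = 0) \<longleftrightarrow>
      (euler_deriv u p = 0 \<and> euler_deriv (laplacian u) p = - \<xi> * u p)" if "norm p = 1" for p
      unfolding 1[OF that] by linarith
    \<comment> \<open>On the inner sphere the outward normal is -p/e; this turns the sign of the
      condition and produces the factor \<open>e\<close>.\<close>
    have B: "(normal_deriv (annulus e) u p = 0 \<and>
        normal_deriv (annulus e) (laplacian u) p + \<xi> * u p = 0) \<longleftrightarrow>
      (euler_deriv u p = 0 \<and> euler_deriv (laplacian u) p = \<xi> * e * u p)" if "norm p = e" for p
      unfolding 2[OF that] using e by (auto simp: field_simps)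
    show ?thesis
      unfolding frontier_annulus[OF e] ball_Un by (simp add: A B Ball_def)
  qed
  have lap: "(\<forall>x\<in>annulus e. laplacian (laplacian u) x = 0) \<longleftrightarrow>
      (\<forall>x. e < norm x \<and> norm x < 1 \<longrightarrow> laplacian (laplacian u) x = 0)" by (auto simp: not_le)
  show ?thesis
    unfolding steklov_solution_def shell_eigenfunction_def closure_annulus[OF e] lap
    using * by blast
qed

section \<open>Radial modes of an eigenfunction and their energy\<close>

definition radial_mode ::
  "nat \<Rightarrow> real \<Rightarrow> real \<Rightarrow> real \<Rightarrow> (real \<Rightarrow> real) \<Rightarrow> (real \<Rightarrow> real) \<Rightarrow> (real \<Rightarrow> real) \<Rightarrow> (real \<Rightarrow> real) \<Rightarrow> bool" where
  "radial_mode d l e \<xi> c c1 w w1 \<longleftrightarrow> radial_profile d l e c c1 w \<and> radial_harmonic d l e w w1 \<and>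
    w1 1 = - \<xi> * c 1 \<and> w1 e = \<xi> * e * c e"

text \<open>Compactness leaves a margin around the shell, so that the coefficients are continuous up
  to the end points e and 1.\<close>

lemma shell_tube:
  assumes "open V" "shell e \<subseteq> (V :: 'a::euclidean_space set)" "0 \<le> e" "e < 1"
  obtains \<delta> where "\<delta> > 0" "\<And>t \<omega>. e - \<delta> < t \<Longrightarrow> t < 1 + \<delta> \<Longrightarrow> norm \<omega> = 1 \<Longrightarrow> t *\<^sub>R \<omega> \<in> V"
proof -
  have "compact (shell e :: 'a set)" unfolding shell_def by (intro compact_diff) auto
  from compact_subset_open_imp_ball_epsilon_subset[OF this assms(1,2)]
  obtain \<delta> where d: "\<delta> > 0" "(\<Union>x\<in>shell e. ball x \<delta>) \<subseteq> V" by blast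
  show ?thesis
  proof (rule that[OF d(1)])
    fix t :: real and \<omega> :: 'a
    assume t: "e - \<delta> < t" "t < 1 + \<delta>" and w: "norm \<omega> = 1"
    define t' where "t' = max e (min 1 t)"
    have "t' *\<^sub>R \<omega> \<in> shell e" using w assms by (auto simp: shell_def t'_def)
    moreover have "t *\<^sub>R \<omega> \<in> ball (t' *\<^sub>R \<omega>) \<delta>"
      using t w d(1) assms by (auto simp: dist_norm t'_def max_def min_def simp flip: scaleR_diff_left)
    ultimately show "t *\<^sub>R \<omega> \<in> V" using d(2) by blast
  qed
qed

lemma sph_coeff_cong:
  "(\<And>\<omega>. norm \<omega> = 1 \<Longrightarrow> f (r *\<^sub>R \<omega>) = g (r *\<^sub>R \<omega>)) \<Longrightarrow> sph_coeff Y f r = sph_coeff Y g r"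
  unfolding sph_coeff_def by (rule sphere_mean_cong) simp

lemma sph_coeff_cmult: "sph_coeff Y (\<lambda>x. c * f x) r = c * sph_coeff Y f r"
  unfolding sph_coeff_def by (simp add: sphere_mean_cmult mult.assoc)

text \<open>The boundary value problem tested against \<open>Y\<close>. Since the Laplacian of
  \<open>u\<close> is itself harmonic, its coefficient is a \<open>radial_harmonic\<close> and can
  play the role of the test function in \<open>radial_green\<close>.\<close>

lemma shell_eigenfunction_mode:
  fixes u Y :: "'a::euclidean_space \<Rightarrow> real"
  assumes u: "shell_eigenfunction e \<xi> u" and e: "0 \<le> e" "e < 1" and Y: "solid_harmonic j Y"
    and n: "DIM('a) = d + 2"
  shows "radial_mode d (real j * real (j + d)) e \<xi> (sph_coeff Y u) (sph_coeff Y (euler_deriv u))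
    (sph_coeff Y (laplacian u)) (sph_coeff Y (euler_deriv (laplacian u)))"
proof -
  obtain V where V: "open V" "shell e \<subseteq> V" "smooth_on V u"
    using u by (auto simp: shell_eigenfunction_def)
  from shell_tube[OF V(1,2) e] obtain \<delta> where d: "\<delta> > 0"
    "\<And>t \<omega>. e - \<delta> < t \<Longrightarrow> t < 1 + \<delta> \<Longrightarrow> norm \<omega> = 1 \<Longrightarrow> t *\<^sub>R (\<omega>::'a) \<in> V" by blast
  note sl = smooth_on_laplacian[OF V(3)]
  note se = smooth_on_euler_deriv
  have cont: "continuous_on {e..1} (sph_coeff Y f)" if "smooth_on V f" for f
    by (rule continuous_on_subset[OF sph_coeff_continuous[OF Y that d(2)]]) (use d(1) in auto)
  have deriv: "(sph_coeff Y f has_real_derivative sph_coeff Y (euler_deriv f) r / r) (at r)"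
    if "smooth_on V f" "e < r" "r < 1" for f r
    by (rule sph_coeff_has_derivative[OF Y that(1) d(2)]) (use that d(1) e in auto)
  have lap: "sph_coeff Y (euler_deriv (euler_deriv f)) r
      = r\<^sup>2 * sph_coeff Y (laplacian f) r - real d * sph_coeff Y (euler_deriv f) r
        + real j * real (j + d) * sph_coeff Y f r"
    if "smooth_on V f" "e < r" "r < 1" for f r
    using sph_coeff_laplacian[OF Y that(1), of r] d that e by (simp add: n)
  have lap2: "sph_coeff Y (laplacian (laplacian u)) r = 0" if "e < r" "r < 1" for r
  proof -
    have "sph_coeff Y (laplacian (laplacian u)) r = sph_coeff Y (\<lambda>x. 0 * u x) r"
      using u that e by (intro sph_coeff_cong) (auto simp: shell_eigenfunction_def)
    then show ?thesis unfolding sph_coeff_cmult by simp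
  qed
  have b: "sph_coeff Y (euler_deriv u) r = 0" if "r = 1 \<or> r = e" for r
  proof -
    have "sph_coeff Y (euler_deriv u) r = sph_coeff Y (\<lambda>x. 0 * u x) r"
      using u that e by (intro sph_coeff_cong) (auto simp: shell_eigenfunction_def)
    then show ?thesis unfolding sph_coeff_cmult by simp
  qed
  have b1: "sph_coeff Y (euler_deriv (laplacian u)) 1 = - \<xi> * sph_coeff Y u 1"
    unfolding sph_coeff_cmult[symmetric]
    using u by (intro sph_coeff_cong) (auto simp: shell_eigenfunction_def)
  have b2: "sph_coeff Y (euler_deriv (laplacian u)) e = \<xi> * e * sph_coeff Y u e"
    unfolding sph_coeff_cmult[symmetric]
    using u e by (intro sph_coeff_cong) (auto simp: shell_eigenfunction_def)
  have D2: "(sph_coeff Y (euler_deriv u) has_real_derivative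
      (r\<^sup>2 * sph_coeff Y (laplacian u) r - real d * sph_coeff Y (euler_deriv u) r
        + real j * real (j + d) * sph_coeff Y u r) / r) (at r)" if "e < r" "r < 1" for r
    using deriv[OF se[OF V(3)] that] unfolding lap[OF V(3) that] .
  have D4: "(sph_coeff Y (euler_deriv (laplacian u)) has_real_derivative
      (real j * real (j + d) * sph_coeff Y (laplacian u) r
        - real d * sph_coeff Y (euler_deriv (laplacian u)) r) / r) (at r)" if "e < r" "r < 1" for r
    using deriv[OF se[OF sl] that] unfolding lap[OF sl that] lap2[OF that] by (simp add: algebra_simps)
  show ?thesis
    unfolding radial_mode_def radial_profile_def radial_harmonic_def
    using e b b1 b2 cont[OF V(3)] cont[OF se[OF V(3)]] cont[OF sl] cont[OF se[OF sl]]
      deriv[OF V(3)] D2 deriv[OF sl] D4 by simp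
qed

text \<open>\<open>radial_green\<close> with the Laplacian of one mode as test function for the
  other. The left side is symmetric in the two modes, the right side carries \<xi>; comparing the
  two orders gives orthogonality of boundary values. On equal modes it is the energy
  identity.\<close>

lemma radial_mode_pairing:
  assumes "radial_mode d l e \<xi> c c1 w w1" "radial_mode d l e \<xi>' c' c1' w' w1'"
  shows "((\<lambda>r. r ^ Suc d * (w r * w' r)) has_integral
    \<xi> * (c 1 * c' 1 + e ^ Suc d * (c e * c' e))) {e..1}"
proof -
  have "e ^ d * (w1 e * c' e) - w1 1 * c' 1 = \<xi> * (c 1 * c' 1 + e ^ Suc d * (c e * c' e))"
    using assms(1) by (simp add: radial_mode_def algebra_simps)
  with radial_green[of d l e c' c1' w' w w1] assms show ?thesis
    by (simp add: radial_mode_def)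
qed

lemma radial_profile_sum:
  assumes "finite F" "\<And>i. i \<in> F \<Longrightarrow> radial_profile d l e (c i) (c1 i) (w i)" "0 \<le> e" "e < 1"
  shows "radial_profile d l e (\<lambda>r. \<Sum>i\<in>F. a i * c i r) (\<lambda>r. \<Sum>i\<in>F. a i * c1 i r)
    (\<lambda>r. \<Sum>i\<in>F. a i * w i r)"
proof -
  have "((\<lambda>r. \<Sum>i\<in>F. a i * c i r) has_real_derivative (\<Sum>i\<in>F. a i * c1 i r) / r) (at r)"
    if "e < r" "r < 1" for r
  proof -
    have "((\<lambda>r. \<Sum>i\<in>F. a i * c i r) has_real_derivative (\<Sum>i\<in>F. a i * (c1 i r / r))) (at r)"
      by (intro DERIV_sum DERIV_cmult radial_profileD(1)[OF assms(2) that])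
    then show ?thesis by (simp add: sum_divide_distrib)
  qed
  moreover have "((\<lambda>r. \<Sum>i\<in>F. a i * c1 i r) has_real_derivative
      (r\<^sup>2 * (\<Sum>i\<in>F. a i * w i r) - real d * (\<Sum>i\<in>F. a i * c1 i r) + l * (\<Sum>i\<in>F. a i * c i r)) / r) (at r)"
    if "e < r" "r < 1" for r
  proof -
    have "((\<lambda>r. \<Sum>i\<in>F. a i * c1 i r) has_real_derivative
        (\<Sum>i\<in>F. a i * ((r\<^sup>2 * w i r - real d * c1 i r + l * c i r) / r))) (at r)"
      by (intro DERIV_sum DERIV_cmult radial_profileD(2)[OF assms(2) that])
    moreover have "(\<Sum>i\<in>F. a i * ((r\<^sup>2 * w i r - real d * c1 i r + l * c i r) / r))
      = (r\<^sup>2 * (\<Sum>i\<in>F. a i * w i r) - real d * (\<Sum>i\<in>F. a i * c1 i r) + l * (\<Sum>i\<in>F. a i * c i r)) / r"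
      by (simp add: sum_distrib_left sum.distrib sum_subtractf sum_divide_distrib
          algebra_simps add_divide_distrib diff_divide_distrib)
    ultimately show ?thesis by simp
  qed
  ultimately show ?thesis
    using assms(2-) unfolding radial_profile_def
    by (auto intro!: continuous_intros sum.neutral)
qed

text \<open>Boundary values belonging to different eigenvalues are orthogonal, so that the deficit
  \<open>T * |v|^2 - E\<close> of a combination is again the square norm of a combination.\<close>

lemma radial_mode_sum_energy:
  assumes F: "finite F" and m: "\<And>i. i \<in> F \<Longrightarrow> radial_mode d l e (\<xi> i) (c i) (c1 i) (w i) (w1 i)"
    and T: "\<And>i. i \<in> F \<Longrightarrow> \<xi> i \<le> T" and e: "0 \<le> e"
  shows "radial_energy d e (\<lambda>r. \<Sum>i\<in>F. a i * w i r)
    \<le> T * ((\<Sum>i\<in>F. a i * c i 1)\<^sup>2 + e ^ Suc d * (\<Sum>i\<in>F. a i * c i e)\<^sup>2)"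
proof -
  define B where "B i k = c i 1 * c k 1 + e ^ Suc d * (c i e * c k e)" for i k
  define s where "s i = sqrt (T - \<xi> i)" for i
  have pair: "((\<lambda>r. r ^ Suc d * (w i r * w k r)) has_integral \<xi> i * B i k) {e..1}"
    if "i \<in> F" "k \<in> F" for i k
    unfolding B_def by (rule radial_mode_pairing[OF m[OF that(1)] m[OF that(2)]])
  have sym: "\<xi> i * B i k = \<xi> k * B i k" if "i \<in> F" "k \<in> F" for i k
  proof -
    have "B k i = B i k" by (simp add: B_def mult.commute)
    moreover have "((\<lambda>r. r ^ Suc d * (w i r * w k r)) has_integral \<xi> k * B k i) {e..1}"
      using pair[OF that(2,1)] by (simp add: mult.commute)
    ultimately show ?thesis using has_integral_unique[OF pair[OF that]] by simp
  qed
  \<comment> \<open>A nonzero \<open>B i k\<close> forces equal eigenvalues, and then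
    \<open>s i * s k\<close> is exactly T - \<xi>. The matrix of the deficit thus factors through
    \<open>s\<close>.\<close>
  have ss: "(T - \<xi> i) * B i k = s i * s k * B i k" if "i \<in> F" "k \<in> F" for i k
  proof (cases "B i k = 0")
    case False
    then have "\<xi> i = \<xi> k" using sym[OF that] by simp
    then show ?thesis using T[OF that(1)] by (simp add: s_def)
  qed simp
  have sq: "(\<Sum>i\<in>F. x i * c i 1)\<^sup>2 + e ^ Suc d * (\<Sum>i\<in>F. x i * c i e)\<^sup>2
      = (\<Sum>i\<in>F. \<Sum>k\<in>F. x i * x k * B i k)" for x
    unfolding power2_eq_square sum_product B_def
    by (simp add: sum_distrib_left sum.distrib[symmetric] algebra_simps)
  have "((\<lambda>r. \<Sum>i\<in>F. \<Sum>k\<in>F. a i * a k * (r ^ Suc d * (w i r * w k r))) has_integral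
      (\<Sum>i\<in>F. \<Sum>k\<in>F. a i * a k * (\<xi> i * B i k))) {e..1}"
    by (intro has_integral_sum F has_integral_mult_right pair)
  moreover have "(\<Sum>i\<in>F. \<Sum>k\<in>F. a i * a k * (r ^ Suc d * (w i r * w k r)))
      = r ^ Suc d * (\<Sum>i\<in>F. a i * w i r)\<^sup>2" for r
    unfolding power2_eq_square sum_product
    by (simp add: sum_distrib_left mult_ac)
  ultimately have E: "radial_energy d e (\<lambda>r. \<Sum>i\<in>F. a i * w i r)
      = (\<Sum>i\<in>F. \<Sum>k\<in>F. a i * a k * (\<xi> i * B i k))"
    unfolding radial_energy_def by (simp add: integral_unique)
  have "T * (\<Sum>i\<in>F. \<Sum>k\<in>F. a i * a k * B i k) - (\<Sum>i\<in>F. \<Sum>k\<in>F. a i * a k * (\<xi> i * B i k))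
      = (\<Sum>i\<in>F. \<Sum>k\<in>F. a i * a k * ((T - \<xi> i) * B i k))"
    by (simp add: sum_distrib_left sum_subtractf[symmetric] algebra_simps)
  also have "\<dots> = (\<Sum>i\<in>F. \<Sum>k\<in>F. (a i * s i) * (a k * s k) * B i k)"
    by (intro sum.cong refl) (simp add: ss)
  also have "\<dots> = (\<Sum>i\<in>F. a i * s i * c i 1)\<^sup>2 + e ^ Suc d * (\<Sum>i\<in>F. a i * s i * c i e)\<^sup>2"
    by (rule sq[symmetric])
  also have "\<dots> \<ge> 0" using e by simp
  finally show ?thesis unfolding E sq by simp
qed

section \<open>Explicit eigenfunctions\<close>

text \<open>The two coefficients solve a + b = 1 (boundary value \<open>Y\<close>) and j a + (j + 2)
  b = 0 (Neumann condition).\<close>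

lemma ball_eigenfunction:
  fixes Y :: "'a::euclidean_space \<Rightarrow> real"
  assumes Y: "solid_harmonic j Y" and n: "DIM('a) = d + 2"
  defines "u \<equiv> \<lambda>x. (1 + real j / 2) * Y x + (- (real j / 2)) * ((x \<bullet> x) * Y x)"
  shows "steklov_solution (ball 0 1) (ball_eigval d j) u" and "norm \<omega> = 1 \<Longrightarrow> u \<omega> = Y \<omega>"
proof -
  have p: "hpoly j Y" and q: "hpoly (2 + j) (\<lambda>x. (x \<bullet> x) * Y x)"
    using solid_harmonic_hpoly[OF Y] hpoly_mult[OF hpoly_norm_sq solid_harmonic_hpoly[OF Y]] by auto
  have lY: "laplacian Y x = 0" for x using Y by (simp add: solid_harmonic_def)
  note sm = hpoly_smooth[OF _ open_UNIV]
  have smu: "smooth_on UNIV u" unfolding u_def by (intro smooth_on_add smooth_on_cmult sm[OF p] sm[OF q])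
  have euler_cmult: "euler_deriv (\<lambda>x. k * f x) x = k * (real i * f x)" if "hpoly i f"
    for k i x and f :: "'a \<Rightarrow> real"
    using hpoly_euler_deriv[OF hpoly_cmult[OF that]] by simp
  have lu: "laplacian u = (\<lambda>x. (- (real j * real (2 * j + d + 2))) * Y x)"
  proof
    fix x :: 'a
    have "laplacian u x = laplacian (\<lambda>x. (1 + real j / 2) * Y x) x
        + laplacian (\<lambda>x. (- (real j / 2)) * ((x \<bullet> x) * Y x)) x"
      unfolding u_def
      by (rule laplacian_add[OF smooth_on_cmult[OF sm[OF p]] smooth_on_cmult[OF sm[OF q]] UNIV_I])
    also have "\<dots> = (1 + real j / 2) * laplacian Y x
        + (- (real j / 2)) * laplacian (\<lambda>x. (x \<bullet> x) * Y x) x"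
      by (simp only: laplacian_cmult[OF sm[OF p] UNIV_I] laplacian_cmult[OF sm[OF q] UNIV_I])
    finally show "laplacian u x = (- (real j * real (2 * j + d + 2))) * Y x"
      unfolding laplacian_norm_sq_mult[OF p] lY by (simp add: n algebra_simps)
  qed
  have llu: "laplacian (laplacian u) x = 0" for x
    unfolding lu laplacian_cmult[OF sm[OF p] UNIV_I] lY by simp
  have el: "euler_deriv (laplacian u) x = - (real j * real (2 * j + d + 2)) * (real j * Y x)" for x
    unfolding lu euler_cmult[OF p] ..
  have eu: "euler_deriv u x = (1 + real j / 2) * (real j * Y x)
      + (- (real j / 2)) * (real (2 + j) * ((x \<bullet> x) * Y x))" for x
    unfolding u_def euler_cmult[OF p, symmetric] euler_cmult[OF q, symmetric]
    by (rule euler_deriv_add[OF hpoly_differentiable[OF hpoly_cmult[OF p]]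
          hpoly_differentiable[OF hpoly_cmult[OF q]]])
  show u1: "u \<omega> = Y \<omega>" if "norm \<omega> = 1" for \<omega>
    unfolding u_def using that by (simp add: dot_square_norm algebra_simps)
  show "steklov_solution (ball 0 1) (ball_eigval d j) u"
  proof (rule steklov_solution_ballI[OF smu llu])
    fix p :: 'a assume p: "norm p = 1"
    then have pp: "p \<bullet> p = 1" by (simp add: dot_square_norm)
    show "euler_deriv u p = 0 \<and> euler_deriv (laplacian u) p = - ball_eigval d j * u p"
      unfolding eu el u1[OF p] pp ball_eigval_def by (simp add: field_simps power2_eq_square)
  qed
qed

text \<open>Sums of polynomials times real powers of |x|^2: closed under differentiation off the
  origin, hence smooth there by \<open>smooth_on_coinduct\<close>.\<close>

inductive radial_hpoly :: "('a::euclidean_space \<Rightarrow> real) \<Rightarrow> bool" where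
  base: "hpoly d p \<Longrightarrow> radial_hpoly (\<lambda>x. p x * (x \<bullet> x) powr s)"
| add: "radial_hpoly f \<Longrightarrow> radial_hpoly g \<Longrightarrow> radial_hpoly (\<lambda>x. f x + g x)"

lemma powr_norm_sq_has_derivative:
  fixes x :: "'a::euclidean_space"
  assumes "x \<noteq> 0"
  shows "((\<lambda>x. (x \<bullet> x) powr s) has_derivative (\<lambda>v. 2 * s * (x \<bullet> v) * (x \<bullet> x) powr (s - 1))) (at x)"
proof -
  have "((\<lambda>t. t powr s) has_real_derivative s * (x \<bullet> x) powr (s - 1)) (at (x \<bullet> x))"
    using assms by (intro has_real_derivative_powr) simp
  then have 1: "((\<lambda>t. t powr s) has_derivative (\<lambda>h. s * (x \<bullet> x) powr (s - 1) * h)) (at (x \<bullet> x))"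
    by (simp add: has_field_derivative_def)
  have 2: "((\<lambda>x. x \<bullet> x) has_derivative (\<lambda>v. 2 * (x \<bullet> v))) (at x)"
    by (auto intro!: derivative_eq_intros simp: inner_commute)
  from has_derivative_compose[OF 2 1] show ?thesis by (simp add: mult_ac)
qed

lemma powr_norm_sq_differentiable:
  "x \<noteq> 0 \<Longrightarrow> (\<lambda>x::'a::euclidean_space. (x \<bullet> x) powr s) differentiable (at x)"
  using powr_norm_sq_has_derivative by (rule differentiableI)

lemma dd_powr_norm_sq:
  "x \<noteq> 0 \<Longrightarrow> dd [b] (\<lambda>x. (x \<bullet> x) powr s) x = (x \<bullet> b) * (2 * s * (x \<bullet> x) powr (s - 1))"
  by (subst has_derivative_imp_dd[OF powr_norm_sq_has_derivative]) auto

lemma radial_hpoly_differentiable: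
  "radial_hpoly f \<Longrightarrow> x \<noteq> 0 \<Longrightarrow> f differentiable (at x)"
  by (induction rule: radial_hpoly.induct)
    (auto intro: differentiable_mult differentiable_add hpoly_differentiable powr_norm_sq_differentiable)

lemma radial_hpoly_dd:
  "radial_hpoly f \<Longrightarrow> b \<in> Basis \<Longrightarrow> \<exists>g. radial_hpoly g \<and> (\<forall>x\<in>- {0}. dd [b] f x = g x)"
proof (induction rule: radial_hpoly.induct)
  case (base d p s)
  have 1: "hpoly (d - 1) (dd [b] p)" using hpoly_dd[OF base] by simp
  have 2: "hpoly (Suc d) (\<lambda>x. 2 * s * ((x \<bullet> b) * p x))"
    by (rule hpoly_cmult[OF hpoly.var[OF base]])
  have "dd [b] (\<lambda>x. p x * (x \<bullet> x) powr s) x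
      = dd [b] p x * (x \<bullet> x) powr s + 2 * s * ((x \<bullet> b) * p x) * (x \<bullet> x) powr (s - 1)" if "x \<noteq> 0" for x
    using dd_mult[OF hpoly_differentiable[OF base(1)] powr_norm_sq_differentiable[OF that], of b s]
    by (simp add: dd_powr_norm_sq[OF that] mult_ac)
  then show ?case using radial_hpoly.add[OF radial_hpoly.base[OF 1] radial_hpoly.base[OF 2]]
    by (intro exI[of _ "\<lambda>x. dd [b] p x * (x \<bullet> x) powr s + 2 * s * ((x \<bullet> b) * p x) * (x \<bullet> x) powr (s - 1)"]) auto
next
  case (add f g)
  then obtain f' g' where "radial_hpoly f'" "radial_hpoly g'"
    "\<forall>x\<in>- {0}. dd [b] f x = f' x" "\<forall>x\<in>- {0}. dd [b] g x = g' x" by blast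
  then show ?case using add.hyps
    by (intro exI[of _ "\<lambda>x. f' x + g' x"])
      (auto intro!: radial_hpoly.add simp: dd_add radial_hpoly_differentiable)
qed

lemma radial_hpoly_smooth: "radial_hpoly f \<Longrightarrow> smooth_on (- {0}) f"
  by (rule smooth_on_coinduct[of "- {0}" radial_hpoly])
    (auto intro: radial_hpoly_differentiable radial_hpoly_dd)

lemma smooth_powr_norm_sq: "smooth_on (- {0 :: 'a::euclidean_space}) (\<lambda>x. (x \<bullet> x) powr s)"
  using radial_hpoly_smooth[OF radial_hpoly.base[OF hpoly.const[of 1], of s]] by simp

lemma laplacian_powr_norm_sq:
  fixes x :: "'a::euclidean_space"
  assumes x: "x \<noteq> 0"
  shows "laplacian (\<lambda>x. (x \<bullet> x) powr s) x = 2 * s * (real DIM('a) + 2 * s - 2) * (x \<bullet> x) powr (s - 1)"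
proof -
  let ?r = "\<lambda>s x. (x \<bullet> (x::'a)) powr s"
  have pw: "(x \<bullet> x) * ?r (s - 2) x = ?r (s - 1) x"
  proof -
    have "(x \<bullet> x) * ?r (s - 2) x = (x \<bullet> x) powr 1 * ?r (s - 2) x" using x by simp
    also have "\<dots> = ?r (s - 1) x" by (subst powr_add[symmetric]) simp
    finally show ?thesis .
  qed
  have "dd [b, b] (?r s) x = 2 * s * ?r (s - 1) x + 4 * s * (s - 1) * ((x \<bullet> b) * (x \<bullet> b)) * ?r (s - 2) x"
    if b: "b \<in> Basis" for b
  proof -
    have "dd [b, b] (?r s) x = dd [b] (\<lambda>x. (x \<bullet> b) * (2 * s * ?r (s - 1) x)) x"
      unfolding dd_pair by (rule dd_cong_open[of "- {0}"]) (auto simp: dd_powr_norm_sq x)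
    also have "\<dots> = (x \<bullet> b) * dd [b] (\<lambda>x. 2 * s * ?r (s - 1) x) x + (b \<bullet> b) * (2 * s * ?r (s - 1) x)"
      using dd_mult[of "\<lambda>x. x \<bullet> b" x "\<lambda>x. 2 * s * ?r (s - 1) x" b] powr_norm_sq_differentiable[OF x, of "s - 1"]
      by (simp add: differentiable_mult)
    also have "dd [b] (\<lambda>x. 2 * s * ?r (s - 1) x) x = 2 * s * ((x \<bullet> b) * (2 * (s - 1) * ?r (s - 2) x))"
      using dd_cmult[OF powr_norm_sq_differentiable[OF x, of "s - 1"], of b "2 * s"]
      by (simp add: dd_powr_norm_sq[OF x])
    finally show ?thesis using b by (simp add: algebra_simps)
  qed
  then have "laplacian (?r s) x
      = real DIM('a) * (2 * s * ?r (s - 1) x) + (\<Sum>b\<in>Basis. 4 * s * (s - 1) * ((x \<bullet> b) * (x \<bullet> b)) * ?r (s - 2) x)"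
    unfolding laplacian_def by (simp add: sum.distrib)
  also have "(\<Sum>b\<in>Basis. 4 * s * (s - 1) * ((x \<bullet> b) * (x \<bullet> b)) * ?r (s - 2) x)
      = 4 * s * (s - 1) * ((x \<bullet> x) * ?r (s - 2) x)"
  proof -
    have "(\<Sum>b\<in>Basis. k * ((x \<bullet> b) * (x \<bullet> b)) * t) = k * ((x \<bullet> x) * t)" for k t
      by (subst euclidean_inner[of x x]) (simp add: sum_distrib_left sum_distrib_right mult_ac)
    then show ?thesis .
  qed
  finally show ?thesis unfolding pw by (simp add: algebra_simps)
qed

text \<open>The factor vanishes for s = 0 and for 2 s = 2 - n - 2 j: these are the two harmonic
  radial powers r^j and r^(-j-d). Raising s by 1 gives the two biharmonic ones.\<close>

lemma laplacian_powr_harm: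
  fixes Y :: "'a::euclidean_space \<Rightarrow> real"
  assumes Y: "solid_harmonic j Y" and x: "x \<noteq> 0"
  shows "laplacian (\<lambda>x. (x \<bullet> x) powr s * Y x) x
    = 2 * s * (real DIM('a) - 2 + 2 * s + 2 * real j) * ((x \<bullet> x) powr (s - 1) * Y x)"
proof -
  have sY: "smooth_on (- {0}) Y" by (rule solid_harmonic_smooth[OF Y]) auto
  have "(\<Sum>b\<in>Basis. dd [b] (\<lambda>x. (x \<bullet> x) powr s) x * dd [b] Y x)
      = 2 * s * (x \<bullet> x) powr (s - 1) * euler_deriv Y x"
    unfolding euler_deriv_def dd_powr_norm_sq[OF x] by (simp add: sum_distrib_left mult_ac)
  then have "(\<Sum>b\<in>Basis. dd [b] (\<lambda>x. (x \<bullet> x) powr s) x * dd [b] Y x)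
      = 2 * s * (x \<bullet> x) powr (s - 1) * (real j * Y x)"
    using hpoly_euler_deriv[OF solid_harmonic_hpoly[OF Y]] by simp
  then show ?thesis
    using laplacian_mult[OF smooth_powr_norm_sq sY, of x s] x Y
    by (simp add: laplacian_powr_norm_sq[OF x] solid_harmonic_def algebra_simps)
qed

lemma euler_deriv_powr_harm:
  fixes Y :: "'a::euclidean_space \<Rightarrow> real"
  assumes Y: "solid_harmonic j Y" and x: "x \<noteq> 0"
  shows "euler_deriv (\<lambda>x. (x \<bullet> x) powr s * Y x) x = (2 * s + real j) * ((x \<bullet> x) powr s * Y x)"
proof -
  have "euler_deriv (\<lambda>x. (x \<bullet> x) powr s) x = 2 * s * (x \<bullet> x) powr (s - 1) * (x \<bullet> x)"
    unfolding euler_deriv_def dd_powr_norm_sq[OF x] euclidean_inner[of x x]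
    by (simp add: sum_distrib_left sum_distrib_right mult_ac)
  also have "(x \<bullet> x) powr (s - 1) * (x \<bullet> x) = (x \<bullet> x) powr s"
  proof -
    have "(x \<bullet> x) powr (s - 1) * (x \<bullet> x) = (x \<bullet> x) powr (s - 1) * (x \<bullet> x) powr 1" using x by simp
    also have "\<dots> = (x \<bullet> x) powr s" by (subst powr_add[symmetric]) simp
    finally show ?thesis .
  qed
  then have "2 * s * (x \<bullet> x) powr (s - 1) * (x \<bullet> x) = 2 * s * (x \<bullet> x) powr s" by simp
  finally show ?thesis
    using euler_deriv_mult[OF powr_norm_sq_differentiable[OF x] hpoly_differentiable[OF solid_harmonic_hpoly[OF Y]], of s]
      hpoly_euler_deriv[OF solid_harmonic_hpoly[OF Y]]
    by (simp add: algebra_simps)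
qed

lemma powr_harm_dilate:
  assumes Y: "solid_harmonic j Y" and r: "r > 0" and w: "norm \<omega> = 1"
  shows "((r *\<^sub>R \<omega>) \<bullet> (r *\<^sub>R \<omega>)) powr s * Y (r *\<^sub>R \<omega>) = r powr (2 * s + real j) * Y \<omega>"
proof -
  have "(r *\<^sub>R \<omega>) \<bullet> (r *\<^sub>R \<omega>) = r powr 2" using w r by (simp add: dot_square_norm power2_eq_square)
  then have "((r *\<^sub>R \<omega>) \<bullet> (r *\<^sub>R \<omega>)) powr s = r powr (2 * s)" by (simp add: powr_powr)
  moreover have "Y (r *\<^sub>R \<omega>) = r powr (real j) * Y \<omega>"
    using hpoly_homogeneous[OF solid_harmonic_hpoly[OF Y]] r by (simp add: powr_realpow)
  ultimately show ?thesis by (simp add: powr_add)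
qed

text \<open>Coefficient vectors \<open>(A, B, C, D)\<close> stand for the radial functions
  \<open>A r^j + B r^(j+2) + C r^(-j-d) + D r^(2-j-d)\<close>, which are biharmonic of angular degree \<open>j\<close>.\<close>

type_synonym quad = "real \<times> real \<times> real \<times> real"

fun quad_c :: "real \<Rightarrow> real \<Rightarrow> quad \<Rightarrow> real \<Rightarrow> real" where
  "quad_c j q (A, B, C, D) r = A * r powr j + B * r powr (j + 2) + C * r powr - q + D * r powr (2 - q)"

fun quad_euler :: "real \<Rightarrow> real \<Rightarrow> quad \<Rightarrow> quad" where
  "quad_euler j q (A, B, C, D) = (j * A, (j + 2) * B, - q * C, (2 - q) * D)"

text \<open>The Laplacian lowers a power by 2, so the coefficient of r^(j+2) moves into the slot of
  r^j and that of r^(2-q) into the slot of r^(-q), with q = j + d. The harmonic powers are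
  annihilated.\<close>

fun quad_lap :: "real \<Rightarrow> real \<Rightarrow> quad \<Rightarrow> quad" where
  "quad_lap j q (A, B, C, D) = (2 * (j + q + 2) * B, 0, - 2 * (j + q - 2) * D, 0)"

lemma quad_c_linear:
  "quad_c j q (v + v') r = quad_c j q v r + quad_c j q v' r" "quad_c j q (c *\<^sub>R v) r = c * quad_c j q v r"
  "quad_euler j q (v + v') = quad_euler j q v + quad_euler j q v'"
  "quad_euler j q (c *\<^sub>R v) = c *\<^sub>R quad_euler j q v"
  "quad_lap j q (v + v') = quad_lap j q v + quad_lap j q v'"
  "quad_lap j q (c *\<^sub>R v) = c *\<^sub>R quad_lap j q v"
  by (cases v; cases v'; simp add: algebra_simps)+

lemma quad_c_derivative:
  assumes "r > 0"
  shows "(quad_c j q v has_real_derivative quad_c j q (quad_euler j q v) r / r) (at r)"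
proof -
  obtain A B C D where v: "v = (A, B, C, D)" by (cases v)
  have P: "((\<lambda>r. r powr s) has_real_derivative s * r powr s / r) (at r)" for s
    using has_real_derivative_powr[OF assms, of s] assms by (simp add: powr_diff)
  have "((\<lambda>r. A * r powr j + B * r powr (j + 2) + C * r powr - q + D * r powr (2 - q)) has_real_derivative
      A * (j * r powr j / r) + B * ((j + 2) * r powr (j + 2) / r) + C * (- q * r powr - q / r)
      + D * ((2 - q) * r powr (2 - q) / r)) (at r)"
    by (intro DERIV_add DERIV_cmult P)
  moreover have "A * (j * r powr j / r) + B * ((j + 2) * r powr (j + 2) / r) + C * (- q * r powr - q / r)
      + D * ((2 - q) * r powr (2 - q) / r) = quad_c j q (quad_euler j q v) r / r"
    using assms by (simp add: v field_simps)
  moreover have "quad_c j q v = (\<lambda>r. A * r powr j + B * r powr (j + 2) + C * r powr - q + D * r powr (2 - q))"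
    by (rule ext) (simp add: v)
  ultimately show ?thesis by simp
qed

lemma quad_c_continuous: "continuous_on {0<..} (quad_c j q v)"
  by (intro continuous_at_imp_continuous_on ballI DERIV_isCont[OF quad_c_derivative]) auto

lemma quad_c_lap:
  assumes "r > 0" "q = j + d"
  shows "quad_c j q (quad_euler j q (quad_euler j q v)) r
    = r\<^sup>2 * quad_c j q (quad_lap j q v) r - d * quad_c j q (quad_euler j q v) r + j * q * quad_c j q v r"
proof -
  obtain A B C D where v: "v = (A, B, C, D)" by (cases v)
  have "r powr (j + 2) = r\<^sup>2 * r powr j" "r powr (2 - q) = r\<^sup>2 * r powr - q"
    using assms by (auto simp: powr_add powr_diff powr_minus divide_inverse)
  then show ?thesis unfolding v using assms(2) by (simp add: algebra_simps power2_eq_square)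
qed

lemma quad_lap_lap: "quad_lap j q (quad_lap j q v) = 0"
  by (cases v) (simp add: zero_prod_def)

lemma quad_c_zero: "quad_c j q 0 r = 0"
  by (simp add: zero_prod_def)

lemma quad_profile:
  assumes e: "0 < e" "e < 1" and q: "q = j + real d"
    and b: "quad_c j q (quad_euler j q v) 1 = 0" "quad_c j q (quad_euler j q v) e = 0"
  shows "radial_profile d (j * q) e (quad_c j q v) (quad_c j q (quad_euler j q v)) (quad_c j q (quad_lap j q v))"
proof -
  have c: "continuous_on {e..1} (quad_c j q v)" for v
    by (rule continuous_on_subset[OF quad_c_continuous]) (use e in auto)
  have "(quad_c j q (quad_euler j q v) has_real_derivative
      (r\<^sup>2 * quad_c j q (quad_lap j q v) r - real d * quad_c j q (quad_euler j q v) r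
       + j * q * quad_c j q v r) / r) (at r)" if "e < r" for r
    using quad_c_derivative[of r j q "quad_euler j q v"] quad_c_lap[OF _ q, of r v] that e by simp
  then show ?thesis
    unfolding radial_profile_def using e b c quad_c_derivative[of _ j q v] by simp
qed

lemma quad_harmonic:
  assumes e: "0 < e" "e < 1" and q: "q = j + real d"
  shows "radial_harmonic d (j * q) e (quad_c j q (quad_lap j q v)) (quad_c j q (quad_euler j q (quad_lap j q v)))"
proof -
  let ?w = "quad_lap j q v"
  have c: "continuous_on {e..1} (quad_c j q v)" for v
    by (rule continuous_on_subset[OF quad_c_continuous]) (use e in auto)
  have "(quad_c j q (quad_euler j q ?w) has_real_derivative
      (j * q * quad_c j q ?w r - real d * quad_c j q (quad_euler j q ?w) r) / r) (at r)" if "e < r" for r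
    using quad_c_derivative[of r j q "quad_euler j q ?w"] quad_c_lap[OF _ q, of r ?w] that e
    by (simp add: quad_lap_lap quad_c_zero)
  then show ?thesis
    unfolding radial_harmonic_def using e c quad_c_derivative[of _ j q ?w] by simp
qed

section \<open>Eigenfunctions of the annulus in a given degree\<close>

lemma two_powers_zero:
  assumes e: "0 < e" "e < 1" and jq: "j + q > 0"
    and 1: "A + C = 0" and 2: "A * e powr j + C * e powr - q = 0"
  shows "A = (0::real) \<and> C = 0"
proof -
  have "e powr - q * (A * e powr (j + q) + C) = 0"
    using 2 e by (simp add: powr_add powr_minus field_simps)
  then have "A * e powr (j + q) + C = 0" using e by simp
  moreover have "A * (e powr (j + q) - 1) = (A * e powr (j + q) + C) - (A + C)"
    by (simp add: algebra_simps)
  ultimately have "A * (e powr (j + q) - 1) = 0" using 1 by simp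
  moreover have "e powr (j + q) < 1" using e jq by (simp add: powr_def mult_pos_neg)
  ultimately show ?thesis using 1 by auto
qed

text \<open>Four coefficients face four boundary data, so injectivity suffices: zero data give zero
  energy, hence a vanishing profile. For j >= 2 the four powers are distinct; for j = 1 and d = 0
  the powers r^j and r^(2-q) would coincide.\<close>

lemma quad_boundary_surj:
  fixes j d :: nat
  assumes e: "0 < e" "e < 1" and j: "j \<ge> 2"
  shows "\<exists>v. quad_c j (j + d) (quad_euler j (j + d) v) 1 = 0 \<and> quad_c j (j + d) (quad_euler j (j + d) v) e = 0
    \<and> quad_c j (j + d) v 1 = x \<and> quad_c j (j + d) v e = y"
proof -
  let ?j = "real j" and ?q = "real (j + d)"
  define \<Phi> where "\<Phi> v = (quad_c ?j ?q (quad_euler ?j ?q v) 1, quad_c ?j ?q (quad_euler ?j ?q v) e,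
      quad_c ?j ?q v 1, quad_c ?j ?q v e)" for v
  have lin: "linear \<Phi>"
    by (rule linearI) (auto simp: \<Phi>_def quad_c_linear)
  have "v = 0" if v: "\<Phi> v = 0" for v
  proof -
    have z: "quad_c ?j ?q (quad_euler ?j ?q v) 1 = 0" "quad_c ?j ?q (quad_euler ?j ?q v) e = 0"
      "quad_c ?j ?q v 1 = 0" "quad_c ?j ?q v e = 0"
      using v by (auto simp: \<Phi>_def zero_prod_def)
    have q: "?q = ?j + real d" by simp
    note prof = quad_profile[OF e q z(1,2)]
    \<comment> \<open>Green's identity with the Laplacian of the profile as its own test function;
      all boundary terms vanish.\<close>
    have "radial_energy d e (quad_c ?j ?q (quad_lap ?j ?q v)) = 0"
      using radial_green[OF prof quad_harmonic[OF e q]] z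
      unfolding radial_energy_def power2_eq_square by (simp add: integral_unique)
    moreover have "0 \<le> ?j * ?q" by simp
    moreover note z(3)
    ultimately have c0: "quad_c ?j ?q v r = 0" if "r \<in> {e..1}" for r
      using radial_vanish[OF prof _ _ _ that] by simp
    obtain A B C D where vv: "v = (A, B, C, D)" by (cases v)
    have w0: "quad_c ?j ?q (quad_lap ?j ?q v) r = 0" if r: "e < r" "r < 1" for r
    proof -
      \<comment> \<open>A profile that vanishes on the interval has vanishing Euler derivative.
        Applied twice, this transfers c = 0 to the Laplacian, which isolates the coefficients
        \<open>B\<close> and \<open>D\<close>.\<close>
      have dz: "quad_c ?j ?q (quad_euler ?j ?q u) r = 0"
        if "\<And>r. e < r \<Longrightarrow> r < 1 \<Longrightarrow> quad_c ?j ?q u r = 0" "e < r" "r < 1" for u r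
      proof -
        have "(quad_c ?j ?q u has_real_derivative 0) (at r)"
          by (rule has_field_derivative_transform_within_open[of "\<lambda>r. 0" _ _ "{e<..<1}"])
            (use that in auto)
        from DERIV_unique[OF this quad_c_derivative] that e show ?thesis by simp
      qed
      have 1: "quad_c ?j ?q (quad_euler ?j ?q v) r = 0" if "e < r" "r < 1" for r
        using dz[OF _ that, of v] c0 by simp
      have 2: "quad_c ?j ?q (quad_euler ?j ?q (quad_euler ?j ?q v)) r = 0"
        using dz[OF 1 r] .
      have "r\<^sup>2 * quad_c ?j ?q (quad_lap ?j ?q v) r = 0"
        using quad_c_lap[OF _ q, of r v] 1[OF r] 2 c0[of r] r e by simp
      then show ?thesis using r e by simp
    qed
    have w0': "quad_c ?j ?q (quad_lap ?j ?q v) r = 0" if "r \<in> {e..1}" for r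
    proof (rule continuous_constant_on_closure[of "{e<..<1}" "quad_c ?j ?q (quad_lap ?j ?q v)" 0])
      show "continuous_on (closure {e<..<1}) (quad_c ?j ?q (quad_lap ?j ?q v))"
        by (rule continuous_on_subset[OF quad_c_continuous]) (use e in auto)
    qed (use w0 that e in auto)
    have jq: "?j + ?q > 0" using j by simp
    have pos: "?j + ?q + 2 \<noteq> 0" "?j + ?q - 2 \<noteq> 0" using j by auto
    have "2 * (?j + ?q + 2) * B = 0 \<and> - 2 * (?j + ?q - 2) * D = 0"
      using w0'[of 1] w0'[of e] e unfolding vv by (intro two_powers_zero[OF e jq]) auto
    then have BD: "B = 0" "D = 0" using pos by auto
    have "A = 0 \<and> C = 0"
      using c0[of 1] c0[of e] e BD unfolding vv by (intro two_powers_zero[OF e jq]) auto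
    then show ?thesis using BD vv by (simp add: zero_prod_def)
  qed
  then have "inj \<Phi>" using linear_injective_0[OF lin] by blast
  then have "surj \<Phi>" using linear_injective_imp_surjective[OF lin] by blast
  then obtain v where "\<Phi> v = (0, 0, x, y)" by (metis surjD)
  then show ?thesis unfolding \<Phi>_def by (intro exI[of _ v]) simp
qed

text \<open>A 2 by 2 matrix symmetric for the weight (1, K) has discriminant (p1 - q2)^2 + 4 K q1^2
  >= 0 and so a real eigenvalue.\<close>

lemma symmetric_eigenvector:
  fixes p1 p2 q1 q2 K :: real
  assumes "p2 = K * q1" "K \<ge> 0"
  obtains s t \<xi> where "s \<noteq> 0 \<or> t \<noteq> 0" "s * p1 + t * p2 = \<xi> * s" "s * q1 + t * q2 = \<xi> * t"
proof (cases "q1 = 0")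
  case True
  then show ?thesis using that[of 1 0 p1] assms by simp
next
  case False
  define D where "D = (p1 - q2)\<^sup>2 + 4 * (K * q1\<^sup>2)"
  have D: "D \<ge> 0" unfolding D_def using assms(2) by (intro add_nonneg_nonneg mult_nonneg_nonneg) auto
  define \<xi> where "\<xi> = ((p1 + q2) + sqrt D) / 2"
  have "2 * \<xi> = p1 + q2 + sqrt D" by (simp add: \<xi>_def)
  then have "sqrt D = 2 * \<xi> - p1 - q2" by linarith
  then have "(2 * \<xi> - p1 - q2)\<^sup>2 = D" using D by (metis real_sqrt_pow2)
  then have root: "(\<xi> - p1) * (\<xi> - q2) = K * q1 * q1"
    unfolding D_def by (simp add: power2_eq_square algebra_simps)
  define s where "s = (\<xi> - q2) / q1"
  have sq: "s * q1 = \<xi> - q2" using False by (simp add: s_def)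
  have "(\<xi> - p1) * s * q1 = K * q1 * q1" using root sq by (simp add: mult.assoc)
  then have "(\<xi> - p1) * s = K * q1" using False by simp
  then show ?thesis using that[of s 1 \<xi>] sq assms(1) by (simp add: algebra_simps)
qed

text \<open>The boundary values (c(1), c(e)) determine a biharmonic profile with Neumann condition.
  Mapping them to the Steklov data of its Laplacian is a 2 by 2 matrix, and an eigenvector of it is
  an eigenfunction profile. \<open>v\<close> and \<open>w\<close> are the profiles of the two unit
  vectors.\<close>

lemma quad_eigen:
  fixes j d :: nat
  assumes e: "0 < e" "e < 1" and j: "j \<ge> 2"
  defines "q \<equiv> real (j + d)"
  obtains v \<xi> where "quad_c j q (quad_euler j q v) 1 = 0" "quad_c j q (quad_euler j q v) e = 0"
    "quad_c j q (quad_euler j q (quad_lap j q v)) 1 = - \<xi> * quad_c j q v 1"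
    "quad_c j q (quad_euler j q (quad_lap j q v)) e = \<xi> * e * quad_c j q v e"
    "quad_c j q v 1 \<noteq> 0 \<or> quad_c j q v e \<noteq> 0"
proof -
  have q: "q = real j + real d" by (simp add: q_def)
  let ?c = "quad_c j q" and ?E = "quad_euler j q" and ?L = "quad_lap j q"
  obtain v where v: "?c (?E v) 1 = 0" "?c (?E v) e = 0" "?c v 1 = 1" "?c v e = 0"
    using quad_boundary_surj[OF e j, of d 1 0] unfolding q_def by blast
  obtain w where w: "?c (?E w) 1 = 0" "?c (?E w) e = 0" "?c w 1 = 0" "?c w e = 1"
    using quad_boundary_surj[OF e j, of d 0 1] unfolding q_def by blast
  define p1 p2 q1 q2 where "p1 = - ?c (?E (?L v)) 1" "p2 = - ?c (?E (?L w)) 1"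
    "q1 = ?c (?E (?L v)) e / e" "q2 = ?c (?E (?L w)) e / e"
  note defs = this
  have h1: "((\<lambda>r. r ^ Suc d * (?c (?L v) r * ?c (?L w) r)) has_integral e ^ d * (e * q1)) {e..1}"
    using radial_green[OF quad_profile[OF e q w(1,2)] quad_harmonic[OF e q, of v]] w e
    by (simp add: defs)
  have h2: "((\<lambda>r. r ^ Suc d * (?c (?L v) r * ?c (?L w) r)) has_integral p2) {e..1}"
    using radial_green[OF quad_profile[OF e q v(1,2)] quad_harmonic[OF e q, of w]] v
    by (simp add: defs mult.commute)
  \<comment> \<open>Green's identity in both orders yields the symmetry, weighted by the area factor
    e^(d+1) of the inner sphere.\<close>
  have p2: "p2 = e ^ Suc d * q1"
    using has_integral_unique[OF h2 h1] by simp
  obtain s t \<xi> where st: "s \<noteq> 0 \<or> t \<noteq> 0" "s * p1 + t * p2 = \<xi> * s" "s * q1 + t * q2 = \<xi> * t"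
    using symmetric_eigenvector[OF p2, of p1 q2] e by auto
  define z where "z = s *\<^sub>R v + t *\<^sub>R w"
  have L: "?c (?E (?L z)) r = s * ?c (?E (?L v)) r + t * ?c (?E (?L w)) r"
    "?c (?E z) r = s * ?c (?E v) r + t * ?c (?E w) r" "?c z r = s * ?c v r + t * ?c w r" for r
    by (simp_all add: z_def quad_c_linear)
  show ?thesis
  proof (rule that[of z \<xi>])
    show "?c (?E (?L z)) 1 = - \<xi> * ?c z 1"
      using st(2) unfolding L v w by (simp add: defs algebra_simps)
    have "?c (?E (?L z)) e = e * (s * q1 + t * q2)"
      unfolding L using e by (simp add: defs algebra_simps)
    then show "?c (?E (?L z)) e = \<xi> * e * ?c z e"
      unfolding st(3) L v w by simp
  qed (use st(1) in \<open>simp_all add: L v w\<close>)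
qed

lemma annulus_eigenfunction:
  fixes Y :: "'a::euclidean_space \<Rightarrow> real"
  assumes e: "0 < e" "e < 1" and Y: "solid_harmonic j Y" and j: "j \<ge> 2" and n: "DIM('a) = d + 2"
  obtains u \<xi> c where "shell_eigenfunction e \<xi> u" "c 1 \<noteq> 0 \<or> c e \<noteq> 0"
    "\<forall>r \<omega>. 0 < r \<longrightarrow> norm \<omega> = 1 \<longrightarrow> u (r *\<^sub>R \<omega>) = c r * Y \<omega>"
proof -
  define q where "q = real (j + d)"
  let ?c = "quad_c j q" and ?E = "quad_euler j q" and ?L = "quad_lap j q"
  obtain v \<xi> where v: "?c (?E v) 1 = 0" "?c (?E v) e = 0"
    "?c (?E (?L v)) 1 = - \<xi> * ?c v 1" "?c (?E (?L v)) e = \<xi> * e * ?c v e"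
    "?c v 1 \<noteq> 0 \<or> ?c v e \<noteq> 0"
    using quad_eigen[OF e j, of d] unfolding q_def by blast
  \<comment> \<open>Makes 2 s + j = -q, so that \<open>(x \<bullet> x) powr s * Y x\<close> has
    radial part r^(-q).\<close>
  define s where "s = - (real j + q) / 2"
  define U where "U v = (case v of (A, B, C, D) \<Rightarrow> \<lambda>x. A * ((x \<bullet> x) powr 0 * Y x) + B * ((x \<bullet> x) powr 1 * Y x)
      + C * ((x \<bullet> x) powr s * Y x) + D * ((x \<bullet> x) powr (s + 1) * Y x))" for v :: quad
  have sm1: "smooth_on (- {0}) (\<lambda>x. (x \<bullet> x) powr t * Y x)" for t
    by (intro smooth_on_mult smooth_powr_norm_sq solid_harmonic_smooth[OF Y]) auto
  have smU: "smooth_on (- {0}) (U v)" for v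
  proof -
    obtain A B C D where vv: "v = (A, B, C, D)" by (cases v)
    show ?thesis unfolding U_def vv prod.case by (intro smooth_on_add smooth_on_cmult sm1)
  qed
  have UE: "euler_deriv (U v) x = U (?E v) x" if x: "x \<noteq> 0" for v x
  proof -
    obtain A B C D where vv: "v = (A, B, C, D)" by (cases v)
    have xS: "x \<in> - {0}" using x by simp
    note sc = smooth_on_cmult[OF sm1]
    have l: "euler_deriv (\<lambda>x. k * ((x \<bullet> x) powr t * Y x)) x
        = k * ((2 * t + real j) * ((x \<bullet> x) powr t * Y x))" for k t
      using euler_deriv_cmult[OF smooth_on_differentiable[OF sm1 xS], of k t]
        euler_deriv_powr_harm[OF Y x, of t] by (simp only:)
    have E: "euler_deriv (U v) x = A * ((2 * 0 + real j) * ((x \<bullet> x) powr 0 * Y x))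
      + B * ((2 * 1 + real j) * ((x \<bullet> x) powr 1 * Y x))
      + C * ((2 * s + real j) * ((x \<bullet> x) powr s * Y x))
      + D * ((2 * (s + 1) + real j) * ((x \<bullet> x) powr (s + 1) * Y x))"
      unfolding U_def vv prod.case l[symmetric]
      using euler_deriv_add[OF smooth_on_differentiable[OF smooth_on_add[OF smooth_on_add[OF sc sc] sc] xS]
          smooth_on_differentiable[OF sc xS]]
        euler_deriv_add[OF smooth_on_differentiable[OF smooth_on_add[OF sc sc] xS]
          smooth_on_differentiable[OF sc xS]]
        euler_deriv_add[OF smooth_on_differentiable[OF sc xS] smooth_on_differentiable[OF sc xS]]
      by (simp only:)
    have sj: "2 * s + real j = - q" "2 * (s + 1) + real j = 2 - q" "2 * 0 + real j = real j"
      "2 * 1 + real j = real j + 2" by (auto simp: s_def field_simps)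
    show ?thesis
      unfolding E sj unfolding vv U_def quad_euler.simps prod.case by (simp only: ac_simps)
  qed
  have UL: "laplacian (U v) x = U (?L v) x" if x: "x \<noteq> 0" for v x
  proof -
    obtain A B C D where vv: "v = (A, B, C, D)" by (cases v)
    have xS: "x \<in> - {0}" using x by simp
    have l: "laplacian (\<lambda>x. k * ((x \<bullet> x) powr t * Y x)) x
        = k * (2 * t * (real d + 2 * t + 2 * real j) * ((x \<bullet> x) powr (t - 1) * Y x))" for k t
      using laplacian_cmult[OF sm1 xS, of k t] laplacian_powr_harm[OF Y x, of t] by (simp add: n)
    have "laplacian (U v) x = laplacian (\<lambda>x. A * ((x \<bullet> x) powr 0 * Y x)) x
      + laplacian (\<lambda>x. B * ((x \<bullet> x) powr 1 * Y x)) x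
      + laplacian (\<lambda>x. C * ((x \<bullet> x) powr s * Y x)) x
      + laplacian (\<lambda>x. D * ((x \<bullet> x) powr (s + 1) * Y x)) x"
      unfolding U_def vv prod.case
      using laplacian_add[OF smooth_on_add[OF smooth_on_add[OF smooth_on_cmult[OF sm1] smooth_on_cmult[OF sm1]]
            smooth_on_cmult[OF sm1]] smooth_on_cmult[OF sm1] xS]
        laplacian_add[OF smooth_on_add[OF smooth_on_cmult[OF sm1] smooth_on_cmult[OF sm1]]
            smooth_on_cmult[OF sm1] xS]
        laplacian_add[OF smooth_on_cmult[OF sm1] smooth_on_cmult[OF sm1] xS]
      by (simp only:)
    also have "\<dots> = U (?L v) x"
    proof -
      have s2: "2 * s = - (real j + q)" by (simp add: s_def)
      have "real d + 2 * s + 2 * real j = 0" unfolding s2 by (simp add: q_def)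
      moreover have "2 * (s + 1) * (real d + 2 * (s + 1) + 2 * real j) = - 2 * (real j + q - 2)"
        using s2 by (simp add: q_def algebra_simps)
      moreover have "2 * 1 * (real d + 2 * 1 + 2 * real j) = 2 * (real j + q + 2)" by (simp add: q_def)
      ultimately show ?thesis unfolding l vv U_def by simp
    qed
    finally show ?thesis .
  qed
  have Uc: "U v (r *\<^sub>R \<omega>) = ?c v r * Y \<omega>" if "0 < r" "norm \<omega> = 1" for v r \<omega>
  proof -
    obtain A B C D where vv: "v = (A, B, C, D)" by (cases v)
    have sj: "2 * s + real j = - q" "2 * (s + 1) + real j = 2 - q" "2 * 0 + real j = real j"
      "2 * 1 + real j = real j + 2" by (auto simp: s_def field_simps)
    show ?thesis
      unfolding vv U_def prod.case powr_harm_dilate[OF Y that] sj quad_c.simps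
      by (simp only: ring_distribs mult.assoc)
  qed
  have LU: "laplacian (laplacian (U v)) x = 0" if "x \<noteq> 0" for x
  proof -
    have "laplacian (laplacian (U v)) x = laplacian (U (?L v)) x"
      using that by (intro laplacian_cong_open[of "- {0}"]) (auto simp: UL)
    also have "\<dots> = U (?L (?L v)) x" by (rule UL[OF that])
    also have "\<dots> = 0" by (simp add: quad_lap_lap U_def zero_prod_def)
    finally show ?thesis .
  qed
  have EL: "euler_deriv (laplacian (U v)) x = U (?E (?L v)) x" if "x \<noteq> 0" for x
  proof -
    have "euler_deriv (laplacian (U v)) x = euler_deriv (U (?L v)) x"
      using that by (intro euler_deriv_cong_open[of "- {0}"]) (auto simp: UL)
    then show ?thesis using UE[OF that] by simp
  qed
  have shift: "\<exists>\<omega>. p = r *\<^sub>R \<omega> \<and> norm \<omega> = 1" if "norm p = r" "0 < r" for p :: 'a and r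
    using that by (intro exI[of _ "p /\<^sub>R r"]) auto
  have "shell_eigenfunction e \<xi> (U v)"
    unfolding shell_eigenfunction_def
  proof (intro conjI allI impI)
    show "\<exists>V. open V \<and> shell e \<subseteq> V \<and> smooth_on V (U v)"
      using smU e by (intro exI[of _ "- {0}"]) (auto simp: shell_def)
    show "laplacian (laplacian (U v)) x = 0" if "e < norm x \<and> norm x < 1" for x
      using that e by (intro LU) auto
  next
    fix p :: 'a assume p: "norm p = 1"
    then have p0: "p \<noteq> 0" by auto
    from shift[OF p] obtain \<omega> where w: "p = 1 *\<^sub>R \<omega>" "norm \<omega> = 1" by auto
    show "euler_deriv (U v) p = 0" unfolding UE[OF p0] unfolding w(1) Uc[OF zero_less_one w(2)] v by simp
    show "euler_deriv (laplacian (U v)) p = - \<xi> * U v p"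
      unfolding EL[OF p0] unfolding w(1) Uc[OF zero_less_one w(2)] v by simp
  next
    fix p :: 'a assume p: "norm p = e"
    then have p0: "p \<noteq> 0" using e by auto
    from shift[OF p e(1)] obtain \<omega> where w: "p = e *\<^sub>R \<omega>" "norm \<omega> = 1" by auto
    show "euler_deriv (U v) p = 0" unfolding UE[OF p0] unfolding w(1) Uc[OF e(1) w(2)] v by simp
    show "euler_deriv (laplacian (U v)) p = \<xi> * e * U v p"
      unfolding EL[OF p0] unfolding w(1) Uc[OF e(1) w(2)] v by simp
  qed
  then show ?thesis using v(5) Uc by (intro that[of \<xi> "U v" "?c v"]) auto
qed

section \<open>Comparison of the eigenvalues\<close>

text \<open>\<open>lin_indep_fun\<close> speaks of sets, in which repeated members of a family would
  collapse. Independence of the family excludes repetitions, as the coefficients 1 and -1 show, so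
  the cardinality survives.\<close>

lemma independent_family:
  assumes "finite I" and ind: "\<And>a. (\<And>x. (\<Sum>i\<in>I. a i * g i x) = (0::real)) \<Longrightarrow> \<forall>i\<in>I. a i = 0"
  shows "inj_on g I" "lin_indep_fun (g ` I)"
proof -
  show inj: "inj_on g I"
  proof (rule inj_onI, rule ccontr)
    fix i k assume ik: "i \<in> I" "k \<in> I" "g i = g k" "i \<noteq> k"
    define a where "a l = (if l = i then 1 else if l = k then - 1 else (0::real))" for l
    have "(\<Sum>l\<in>I. a l * g l x) = 0" for x
    proof -
      have "(\<Sum>l\<in>I. a l * g l x) = (\<Sum>l\<in>I. (if l = i then g i x else 0) - (if l = k then g k x else 0))"
        by (intro sum.cong refl) (use ik in \<open>auto simp: a_def\<close>)
      also have "\<dots> = 0" using ik assms(1) by (simp add: sum_subtractf)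
      finally show ?thesis .
    qed
    from ind[OF this] ik(1) show False by (auto simp: a_def)
  qed
  show "lin_indep_fun (g ` I)"
    unfolding lin_indep_fun_def sum.reindex[OF inj]
    using ind[of "\<lambda>i. c (g i)" for c] by (auto simp: o_def)
qed

lemma lin_indep_fun_subset:
  assumes "lin_indep_fun S" "T \<subseteq> S" "finite S"
  shows "lin_indep_fun T"
  unfolding lin_indep_fun_def
proof (intro allI impI)
  fix c assume c: "\<forall>x. (\<Sum>f\<in>T. c f * f x) = (0::real)"
  define a where "a f = (if f \<in> T then c f else 0)" for f
  have "(\<Sum>f\<in>S. a f * f x) = 0" for x
  proof -
    have "(\<Sum>f\<in>S. a f * f x) = (\<Sum>f\<in>T. a f * f x)"
      using assms(2,3) by (intro sum.mono_neutral_right) (auto simp: a_def)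
    then show ?thesis using c by (simp add: a_def)
  qed
  then have "\<forall>f\<in>S. a f = 0" using assms(1) unfolding lin_indep_fun_def by blast
  then show "\<forall>f\<in>T. c f = 0" using assms(2) unfolding a_def by (metis subsetD)
qed

lemma lin_indep_fun_span:
  assumes "lin_indep_fun S" "finite S" "\<not> lin_indep_fun (insert f S)" "f \<notin> S"
  shows "\<exists>c. \<forall>x. f x = (\<Sum>g\<in>S. c g * g x)"
proof -
  obtain c where c: "\<And>x. (\<Sum>g\<in>insert f S. c g * g x) = 0" "\<exists>g\<in>insert f S. c g \<noteq> 0"
    using assms(3) unfolding lin_indep_fun_def by auto
  have s: "c f * f x + (\<Sum>g\<in>S. c g * g x) = 0" for x using c(1)[of x] assms by simp
  have "c f \<noteq> 0"
  proof
    assume "c f = 0"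
    then have "\<forall>x. (\<Sum>g\<in>S. c g * g x) = 0" using s by simp
    then have "\<forall>g\<in>S. c g = 0" using assms(1) unfolding lin_indep_fun_def by blast
    then show False using c(2) \<open>c f = 0\<close> by auto
  qed
  have "f x = (\<Sum>g\<in>S. (- c g / c f) * g x)" for x
  proof -
    have "(\<Sum>g\<in>S. (- c g / c f) * g x) = - (\<Sum>g\<in>S. c g * g x) / c f"
      by (simp add: sum_negf sum_divide_distrib)
    also have "(\<Sum>g\<in>S. c g * g x) = - (c f * f x)" using s[of x] by linarith
    finally show ?thesis using \<open>c f \<noteq> 0\<close> by simp
  qed
  then show ?thesis by (intro exI[of _ "\<lambda>g. - c g / c f"]) blast
qed

lemma lin_indep_fun_nonzero:
  assumes "lin_indep_fun S" "finite S" "f \<in> S"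
  obtains x where "f x \<noteq> 0"
proof -
  have "\<exists>x. f x \<noteq> 0"
  proof (rule ccontr)
    assume "\<nexists>x. f x \<noteq> 0"
    then have "(\<Sum>g\<in>S. (if g = f then 1 else 0) * g x) = 0" for x
      using assms(2,3) by (simp add: if_distrib[of "\<lambda>c. c * _"] cong: if_cong)
    then have "\<forall>g\<in>S. (if g = f then 1 else 0) = (0::real)"
      using assms(1)[unfolded lin_indep_fun_def, rule_format, of "\<lambda>g. if g = f then 1 else 0"] by blast
    then show False using assms(3) by auto
  qed
  then show ?thesis using that by blast
qed

text \<open>Gaussian elimination, one equation per step: a pivot column \<open>p\<close> is removed,
  and the coefficient of \<open>p\<close> is recovered afterwards from the eliminated
  equation.\<close>

lemma underdetermined_system:
  fixes G :: "'t \<Rightarrow> 'f \<Rightarrow> real"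
  assumes "finite T" "finite F" "card T < card F"
  shows "\<exists>a. (\<exists>f\<in>F. a f \<noteq> 0) \<and> (\<forall>t\<in>T. (\<Sum>f\<in>F. a f * G t f) = 0)"
  using assms
proof (induction T arbitrary: F G rule: finite_induct)
  case empty
  then obtain f where "f \<in> F" by (metis all_not_in_conv card.empty less_irrefl)
  then show ?case by (intro exI[of _ "\<lambda>_. 1"]) auto
next
  case (insert t T)
  show ?case
  proof (cases "\<forall>f\<in>F. G t f = 0")
    case True
    have "card T < card F" using insert by simp
    from insert.IH[OF insert.prems(1) this, of G] True show ?thesis by auto
  next
    case False
    then obtain p where p: "p \<in> F" "G t p \<noteq> 0" by auto
    define F' where "F' = F - {p}"
    define G' where "G' s f = G s f - G t f / G t p * G s p" for s f
    have F': "finite F'" "F = insert p F'" "p \<notin> F'" using p insert.prems by (auto simp: F'_def)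
    then have "card T < card F'" using insert by simp
    from insert.IH[OF F'(1) this, of G'] obtain a where
      a: "\<exists>f\<in>F'. a f \<noteq> 0" "\<And>s. s \<in> T \<Longrightarrow> (\<Sum>f\<in>F'. a f * G' s f) = 0" by auto
    define b where "b f = (if f = p then - (\<Sum>f\<in>F'. a f * G t f) / G t p else a f)" for f
    have sb: "(\<Sum>f\<in>F. b f * G s f) = (\<Sum>f\<in>F'. a f * G' s f)" for s
    proof -
      have "(\<Sum>f\<in>F. b f * G s f) = b p * G s p + (\<Sum>f\<in>F'. b f * G s f)" using F' by simp
      also have "(\<Sum>f\<in>F'. b f * G s f) = (\<Sum>f\<in>F'. a f * G s f)"
        using F'(3) by (intro sum.cong refl) (auto simp: b_def)
      also have "b p * G s p + \<dots> = (\<Sum>f\<in>F'. a f * G' s f)"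
      proof -
        have "(\<Sum>f\<in>F'. a f * (G t f / G t p * G s p)) = (\<Sum>f\<in>F'. a f * G t f) / G t p * G s p"
          by (simp add: sum_divide_distrib sum_distrib_right mult.assoc)
        then show ?thesis
          unfolding G'_def b_def right_diff_distrib sum_subtractf by simp
      qed
      finally show ?thesis .
    qed
    have "(\<Sum>f\<in>F. b f * G t f) = 0" unfolding sb using p(2) by (simp add: G'_def)
    then have "\<forall>s\<in>insert t T. (\<Sum>f\<in>F. b f * G s f) = 0" using a(2) sb by auto
    moreover have "\<exists>f\<in>F. b f \<noteq> 0" using a(1) F' by (auto simp: b_def)
    ultimately show ?thesis by blast
  qed
qed

text \<open>Extension by 0 turns equality of boundary values into equality of functions, as
  \<open>lin_indep_fun\<close> tests all points of the space.\<close>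

definition on_sphere :: "('a::euclidean_space \<Rightarrow> real) \<Rightarrow> 'a \<Rightarrow> real" where
  "on_sphere Y = (\<lambda>x. if norm x = 1 then Y x else 0)"

text \<open>Each member has one degree; mixtures of degrees enter only through spans.\<close>

definition sph_harm :: "nat \<Rightarrow> ('a::euclidean_space \<Rightarrow> real) set" where
  "sph_harm k = {on_sphere Y | Y j. j \<le> k \<and> solid_harmonic j Y}"

lemma solid_harmonic_family_independent:
  fixes P :: "nat \<Rightarrow> 'a::euclidean_space \<Rightarrow> real"
  assumes n: "DIM('a) \<ge> 2" and I: "finite I" and P: "\<And>i. i \<in> I \<Longrightarrow> solid_harmonic i (P i)"
    and e: "\<And>i. i \<in> I \<Longrightarrow> norm (e i) = 1 \<and> P i (e i) = 1"
    and z: "\<And>\<omega>. norm \<omega> = 1 \<Longrightarrow> (\<Sum>i\<in>I. a i * P i \<omega>) = 0" and k: "k \<in> I"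
  shows "a k = 0"
proof -
  have c: "continuous_on (sphere 0 1) (\<lambda>\<omega>. P i \<omega> * P k \<omega>)" if "i \<in> I" for i
    by (intro continuous_on_mult solid_harmonic_continuous[OF P] that k)
  have orth: "sphere_mean (\<lambda>\<omega>. P i \<omega> * P k \<omega>) = 0" if "i \<in> I" "i \<noteq> k" for i
    using solid_harmonic_orthogonal[OF n P[OF that(1)] P[OF k]] solid_harmonic_orthogonal[OF n P[OF k] P[OF that(1)]] that(2)
    by (cases "i < k") (auto simp: mult.commute)
  have "0 = sphere_mean (\<lambda>\<omega>. (\<Sum>i\<in>I. a i * P i \<omega>) * P k \<omega>)"
    using sphere_mean_cong[of "\<lambda>\<omega>. (\<Sum>i\<in>I. a i * P i \<omega>) * P k \<omega>" "\<lambda>\<omega>. 0"] z by simp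
  also have "\<dots> = (\<Sum>i\<in>I. a i * sphere_mean (\<lambda>\<omega>. P i \<omega> * P k \<omega>))"
    using c by (simp add: sum_distrib_right mult.assoc sphere_mean_sum sphere_mean_cmult
        continuous_on_mult_left)
  also have "\<dots> = (\<Sum>i\<in>I. if i = k then a k * sphere_mean (\<lambda>\<omega>. P k \<omega> * P k \<omega>) else 0)"
    by (intro sum.cong refl) (auto simp: orth)
  also have "\<dots> = a k * sphere_mean (\<lambda>\<omega>. P k \<omega> * P k \<omega>)" using I k by simp
  finally have "a k * sphere_mean (\<lambda>\<omega>. P k \<omega> * P k \<omega>) = 0" by simp
  moreover have "sphere_mean (\<lambda>\<omega>. P k \<omega> * P k \<omega>) \<noteq> 0"
    using sphere_mean_eq_0D[OF c[OF k], of "e k"] e[OF k] by auto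
  ultimately show ?thesis by simp
qed

text \<open>Each harmonic of degree at most k is the boundary value of an eigenfunction of the ball,
  and eigenfunctions with independent boundary values are independent.\<close>

lemma steklov_eigenvalue_ball_le:
  assumes n: "DIM('a::euclidean_space) = d + 2"
    and S: "S \<subseteq> sph_harm k" "finite S" "card S = Suc m" "lin_indep_fun (S :: ('a \<Rightarrow> real) set)"
  shows "\<exists>F :: ('a \<Rightarrow> real) set. finite F \<and> card F = Suc m \<and> lin_indep_fun F \<and>
    (\<forall>f\<in>F. \<exists>\<xi> u. \<xi> \<le> ball_eigval d k \<and> steklov_solution (ball 0 1) \<xi> u \<and> f = restr (ball 0 1) u)"
proof -
  have "\<forall>f\<in>S. \<exists>u \<xi>. \<xi> \<le> ball_eigval d k \<and> steklov_solution (ball 0 1) \<xi> u \<and> (\<forall>\<omega>. norm \<omega> = 1 \<longrightarrow> u \<omega> = f \<omega>)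
      \<and> (\<forall>x. norm x \<noteq> 1 \<longrightarrow> f x = 0)"
  proof
    fix f assume "f \<in> S"
    then obtain Y j where Y: "f = on_sphere Y" "j \<le> k" "solid_harmonic j Y" using S(1) by (auto simp: sph_harm_def)
    have "ball_eigval d j \<le> ball_eigval d k"
      unfolding ball_eigval_def using Y(2) by (intro mult_mono power_mono) auto
    then show "\<exists>u \<xi>. \<xi> \<le> ball_eigval d k \<and> steklov_solution (ball 0 1) \<xi> u \<and> (\<forall>\<omega>. norm \<omega> = 1 \<longrightarrow> u \<omega> = f \<omega>)
      \<and> (\<forall>x. norm x \<noteq> 1 \<longrightarrow> f x = 0)"
      using ball_eigenfunction[OF Y(3) n] by (auto simp: Y(1) on_sphere_def)
  qed
  from bchoice[OF this] obtain u where
    u: "\<forall>f\<in>S. \<exists>\<xi>. \<xi> \<le> ball_eigval d k \<and> steklov_solution (ball 0 1) \<xi> (u f) \<and>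
      (\<forall>\<omega>. norm \<omega> = 1 \<longrightarrow> u f \<omega> = f \<omega>) \<and> (\<forall>x. norm x \<noteq> 1 \<longrightarrow> f x = 0)" by blast
  define g where "g f = restr (ball 0 1) (u f)" for f
  have ind: "\<forall>f\<in>S. a f = 0" if "\<And>x. (\<Sum>f\<in>S. a f * g f x) = 0" for a
  proof -
    have "(\<Sum>f\<in>S. a f * f x) = 0" for x
    proof (cases "norm x = 1")
      case True
      have "(\<Sum>f\<in>S. a f * f x) = (\<Sum>f\<in>S. a f * g f x)"
        using u True by (intro sum.cong refl) (auto simp: g_def restr_def)
      then show ?thesis using that by simp
    next
      case False
      then show ?thesis using u by (intro sum.neutral) auto
    qed
    then show ?thesis using S(4) unfolding lin_indep_fun_def by blast
  qed
  from independent_family[of S g, OF S(2) ind] have "inj_on g S" "lin_indep_fun (g ` S)" by auto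
  moreover have "\<exists>\<xi> v. \<xi> \<le> ball_eigval d k \<and> steklov_solution (ball 0 1) \<xi> v \<and> g f = restr (ball 0 1) v"
    if "f \<in> S" for f
    using u that unfolding g_def by blast
  ultimately show ?thesis
    using S by (intro exI[of _ "g ` S"]) (auto simp: card_image)
qed

text \<open>Completeness of the spherical harmonics, sphere by sphere; for the centre of the ball
  any unit vector represents the point.\<close>

lemma shell_vanish:
  fixes u :: "'a::euclidean_space \<Rightarrow> real"
  assumes u: "continuous_on (shell e) u" and e: "0 \<le> e" "e \<le> 1"
    and z: "\<And>j Y r. solid_harmonic j Y \<Longrightarrow> r \<in> {e..1} \<Longrightarrow> sph_coeff Y u r = 0"
    and x: "x \<in> shell e"
  shows "u x = 0"
proof -
  define r where "r = norm x"
  have r: "r \<in> {e..1}" using x by (auto simp: shell_def r_def)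
  obtain \<omega> where w: "norm \<omega> = 1" "x = r *\<^sub>R \<omega>"
  proof (cases "x = 0")
    case True
    obtain b :: 'a where "b \<in> Basis" using SOME_Basis by blast
    then show ?thesis using that[of b] True by (simp add: r_def)
  next
    case False
    then show ?thesis using that[of "x /\<^sub>R r"] by (simp add: r_def)
  qed
  have "continuous_on (sphere 0 1) (\<lambda>\<omega>. u (r *\<^sub>R \<omega>))"
    using r e by (intro continuous_on_compose2[OF u] continuous_intros) (auto simp: shell_def)
  from sphere_mean_complete[OF this _ w(1)] z r show ?thesis
    unfolding w(2) sph_coeff_def by blast
qed

lemma shell_eigenfunction_continuous:
  "shell_eigenfunction e \<xi> u \<Longrightarrow> continuous_on (shell e) u"
  unfolding shell_eigenfunction_def using smooth_on_continuous continuous_on_subset by blast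

text \<open>On the ball the inner boundary term has weight 0, so the energy of each mode is \<xi>
  c(1)^2. With \<xi> < 0 both sides vanish, and \<open>radial_vanish\<close> removes the mode. This
  supplies the lower bound that the infimum needs.\<close>

lemma ball_eigenvalue_nonneg:
  fixes u :: "'a::euclidean_space \<Rightarrow> real"
  assumes u: "shell_eigenfunction 0 \<xi> u" and neg: "\<xi> < 0" and n: "DIM('a) = d + 2" and x: "norm x \<le> 1"
  shows "u x = 0"
proof (rule shell_vanish[OF shell_eigenfunction_continuous[OF u]])
  fix j and Y :: "'a \<Rightarrow> real" and r :: real
  assume Y: "solid_harmonic j Y" and r: "r \<in> {0..1}"
  note m = shell_eigenfunction_mode[OF u _ _ Y n, simplified]
  have prof: "radial_profile d (real j * real (j + d)) 0 (sph_coeff Y u)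
      (sph_coeff Y (euler_deriv u)) (sph_coeff Y (laplacian u))"
    using m by (simp add: radial_mode_def)
  have E: "radial_energy d 0 (sph_coeff Y (laplacian u)) = \<xi> * (sph_coeff Y u 1)\<^sup>2"
    using radial_mode_pairing[OF m m] unfolding radial_energy_def
    by (simp add: power2_eq_square integral_unique)
  have "radial_energy d 0 (sph_coeff Y (laplacian u)) \<ge> 0" by (rule radial_energy_nonneg) simp
  then have "(sph_coeff Y u 1)\<^sup>2 \<le> 0" unfolding E using neg by (simp add: zero_le_mult_iff)
  then have "sph_coeff Y u 1 = 0" by simp
  with radial_vanish[OF prof _ _ _ r] show "sph_coeff Y u r = 0" unfolding E by simp
qed (use x in \<open>auto simp: shell_def\<close>)

lemma steklov_eigenvalue_ball_bdd:
  assumes n: "DIM('a::euclidean_space) = d + 2"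
    and F: "finite F" "card F = Suc m" "lin_indep_fun (F :: ('a \<Rightarrow> real) set)"
      "\<forall>f\<in>F. \<exists>\<xi> u. \<xi> \<le> t \<and> steklov_solution (ball 0 1) \<xi> u \<and> f = restr (ball 0 1) u"
  shows "0 \<le> t"
proof (rule ccontr)
  assume "\<not> 0 \<le> t"
  obtain f where f: "f \<in> F" using F(2) by fastforce
  then obtain \<xi> u where u: "\<xi> \<le> t" "steklov_solution (ball 0 1) \<xi> u" "f = restr (ball 0 1) u" using F(4) by blast
  have "u x = 0" if "norm x \<le> 1" for x
    using ball_eigenvalue_nonneg[OF steklov_solution_ball[OF u(2)] _ n that] u(1) \<open>\<not> 0 \<le> t\<close> by simp
  then have "f x = 0" for x unfolding u(3) restr_def by simp
  then show False using lin_indep_fun_nonzero[OF F(3,1) f] by blast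
qed

lemma steklov_eigenvalue_ball_upper:
  assumes n: "DIM('a::euclidean_space) = d + 2"
    and S: "S \<subseteq> sph_harm k" "finite S" "card S = Suc m" "lin_indep_fun (S :: ('a \<Rightarrow> real) set)"
  shows "steklov_eigenvalue m (ball (0::'a) 1) \<le> ball_eigval d k"
  unfolding steklov_eigenvalue_def
  using steklov_eigenvalue_ball_le[OF n S] steklov_eigenvalue_ball_bdd[OF n]
  by (intro cInf_lower bdd_belowI[of _ 0]) auto

text \<open>Nonemptiness of the set under the infimum; otherwise a lower bound on its members would
  say nothing about \<open>Inf\<close>.\<close>

lemma annulus_eigenfunctions_exist:
  assumes n: "DIM('a::euclidean_space) = d + 2" and e: "0 < e" "e < 1"
  shows "\<exists>t. \<exists>F :: ('a \<Rightarrow> real) set. finite F \<and> card F = Suc m \<and> lin_indep_fun F \<and>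
    (\<forall>f\<in>F. \<exists>\<xi> u. \<xi> \<le> t \<and> steklov_solution (annulus e) \<xi> u \<and> f = restr (annulus e) u)"
proof -
  have n2: "DIM('a) \<ge> 2" using n by simp
  \<comment> \<open>m + 1 degrees, one eigenfunction each, starting at 2 as
    \<open>annulus_eigenfunction\<close> requires.\<close>
  define I where "I = {2..m + 2}"
  define Q where "Q j P p u \<xi> c \<longleftrightarrow> solid_harmonic j P \<and> norm p = 1 \<and> P p = 1 \<and>
      shell_eigenfunction e \<xi> u \<and> (c 1 \<noteq> 0 \<or> c e \<noteq> 0) \<and>
      (\<forall>r \<omega>. 0 < r \<longrightarrow> norm \<omega> = 1 \<longrightarrow> u (r *\<^sub>R \<omega>) = c r * P \<omega>)"
    for j \<xi> and P u :: "'a \<Rightarrow> real" and p :: 'a and c :: "real \<Rightarrow> real"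
  have "\<forall>j\<in>I. \<exists>P p u \<xi> c. Q j P p u \<xi> c"
  proof
    fix j assume j: "j \<in> I"
    obtain P and p :: 'a where P: "solid_harmonic j P" "norm p = 1" "P p = 1" using solid_harmonic_exists[OF n2] by blast
    have j2: "2 \<le> j" using j by (simp add: I_def)
    obtain u \<xi> c where "shell_eigenfunction e \<xi> u" "c 1 \<noteq> 0 \<or> c e \<noteq> 0"
      "\<forall>r \<omega>. 0 < r \<longrightarrow> norm \<omega> = 1 \<longrightarrow> u (r *\<^sub>R \<omega>) = c r * P \<omega>"
      using annulus_eigenfunction[OF e P(1) j2 n] by metis
    then have "Q j P p u \<xi> c" unfolding Q_def using P by blast
    then show "\<exists>P p u \<xi> c. Q j P p u \<xi> c" by blast
  qed
  then obtain P p u \<xi> c where Q: "\<And>j. j \<in> I \<Longrightarrow> Q j (P j) (p j) (u j) (\<xi> j) (c j)" by metis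
  have P: "solid_harmonic j (P j)" "norm (p j) = 1 \<and> P j (p j) = 1" if "j \<in> I" for j
    using Q[OF that] by (auto simp: Q_def)
  have u: "shell_eigenfunction e (\<xi> j) (u j)" if "j \<in> I" for j using Q[OF that] by (simp add: Q_def)
  have c: "c j 1 \<noteq> 0 \<or> c j e \<noteq> 0" if "j \<in> I" for j using Q[OF that] by (simp add: Q_def)
  have c2: "u j (r *\<^sub>R \<omega>) = c j r * P j \<omega>" if "j \<in> I" "0 < r" "norm \<omega> = 1" for j r \<omega>
    using Q[OF that(1)] that(2,3) by (simp add: Q_def)
  define g where "g j = restr (annulus e) (u j)" for j
  have fin: "finite I" "card I = Suc m" by (auto simp: I_def)
  have ind: "\<forall>j\<in>I. a j = 0" if z: "\<And>x. (\<Sum>j\<in>I. a j * g j x) = 0" for a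
  proof
    fix k assume k: "k \<in> I"
    have "a k * c k r = 0" if r: "0 < r" "e \<le> r" "r \<le> 1" for r
    proof (rule solid_harmonic_family_independent[OF n2 fin(1) P _ k, of "\<lambda>j. a j * c j r"])
      fix \<omega> :: 'a assume w: "norm \<omega> = 1"
      have "r *\<^sub>R \<omega> \<in> closure (annulus e)" unfolding closure_annulus[OF e] using r w by (simp add: shell_def)
      then have "(\<Sum>j\<in>I. a j * g j (r *\<^sub>R \<omega>)) = (\<Sum>j\<in>I. a j * c j r * P j \<omega>)"
        using c2[OF _ r(1) w] by (intro sum.cong refl) (simp add: g_def restr_def)
      then show "(\<Sum>j\<in>I. a j * c j r * P j \<omega>) = 0" using z by simp
    qed
    from this[of 1] this[of e] c[OF k] e show "a k = 0" by auto
  qed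
  from independent_family[of I g, OF fin(1) ind] have gi: "inj_on g I" "lin_indep_fun (g ` I)" by auto
  have "\<exists>\<xi>' v. \<xi>' \<le> Max (\<xi> ` I) \<and> steklov_solution (annulus e) \<xi>' v \<and> g j = restr (annulus e) v"
    if "j \<in> I" for j
    using u[OF that] fin(1) that unfolding steklov_solution_annulus[OF e, symmetric]
    by (intro exI[of _ "\<xi> j"] exI[of _ "u j"]) (auto simp: g_def)
  then show ?thesis
    using gi fin by (intro exI[of _ "Max (\<xi> ` I)"] exI[of _ "g ` I"]) (auto simp: card_image)
qed

text \<open>The counting argument in place of min-max. A combination of the m + 1 eigenfunctions is
  kept an honest competitor by \<open>radial_mode_sum_energy\<close>: its energy is at most t times
  its boundary norm although it is no eigenfunction itself.\<close>

lemma steklov_eigenvalue_annulus_lower: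
  assumes n: "DIM('a::euclidean_space) = d + 2" and e: "0 < e" "e \<le> 1/2" and k: "k \<ge> 1"
    and no: "\<And>S. S \<subseteq> sph_harm (k - 1) \<Longrightarrow> finite S \<Longrightarrow> lin_indep_fun (S :: ('a \<Rightarrow> real) set) \<Longrightarrow> card S \<le> m"
    and se: "ball_eigval d k * e < 1/4"
  shows "steklov_eigenvalue m (annulus e :: 'a set) \<ge> ball_eigval d k - (eigval_loss d k)\<^sup>2 * e ^ (2 * k + d)"
proof -
  define T where "T = ball_eigval d k - (eigval_loss d k)\<^sup>2 * e ^ (2 * k + d)"
  have e1: "0 < e" "e < 1" "0 \<le> e" using e by auto
  have main: "T \<le> t" if F: "finite F" "card F = Suc m" "lin_indep_fun (F :: ('a \<Rightarrow> real) set)"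
      "\<forall>f\<in>F. \<exists>\<xi> u. \<xi> \<le> t \<and> steklov_solution (annulus e) \<xi> u \<and> f = restr (annulus e) u" for t F
  proof (rule ccontr)
    assume "\<not> T \<le> t"
    then have tT: "t < T" by simp
    also have "T \<le> ball_eigval d k" unfolding T_def using e by simp
    finally have te: "t * e < 1/4" using se mult_strict_right_mono[of t "ball_eigval d k" e] e by linarith
    obtain \<xi> u where u: "\<And>f. f \<in> F \<Longrightarrow> \<xi> f \<le> t" "\<And>f. f \<in> F \<Longrightarrow> shell_eigenfunction e (\<xi> f) (u f)"
      "\<And>f. f \<in> F \<Longrightarrow> f = restr (annulus e) (u f)"
      using F(4) unfolding steklov_solution_annulus[OF e1(1,2)] by metis
    have cu: "continuous_on (shell e) (u f)" if "f \<in> F" for f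
      by (rule shell_eigenfunction_continuous[OF u(2)[OF that]])
    have cur: "continuous_on (sphere 0 1) (\<lambda>\<omega>. u f (r *\<^sub>R \<omega>))" if "f \<in> F" "r \<in> {e..1}" for f r
      using that e by (intro continuous_on_compose2[OF cu] continuous_intros) (auto simp: shell_def)
    define adm where "adm S \<longleftrightarrow> S \<subseteq> sph_harm (k - 1) \<and> finite S \<and> lin_indep_fun S" for S :: "('a \<Rightarrow> real) set"
    have "adm {}" by (simp add: adm_def lin_indep_fun_def)
    moreover have "\<forall>S. adm S \<longrightarrow> card S < Suc m" using no by (auto simp: adm_def less_Suc_eq_le)
    ultimately obtain S where S: "adm S" and max: "\<And>S'. adm S' \<Longrightarrow> card S' \<le> card S"
      using ex_has_greatest_nat[of adm "{}" card "Suc m"] by blast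
    have fS: "finite S" "card S < card F" using S no[of S] F(2) by (auto simp: adm_def less_Suc_eq_le)
    \<comment> \<open>An independent set of maximal size spans, so conditions against
      \<open>S\<close> control every harmonic of degree below k.\<close>
    have span: "\<exists>c. \<forall>x. f x = (\<Sum>g\<in>S. c g * g x)" if f: "f \<in> sph_harm (k - 1)" for f
    proof (cases "f \<in> S")
      case True
      then show ?thesis using fS(1)
        by (intro exI[of _ "\<lambda>g. if g = f then 1 else 0"]) (simp add: if_distrib[of "\<lambda>c. c * _"] cong: if_cong)
    next
      case False
      have "\<not> lin_indep_fun (insert f S)"
        using max[of "insert f S"] False S f fS(1) by (auto simp: adm_def)
      then show ?thesis using lin_indep_fun_span S False by (auto simp: adm_def)
    qed
    define G where "G g f = sphere_mean (\<lambda>\<omega>. u f (1 *\<^sub>R \<omega>) * g \<omega>)" for g f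
    \<comment> \<open>At most m conditions on m + 1 functions; they concern the outer sphere
      only.\<close>
    from underdetermined_system[OF fS(1) F(1) fS(2), of G] obtain a where
      a: "\<exists>f\<in>F. a f \<noteq> 0" "\<And>g. g \<in> S \<Longrightarrow> (\<Sum>f\<in>F. a f * G g f) = 0" by blast
    define v where "v x = (\<Sum>f\<in>F. a f * u f x)" for x
    have cv: "continuous_on (shell e) v"
      unfolding v_def[abs_def] by (intro continuous_on_sum continuous_on_mult_left cu)
    have coeff: "sph_coeff Y v r = (\<Sum>f\<in>F. a f * sph_coeff Y (u f) r)" if Y: "solid_harmonic j Y" and r: "r \<in> {e..1}" for j Y r
    proof -
      have "sph_coeff Y v r = sphere_mean (\<lambda>\<omega>. \<Sum>f\<in>F. a f * (u f (r *\<^sub>R \<omega>) * Y \<omega>))"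
        unfolding sph_coeff_def v_def by (simp add: sum_distrib_right mult.assoc)
      also have "\<dots> = (\<Sum>f\<in>F. a f * sph_coeff Y (u f) r)"
        unfolding sph_coeff_def sphere_mean_cmult[symmetric]
        by (intro sphere_mean_sum continuous_on_mult_left continuous_on_mult cur r solid_harmonic_continuous[OF Y])
      finally show ?thesis .
    qed
    have low: "sph_coeff Y v 1 = 0" if Y: "solid_harmonic j Y" and j: "j < k" for j and Y :: "'a \<Rightarrow> real"
    proof -
      have "j \<le> k - 1" using j by simp
      then have "on_sphere Y \<in> sph_harm (k - 1)" using Y unfolding sph_harm_def by blast
      from span[OF this] obtain c where c: "\<And>x. on_sphere Y x = (\<Sum>g\<in>S. c g * g x)" by blast
      have cg: "continuous_on (sphere 0 1) g" if "g \<in> S" for g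
      proof -
        obtain Z i where Z: "g = on_sphere Z" "solid_harmonic i Z" using S \<open>g \<in> S\<close> by (auto simp: adm_def sph_harm_def)
        have "continuous_on (sphere 0 1) g \<longleftrightarrow> continuous_on (sphere 0 1) Z"
          by (rule continuous_on_cong) (auto simp: Z(1) on_sphere_def)
        then show ?thesis using solid_harmonic_continuous[OF Z(2)] by simp
      qed
      have "sph_coeff Y (u f) 1 = (\<Sum>g\<in>S. c g * G g f)" if f: "f \<in> F" for f
      proof -
        have "sph_coeff Y (u f) 1 = sphere_mean (\<lambda>\<omega>. \<Sum>g\<in>S. c g * (u f (1 *\<^sub>R \<omega>) * g \<omega>))"
          unfolding sph_coeff_def
        proof (rule sphere_mean_cong)
          fix \<omega> :: 'a assume "norm \<omega> = 1"
          then have "Y \<omega> = (\<Sum>g\<in>S. c g * g \<omega>)" using c[of \<omega>] by (simp add: on_sphere_def)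
          then show "u f (1 *\<^sub>R \<omega>) * Y \<omega> = (\<Sum>g\<in>S. c g * (u f (1 *\<^sub>R \<omega>) * g \<omega>))"
            by (simp add: sum_distrib_left mult.left_commute)
        qed
        also have "\<dots> = (\<Sum>g\<in>S. c g * G g f)"
          unfolding G_def sphere_mean_cmult[symmetric]
          by (intro sphere_mean_sum continuous_on_mult_left continuous_on_mult cur f cg) (use e in auto)
        finally show ?thesis .
      qed
      then have "sph_coeff Y v 1 = (\<Sum>f\<in>F. \<Sum>g\<in>S. c g * (a f * G g f))"
        using coeff[OF Y, of 1] e by (simp add: sum_distrib_left mult.left_commute)
      also have "\<dots> = (\<Sum>g\<in>S. c g * (\<Sum>f\<in>F. a f * G g f))"
        by (subst sum.swap) (simp add: sum_distrib_left)
      finally show ?thesis using a(2) by simp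
    qed
    have zero: "sph_coeff Y v r = 0" if Y: "solid_harmonic j Y" and r: "r \<in> {e..1}" for j r and Y :: "'a \<Rightarrow> real"
    proof -
      note m = shell_eigenfunction_mode[OF u(2) e1(3,2) Y n]
      let ?c = "\<lambda>r. \<Sum>f\<in>F. a f * sph_coeff Y (u f) r"
      let ?w = "\<lambda>r. \<Sum>f\<in>F. a f * sph_coeff Y (laplacian (u f)) r"
      have prof: "radial_profile d (real j * real (j + d)) e ?c
          (\<lambda>r. \<Sum>f\<in>F. a f * sph_coeff Y (euler_deriv (u f)) r) ?w"
        using m e1 by (intro radial_profile_sum F(1)) (auto simp: radial_mode_def)
      have E: "radial_energy d e ?w \<le> t * ((?c 1)\<^sup>2 + e ^ Suc d * (?c e)\<^sup>2)"
        by (rule radial_mode_sum_energy[OF F(1) m u(1) e1(3)])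
      \<comment> \<open>Degrees from k on vanish because t lies below the energy bound, lower
        degrees because their outer value has been removed.\<close>
      have "?c r = 0"
      proof (cases "k \<le> j")
        case True
        show ?thesis
          by (rule radial_vanish_high[OF prof e k True E _ _ r]) (use tT te in \<open>auto simp: T_def\<close>)
      next
        case False
        then have "?c 1 = 0" using low[OF Y] coeff[OF Y, of 1] e by simp
        then show ?thesis by (rule radial_vanish_low[OF prof e _ E te r])
      qed
      then show ?thesis using coeff[OF Y r] by simp
    qed
    have vz: "v x = 0" if "x \<in> shell e" for x
      by (rule shell_vanish[OF cv _ _ zero that]) (use e in auto)
    have "(\<Sum>f\<in>F. a f * f x) = 0" for x
    proof -
      have "(\<Sum>f\<in>F. a f * f x) = (\<Sum>f\<in>F. a f * restr (annulus e) (u f) x)"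
        using u(3) by (intro sum.cong refl) (metis (full_types))
      also have "\<dots> = (if x \<in> shell e then v x else 0)"
        by (simp add: restr_def closure_annulus[OF e1(1,2)] v_def)
      finally show ?thesis using vz by simp
    qed
    then have "\<forall>f\<in>F. a f = 0" using F(3) unfolding lin_indep_fun_def by blast
    then show False using a(1) by blast
  qed
  show ?thesis
    unfolding steklov_eigenvalue_def T_def[symmetric]
    using annulus_eigenfunctions_exist[OF n e1(1,2), of m] main
    by (intro cInf_greatest) auto
qed

text \<open>The least k for which the harmonics of degree at most k contain m + 1 independent ones
  serves both sides: they give the upper bound on the ball, and minimality limits the conditions on
  the annulus to m.\<close>

lemma degree_cutoff:
  assumes n: "DIM('a::euclidean_space) \<ge> 2" and m: "m \<ge> 1"
  obtains k and S :: "('a::euclidean_space \<Rightarrow> real) set" where "k \<ge> 1"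
    "S \<subseteq> sph_harm k" "finite S" "card S = Suc m" "lin_indep_fun S"
    "\<And>S :: ('a::euclidean_space \<Rightarrow> real) set. S \<subseteq> sph_harm (k - 1) \<Longrightarrow> finite S \<Longrightarrow> lin_indep_fun S \<Longrightarrow> card S \<le> m"
proof -
  define Q where "Q k \<longleftrightarrow> (\<exists>S :: ('a \<Rightarrow> real) set. S \<subseteq> sph_harm k \<and> finite S \<and> card S = Suc m \<and> lin_indep_fun S)" for k
  have "Q m"
  proof -
    have "\<forall>j\<in>{..m}. \<exists>P p. solid_harmonic j (P :: 'a \<Rightarrow> real) \<and> norm p = 1 \<and> P p = 1"
      using solid_harmonic_exists[OF n] by metis
    then obtain P p where P: "\<And>j. j \<le> m \<Longrightarrow> solid_harmonic j (P j :: 'a \<Rightarrow> real)"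
      "\<And>j. j \<le> m \<Longrightarrow> norm (p j) = 1 \<and> P j (p j) = 1" by (metis atMost_iff)
    have ind: "\<forall>j\<in>{..m}. a j = 0" if z: "\<And>x. (\<Sum>j\<le>m. a j * on_sphere (P j) x) = 0" for a
    proof
      fix j assume j: "j \<in> {..m}"
      show "a j = 0"
      proof (rule solid_harmonic_family_independent[OF n finite_atMost[of m] _ _ _ j])
        show "(\<Sum>i\<le>m. a i * P i \<omega>) = 0" if "norm \<omega> = 1" for \<omega>
          using z[of \<omega>] that by (simp add: on_sphere_def)
      qed (use P in auto)
    qed
    from independent_family[of "{..m}" "\<lambda>j. on_sphere (P j)", OF finite_atMost ind]
    have "inj_on (\<lambda>j. on_sphere (P j)) {..m}" "lin_indep_fun ((\<lambda>j. on_sphere (P j)) ` {..m})" by auto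
    then show ?thesis unfolding Q_def
      using P(1) by (intro exI[of _ "(\<lambda>j. on_sphere (P j)) ` {..m}"]) (auto simp: card_image sph_harm_def)
  qed
  \<comment> \<open>In degree 0 only constants on the sphere occur, any two of them dependent, while
    m + 1 >= 2. This gives k >= 1, on which the order of the loss depends.\<close>
  have "\<not> Q 0"
  proof
    assume "Q 0"
    then obtain S :: "('a \<Rightarrow> real) set" where S: "S \<subseteq> sph_harm 0" "finite S" "card S = Suc m" "lin_indep_fun S"
      by (auto simp: Q_def)
    have const: "\<exists>c. f = (\<lambda>x. if norm x = 1 then c else 0)" if f: "f \<in> S" for f
    proof -
      obtain Y where Y: "f = on_sphere Y" "hpoly 0 Y" using S(1) f by (auto simp: sph_harm_def solid_harmonic_def)
      have "Y x = Y 0" for x using hpoly_homogeneous[OF Y(2), of 0 x] by simp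
      then show ?thesis unfolding Y(1) on_sphere_def by metis
    qed
    have "\<not> card S \<le> Suc 0" using S(3) m by simp
    then obtain f g where fg: "f \<in> S" "g \<in> S" "f \<noteq> g" using S(2) by (metis card_le_Suc0_iff_eq)
    obtain b c where bc: "f = (\<lambda>x. if norm x = 1 then b else 0)" "g = (\<lambda>x. if norm x = 1 then c else 0)"
      using const[OF fg(1)] const[OF fg(2)] by blast
    define a where "a h = (if h = f then c else if h = g then - b else 0)" for h
    have "(\<Sum>h\<in>S. a h * h x) = 0" for x
    proof -
      have "(\<Sum>h\<in>S. a h * h x) = (\<Sum>h\<in>S. (if h = f then c * f x else 0) + (if h = g then - b * g x else 0))"
        by (intro sum.cong refl) (use fg in \<open>auto simp: a_def\<close>)
      also have "\<dots> = c * f x - b * g x" using fg S(2) by (simp add: sum.distrib)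
      also have "\<dots> = 0" by (simp add: bc)
      finally show ?thesis .
    qed
    then have "\<forall>h\<in>S. a h = 0" using S(4) unfolding lin_indep_fun_def by blast
    then have 0: "c = 0" "b = 0" using fg unfolding a_def by (auto split: if_splits)
    have "f = g" unfolding bc 0 ..
    then show False using fg(3) by simp
  qed
  define k where "k = (LEAST k. Q k)"
  have Qk: "Q k" unfolding k_def using \<open>Q m\<close> by (rule LeastI)
  then have k: "k \<ge> 1" using \<open>\<not> Q 0\<close> by (cases k) auto
  then have nQ: "\<not> Q (k - 1)" unfolding k_def by (metis Qk diff_less k_def less_numeral_extra(1) less_le_trans not_less_Least zero_less_one)
  have bound: "card S \<le> m" if S: "S \<subseteq> sph_harm (k - 1)" "finite S" "lin_indep_fun S" for S :: "('a \<Rightarrow> real) set"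
  proof (rule ccontr)
    assume "\<not> card S \<le> m"
    then obtain T where "T \<subseteq> S" "card T = Suc m" "finite T"
      using obtain_subset_with_card_n[of "Suc m" S] by (metis not_less_eq_eq)
    then have "Q (k - 1)" unfolding Q_def using S lin_indep_fun_subset[OF S(3) _ S(2)] by blast
    then show False using nQ by blast
  qed
  from Qk obtain S :: "('a \<Rightarrow> real) set" where "S \<subseteq> sph_harm k" "finite S" "card S = Suc m" "lin_indep_fun S"
    by (auto simp: Q_def)
  from that[OF k this bound] show ?thesis by blast
qed

text \<open>The boundary area gains a term of order \<open>e^(d+1)\<close>, while the eigenvalue loses only
  a term of order \<open>e^(2k+d)\<close>.\<close>

lemma radius_choice:
  assumes k: "k \<ge> 1" and p: "p > 0"
  obtains e where "0 < e" "e \<le> 1/2" "ball_eigval d k * e < 1/4"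
    "(ball_eigval d k - (eigval_loss d k)\<^sup>2 * e ^ (2 * k + d)) * (1 + e ^ Suc d) powr p > ball_eigval d k"
proof -
  define s where "s = ball_eigval d k"
  define L where "L = (eigval_loss d k)\<^sup>2"
  \<comment> \<open>Expanding (s - L e y) (1 + p y / 2) - s and dividing by y leaves at least s p /
    2 - L e (1 + p / 2), since y <= 1. \<open>M\<close> bounds this coefficient of \<open>e\<close>,
    and the summand 1 keeps it positive.\<close>
  define M where "M = L * (1 + p / 2) + 1"
  have s: "s > 0" unfolding s_def ball_eigval_def using k by simp
  have L: "L \<ge> 0" by (simp add: L_def)
  have M: "M > 0" unfolding M_def using L p by (intro add_nonneg_pos mult_nonneg_nonneg) auto
  \<comment> \<open>The second entry gives s e <= 1/8, the third M e <= s p / 4; both are half of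
    the permitted value, which makes the inequalities strict.\<close>
  define e where "e = Min {1/2, 1 / (8 * s), s * p / (4 * M)}"
  have e: "0 < e" "e \<le> 1/2" "e \<le> 1 / (8 * s)" "e \<le> s * p / (4 * M)"
    using s p M by (auto simp: e_def)
  define y where "y = e ^ Suc d"
  have y: "0 < y" "y \<le> 1" using e by (auto simp: y_def intro!: power_le_one mult_le_one)
  have se: "s * e < 1/4"
  proof -
    have "s * e \<le> s * (1 / (8 * s))" using s by (intro mult_left_mono e) auto
    also have "\<dots> < 1/4" using s by simp
    finally show ?thesis .
  qed
  have pw: "(1 + y) powr p \<ge> 1 + p * y / 2"
  proof -
    \<comment> \<open>Linear lower bound for the power: ln (1 + y) >= y / (1 + y) >= y / 2 for y <=
      1, followed by exp u >= 1 + u.\<close>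
    have "y / 2 \<le> y / (1 + y)" using y by (intro divide_left_mono) auto
    also have "\<dots> \<le> ln (1 + y)"
    proof -
      have "ln (1 / (1 + y)) \<le> 1 / (1 + y) - 1" using y by (intro ln_le_minus_one) auto
      moreover have "ln (1 / (1 + y)) = - ln (1 + y)" using y by (simp add: ln_div)
      moreover have "1 / (1 + y) - 1 = - (y / (1 + y))" using y by (simp add: field_simps)
      ultimately show ?thesis by simp
    qed
    finally have "p * y / 2 \<le> p * ln (1 + y)" using p mult_left_mono[of "y / 2" "ln (1 + y)" p] by simp
    then have "1 + p * y / 2 \<le> exp (p * ln (1 + y))"
      using exp_ge_add_one_self[of "p * ln (1 + y)"] by linarith
    then show ?thesis using y by (simp add: powr_def)
  qed
  have el: "L * e ^ (2 * k + d) \<le> L * e * y"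
  proof -
    \<comment> \<open>k >= 1 makes the exponent at least d + 2, one more than that of the area gain
      \<open>y\<close>.\<close>
    have "e ^ (2 * k + d) \<le> e ^ Suc (Suc d)" using e k by (intro power_decreasing) auto
    also have "\<dots> = e * y" by (simp add: y_def)
    finally show ?thesis using L mult_left_mono[of _ _ L] by (simp add: mult.assoc)
  qed
  have Me: "L * e * (1 + p / 2) < s * p / 2"
  proof -
    have "L * e * (1 + p / 2) \<le> M * e" using e unfolding M_def by (simp add: algebra_simps)
    also have "\<dots> \<le> M * (s * p / (4 * M))" using M by (intro mult_left_mono e) auto
    also have "\<dots> < s * p / 2" using M s p by simp
    finally show ?thesis .
  qed
  define X Z where "X = s - L * e * y" and "Z = 1 + p * y / 2"
  have XZ: "X * Z > s"
  proof -
    have "L * e * (p * y / 2) \<le> L * e * (p / 2)"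
      using L e y p by (intro mult_left_mono mult_nonneg_nonneg) auto
    then have "0 < s * p / 2 - L * e - L * e * (p * y / 2)" using Me by (simp add: algebra_simps)
    from mult_pos_pos[OF y(1) this] show ?thesis by (simp add: X_def Z_def algebra_simps)
  qed
  have Z: "Z > 0" using p y by (simp add: Z_def add_pos_pos)
  have X: "X > 0" using XZ s Z by (metis less_trans zero_less_mult_pos2)
  have "s < X * Z" by (rule XZ)
  also have "\<dots> \<le> (s - L * e ^ (2 * k + d)) * (1 + y) powr p"
    using X Z el pw by (intro mult_mono) (auto simp: X_def Z_def)
  finally show ?thesis
    using e se unfolding s_def L_def y_def by (intro that[of e]) auto
qed

theorem theorem1p2:
  fixes m :: nat
  assumes "DIM('a::euclidean_space) \<ge> 2" and "m \<ge> 1"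
  shows "\<exists>\<Omega> :: 'a set. smooth_bounded_domain \<Omega> \<and>
    steklov_eigenvalue m \<Omega> * boundary_area \<Omega> powr (3 / (real DIM('a) - 1)) >
    steklov_eigenvalue m (ball (0::'a) 1) * boundary_area (ball (0::'a) 1) powr (3 / (real DIM('a) - 1))"
proof -
  define d where "d = DIM('a) - 2"
  define p where "p = 3 / (real DIM('a) - 1)"
  have n: "DIM('a) = d + 2" using assms(1) by (simp add: d_def)
  have p: "p > 0" using assms(1) by (simp add: p_def)
  obtain k and S :: "('a \<Rightarrow> real) set" where k: "k \<ge> 1"
    and S: "S \<subseteq> sph_harm k" "finite S" "card S = Suc m" "lin_indep_fun S"
    and max: "\<And>S :: ('a \<Rightarrow> real) set. S \<subseteq> sph_harm (k - 1) \<Longrightarrow> finite S \<Longrightarrow> lin_indep_fun S \<Longrightarrow> card S \<le> m"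
    using degree_cutoff[OF assms] by blast
  obtain e where e: "0 < e" "e \<le> 1/2" and se: "ball_eigval d k * e < 1/4"
    and gain: "(ball_eigval d k - (eigval_loss d k)\<^sup>2 * e ^ (2 * k + d)) * (1 + e ^ Suc d) powr p > ball_eigval d k"
    using radius_choice[OF k p] by blast
  have e1: "0 < e" "e < 1" using e by auto
  define \<tau> where "\<tau> = ball_eigval d k - (eigval_loss d k)\<^sup>2 * e ^ (2 * k + d)"
  define a where "a = boundary_area (ball (0::'a) 1)"
  have a: "a > 0" unfolding a_def by (rule boundary_area_ball_pos[OF assms(1)])
  have sig: "ball_eigval d k \<ge> 0" by (simp add: ball_eigval_def)
  \<comment> \<open>Positivity of the lower bound is read off from the gain inequality; it is what
    permits multiplying the bounds for eigenvalue and area.\<close>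
  have "0 < \<tau> * (1 + e ^ Suc d) powr p" using gain sig unfolding \<tau>_def by linarith
  moreover have "1 + e ^ Suc d > 0" using e by (intro add_pos_pos) auto
  ultimately have tau: "\<tau> > 0" by (simp add: zero_less_mult_iff)
  have low: "steklov_eigenvalue m (annulus e :: 'a set) \<ge> \<tau>"
    unfolding \<tau>_def by (rule steklov_eigenvalue_annulus_lower[OF n e k max se])
  have area: "boundary_area (annulus e :: 'a set) \<ge> (1 + e ^ Suc d) * a"
    using boundary_area_annulus[OF assms(1) e1] by (simp add: a_def n)
  have "steklov_eigenvalue m (ball (0::'a) 1) * a powr p \<le> ball_eigval d k * a powr p"
    by (rule mult_right_mono[OF steklov_eigenvalue_ball_upper[OF n S]]) simp
  also have "\<dots> < (\<tau> * (1 + e ^ Suc d) powr p) * a powr p"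
    using gain a unfolding \<tau>_def by (intro mult_strict_right_mono) auto
  also have "\<dots> = \<tau> * ((1 + e ^ Suc d) * a) powr p"
    by (simp add: powr_mult mult.assoc)
  also have "\<dots> \<le> steklov_eigenvalue m (annulus e :: 'a set) * boundary_area (annulus e :: 'a set) powr p"
    using low area tau a e p by (intro mult_mono powr_mono2) auto
  finally show ?thesis
    using smooth_bounded_domain_annulus[OF assms(1) e1] unfolding a_def p_def by blast
qed

end
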